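(* Let $\{X_i\}_{i\geq1}$ be a time-homogeneous Markov chain on $(\mathcal{X},\mathcal{B})$ with invariant probability measure $\pi$, absolute spectral gap $1-\lambda$ and right spectral gap $1-\lambda_r$. Suppose the initial measure $\nu$ (the law of $X_1$) is absolutely continuous with respect to $\pi$ and its density $d\nu/d\pi$ has a finite $p$-moment for some $p\in(1,\infty]$, i.e. $\|d\nu/d\pi\|_{\pi,p}<\infty$. Let $q=p/(p-1)\in[1,\infty)$ (with $q=1$ if $p=\infty$), let $n_0\ge0$ be an integer, and let $$C_p(\nu,n_0)=\begin{cases}1+2^{2/p}\lambda^{2n_0/q}\left\|\frac{d\nu}{d\pi}-1\right\|_{\pi,p}&\text{if }p\in(1,2),\\ 1+\lambda^{n_0}\left\|\frac{d\nu}{d\pi}-1\right\|_{\pi,2}&\text{if }p=2,\\ 1+2^{2/q}\lambda^{2n_0/p}\left\|\frac{d\nu}{d\pi}-1\right\|_{\pi,p}&\text{if }p\in(2,\infty),\\ \left\|\frac{d\nu}{d\pi}\right\|_{\pi,\infty}=\operatorname{ess\,sup}\frac{d\nu}{d\pi}&\text{if }p=\infty.\end{cases}$$ Then, for any $n\ge1$, any bounded measurable function $f:\mathcal{X}\to[a,b]$ and any $t\in\mathbb{R}$, $$\mathbb{E}_\nu\left[e^{t\left(\sum_{i=n_0+1}^{n_0+n}f(X_i)-n\pi(f)\right)}\right]\leq C_p(\nu,n_0)\exp\left(\frac{t^2}{2}\cdot q\,\alpha(\lambda_r\vee0)\cdot\frac{n(b-a)^2}{4}\right).$$ It follows that for any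 $\epsilon>0$, $$\mathbb{P}_\nu\left(\left|\frac1n\sum_{i=n_0+1}^{n_0+n}f(X_i)-\pi(f)\right|>\epsilon\right)\leq2C_p(\nu,n_0)\exp\left(-\frac{q^{-1}\alpha(\lambda_r\vee0)^{-1}}{2\times(b-a)^2/4}\cdot n\epsilon^2\right).$$
   Context: The state space $(\mathcal{X},\mathcal{B})$ is a standard Borel space. The transition kernel $P$ is invariant with $\pi$: $\pi(B)=\int P(x,B)\,\pi(dx)$ for all $B\in\mathcal{B}$. $\pi(h):=\int h\,d\pi$; $\|h\|_{\pi,p}=\pi(|h|^p)^{1/p}$ for $p<\infty$ and $\|h\|_{\pi,\infty}=\operatorname{ess\,sup}|h|$. $\mathcal{L}_2(\pi)$ is the real Hilbert space of $\pi$-square-integrable functions with inner product $\langle h_1,h_2\rangle_\pi=\int h_1h_2\,d\pi$ and norm $\|h\|_\pi=\|h\|_{\pi,2}$. $P$ acts on it by $Ph(x)=\int h(y)P(x,dy)$, with adjoint $P^*$, and $R=(P+P^* )/2$. The chain admits absolute spectral gap $1-\lambda$ if $\lambda:=\sup\{\|Ph\|_\pi:\|h\|_\pi=1,\ \pi(h)=0\}<1$, and right spectral gap $1-\lambda_r$ if $\lambda_r:=\sup\{\langle Rh,h\rangle_\pi:\|h\|_\pi=1,\ \pi(h)=0\}<1$. $\mathbb{E}_\nu$, $\mathbb{P}_\nu$ denote expectation and probability when $X_1\sim\nu$. $\alpha(\lambda)=\frac{1+\lambda}{1-\lambda}$; $\xi_1\vee\xi_2=\max\{\xi_1,\xi_2\}$;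 $0^0=1$. *)

theory Defs
  imports "HOL-Probability.Probability"
begin

text \<open>
  A measurable space is represented by a measure \<open>S\<close> of which only \<open>space S\<close> and \<open>sets S\<close>
  are used.
\<close>

definition standard_Borel :: "'a measure \<Rightarrow> bool" where
  "standard_Borel S \<longleftrightarrow>
     (\<exists>T. completely_metrizable_space T \<and> second_countable T \<and> topspace T = space S \<and>
          sets S = sigma_sets (space S) {U. openin T U})"

definition invariant_prob :: "'a measure \<Rightarrow> ('a \<Rightarrow> 'a measure) \<Rightarrow> 'a measure \<Rightarrow> bool" where
  "invariant_prob S P \<pi> \<longleftrightarrow>
     sets \<pi> = sets S \<and> prob_space \<pi> \<and>
     (\<forall>B\<in>sets S. emeasure \<pi> B = (\<integral>\<^sup>+x. emeasure (P x) B \<partial>\<pi>))"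

text \<open>The sigma-algebra generated by \<open>X 1, \<dots>, X k\<close>.\<close>

definition past :: "'w measure \<Rightarrow> 'a measure \<Rightarrow> (nat \<Rightarrow> 'w \<Rightarrow> 'a) \<Rightarrow> nat \<Rightarrow> 'w measure" where
  "past M S X k = sigma (space M) (\<Union>i\<in>{1..k}. {X i -` A \<inter> space M |A. A \<in> sets S})"

text \<open>The chain is indexed from 1; \<open>X 0\<close> plays no role.\<close>

definition markov_chain ::
  "'w measure \<Rightarrow> 'a measure \<Rightarrow> ('a \<Rightarrow> 'a measure) \<Rightarrow> 'a measure \<Rightarrow> (nat \<Rightarrow> 'w \<Rightarrow> 'a) \<Rightarrow> bool" where
  "markov_chain M S P \<nu> X \<longleftrightarrow>
     prob_space M \<and> (\<forall>i\<ge>1. X i \<in> measurable M S) \<and>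
     distr M S (X 1) = \<nu> \<and>
     (\<forall>k\<ge>1. \<forall>A\<in>sets S. AE \<omega> in M.
        real_cond_exp M (past M S X k) (\<lambda>\<omega>. indicator A (X (Suc k) \<omega>)) \<omega>
          = measure (P (X k \<omega>)) A)"

text \<open>The exponent \<open>p\<close> ranges over \<open>(1, \<infinity>]\<close>, and the norm takes the value \<open>\<infinity>\<close> off \<open>L\<^sub>p\<close>.\<close>

definition Lp_norm :: "'a measure \<Rightarrow> ennreal \<Rightarrow> ('a \<Rightarrow> real) \<Rightarrow> ennreal" where
  "Lp_norm \<pi> p h =
     (if p = \<infinity> then esssup \<pi> (\<lambda>x. ennreal \<bar>h x\<bar>)
      else let I = (\<integral>\<^sup>+x. ennreal (\<bar>h x\<bar> powr enn2real p) \<partial>\<pi>)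
           in if I = \<infinity> then \<infinity> else ennreal (enn2real I powr (1 / enn2real p)))"

definition L2 :: "'a measure \<Rightarrow> ('a \<Rightarrow> real) set" where
  "L2 \<pi> = {h \<in> borel_measurable \<pi>. integrable \<pi> (\<lambda>x. (h x)\<^sup>2)}"

definition L2_inner :: "'a measure \<Rightarrow> ('a \<Rightarrow> real) \<Rightarrow> ('a \<Rightarrow> real) \<Rightarrow> real" where
  "L2_inner \<pi> g h = (\<integral>x. g x * h x \<partial>\<pi>)"

definition kernel_op :: "('a \<Rightarrow> 'a measure) \<Rightarrow> ('a \<Rightarrow> real) \<Rightarrow> 'a \<Rightarrow> real" where
  "kernel_op P h x = (\<integral>y. h y \<partial>P x)"

text \<open>
  Elements of the Hilbert space are functions rather than classes modulo null sets, so the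
  adjoint picks a representative; it is unique up to a \<open>\<pi>\<close>-null set.
\<close>

definition adjoint_op ::
  "'a measure \<Rightarrow> (('a \<Rightarrow> real) \<Rightarrow> 'a \<Rightarrow> real) \<Rightarrow> ('a \<Rightarrow> real) \<Rightarrow> 'a \<Rightarrow> real" where
  "adjoint_op \<pi> T g =
     (SOME k. k \<in> L2 \<pi> \<and> (\<forall>h\<in>L2 \<pi>. L2_inner \<pi> (T h) g = L2_inner \<pi> h k))"

definition reversibilization ::
  "'a measure \<Rightarrow> ('a \<Rightarrow> 'a measure) \<Rightarrow> ('a \<Rightarrow> real) \<Rightarrow> 'a \<Rightarrow> real" where
  "reversibilization \<pi> P h x = (kernel_op P h x + adjoint_op \<pi> (kernel_op P) h x) / 2"

definition unit_centered :: "'a measure \<Rightarrow> ('a \<Rightarrow> real) set" where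
  "unit_centered \<pi> = {h \<in> L2 \<pi>. Lp_norm \<pi> 2 h = 1 \<and> (\<integral>x. h x \<partial>\<pi>) = 0}"

text \<open>
  The suprema are taken in \<open>[0, \<infinity>]\<close> and \<open>[-\<infinity>, \<infinity>]\<close>, so that they also make sense when
  \<open>unit_centered \<pi>\<close> is empty, i.e. when \<open>\<pi>\<close> takes only the values 0 and 1.
\<close>

definition abs_lambda :: "'a measure \<Rightarrow> ('a \<Rightarrow> 'a measure) \<Rightarrow> ennreal" where
  "abs_lambda \<pi> P = (SUP h\<in>unit_centered \<pi>. Lp_norm \<pi> 2 (kernel_op P h))"

definition right_lambda :: "'a measure \<Rightarrow> ('a \<Rightarrow> 'a measure) \<Rightarrow> ereal" where
  "right_lambda \<pi> P = (SUP h\<in>unit_centered \<pi>. ereal (L2_inner \<pi> (reversibilization \<pi> P h) h))"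

definition alpha :: "real \<Rightarrow> real" where
  "alpha l = (1 + l) / (1 - l)"

definition conj_exponent :: "ennreal \<Rightarrow> real" where
  "conj_exponent p = (if p = \<infinity> then 1 else enn2real p / (enn2real p - 1))"

text \<open>Real powers with \<open>0\<^sup>0 = 1\<close>, whereas \<open>0 powr 0 = 0\<close>.\<close>

definition rpow :: "real \<Rightarrow> real \<Rightarrow> real" where
  "rpow x y = (if y = 0 then 1 else x powr y)"

definition dens :: "'a measure \<Rightarrow> 'a measure \<Rightarrow> 'a \<Rightarrow> real" where
  "dens \<pi> \<nu> x = enn2real (RN_deriv \<pi> \<nu> x)"

definition C_const ::
  "'a measure \<Rightarrow> ('a \<Rightarrow> 'a measure) \<Rightarrow> ennreal \<Rightarrow> 'a measure \<Rightarrow> nat \<Rightarrow> real" where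
  "C_const \<pi> P p \<nu> n0 =
     (let r = enn2real p; q = conj_exponent p; l = enn2real (abs_lambda \<pi> P);
          D = enn2real (Lp_norm \<pi> p (\<lambda>x. dens \<pi> \<nu> x - 1))
      in if p = \<infinity> then enn2real (Lp_norm \<pi> \<infinity> (dens \<pi> \<nu>))
         else if p < 2 then 1 + 2 powr (2 / r) * rpow l (2 * real n0 / q) * D
         else if p = 2 then 1 + l ^ n0 * D
         else 1 + 2 powr (2 / q) * rpow l (2 * real n0 / r) * D)"

end

theory Submission
  imports Defs
begin

text \<open>
  Write \<open>F = f - \<pi>(f)\<close>, let \<open>A\<close> be the kernel \<open>P\<close> multiplied on both sides by
  \<open>e = exp (t F / 2)\<close>, and let \<open>\<lambda>\<close> be the positive part of the right spectral gap parameter.  For the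
  stationary chain the moment generating function is \<open>\<langle>A\<^sup>n\<^sup>-\<^sup>1 e, e\<rangle>\<close>.  As \<open>A\<close> preserves
  nonnegative functions, this is at most \<open>w\<^sup>n\<^sup>-\<^sup>1 \<parallel>e\<parallel>\<^sup>2\<close> for any bound \<open>w\<close> of the quadratic form of
  \<open>A\<close>, even when \<open>P\<close> is not reversible.  The right spectral gap bounds this form by the one with
  \<open>P\<close> replaced by \<open>\<lambda> I + (1 - \<lambda>) \<Pi>\<close>, where \<open>\<Pi>\<close> is the projection onto the constants; its norm is
  largest when \<open>F\<close> takes only two values, which leaves an elementary inequality between hyperbolic
  functions.

  An initial law with density \<open>1 + g\<close> contributes the term \<open>\<langle>g, (P\<^sup>n\<^sup>0 - \<Pi>) h\<rangle>\<close>, where \<open>h x\<close> is the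
  moment generating function for the chain started at \<open>x\<close>.  It is estimated by interpolating
  \<open>P\<^sup>n\<^sup>0 - \<Pi>\<close> (for \<open>p \<le> 2\<close>) or its adjoint (for \<open>p > 2\<close>) between \<open>L\<^sub>2\<close> and \<open>L\<^sub>\<infinity>\<close>, and
  Jensen's inequality bounds \<open>h\<^sup>q\<close> by the same function with \<open>q t\<close> in place of \<open>t\<close>.
\<close>

subsection \<open>The two-state inequality\<close>

text \<open>For a non-symmetric \<open>A\<close> a bound on the quadratic form controls neither the
  norm nor, in general, the forms of the powers; positivity of the kernel replaces the spectral
  theorem. The gap parameter is cut off at 0 because the reduction to two values rests on convexity
  of exp y / (w - \<lambda> exp y), which uses \<lambda> \<ge> 0. Interpolation between L2 and
  L\<infinity> reaches only exponents above 2. One of the conjugate exponents p and q is at least 2,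
  and this decides whether the operator acts on h (p \<le> 2) or its adjoint on g (p > 2).
  Truncating a nonnegative function at height s costs no constant: the image of the truncation under
  a Markov kernel and its mean both lie in [0, s], so they differ by at most s. Now h is nonnegative
  but g is signed, so for p > 2 the two parts of g are treated separately, at the price of a factor
  2. The resulting factors 1 and 2 are at most the stated 2^(2/p) and 2^(2/q). For p = \<infinity>
  no cancellation is used: the density is bounded by its essential supremum.\<close>

lemma le_sinh: "0 \<le> x \<Longrightarrow> x \<le> sinh x" for x :: real
proof -
  assume "0 \<le> x"
  then have "sinh 0 - 0 \<le> sinh x - x"
  proof (intro DERIV_nonneg_imp_nondecreasing[where f = "\<lambda>x. sinh x - x"])
    show "\<exists>y. ((\<lambda>x. sinh x - x) has_real_derivative y) (at u) \<and> 0 \<le> y" for u :: real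
      by (rule exI[of _ "cosh u - 1"]) (auto intro!: derivative_eq_intros simp: cosh_real_ge_1)
  qed
  then show ?thesis by simp
qed

lemma sinh_le_mult_cosh: "0 \<le> x \<Longrightarrow> sinh x \<le> x * cosh x" for x :: real
proof -
  assume "0 \<le> x"
  then have "0 * cosh 0 - sinh 0 \<le> x * cosh x - sinh x"
    by (intro DERIV_nonneg_imp_nondecreasing[where f = "\<lambda>x. x * cosh x - sinh x"])
       (auto intro!: derivative_eq_intros exI simp: le_sinh intro: order_trans)
  then show ?thesis by simp
qed

text \<open>Hoeffding's lemma for a fair sign: \<open>Hoeffdings_lemma_aux\<close> with weight 1/2
  and argument 2x, since 1 + (exp (2x) - 1)/2 = cosh x exp x. Evenness covers negative
  arguments.\<close>

lemma cosh_le_exp_square: "cosh x \<le> exp (x\<^sup>2 / 2)" for x :: real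
proof -
  have *: "cosh x \<le> exp (x\<^sup>2 / 2)" if "0 < x" for x :: real
  proof -
    have "- (2 * x) * (1/2) + ln (1 + (1/2) * (exp (2 * x) - 1)) \<le> (2 * x)\<^sup>2 / 8"
      using that by (intro Hoeffdings_lemma_aux) auto
    moreover have "1 + (1/2) * (exp (2 * x) - 1) = cosh x * exp x"
      by (simp add: cosh_def algebra_simps flip: exp_add)
    ultimately have "ln (cosh x) \<le> x\<^sup>2 / 2"
      by (simp add: ln_mult power2_eq_square cosh_real_pos)
    then show ?thesis
      by (metis cosh_real_pos exp_le_cancel_iff exp_ln)
  qed
  show ?thesis
    using *[of x] *[of "-x"] by (cases x "0 :: real" rule: linorder_cases) auto
qed

text \<open>Let Y take two values with mean zero, difference 2D and midpoint r D, so that the upper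
  value has probability (1 - r)/2. The claim says that the characteristic polynomial of l I + (1 -
  l) \<Pi>, multiplied on both sides by exp (Y/2), is nonnegative at exp s; it has been divided by
  exp (s + r D).\<close>

lemma two_state_bound:
  fixes l D r :: real
  assumes l: "0 \<le> l" "l < 1" and D: "0 < D"
  defines "s \<equiv> alpha l * D\<^sup>2 / 2"
  shows "(1 + l) * cosh D - (1 - l) * r * sinh D \<le> exp (s - r * D) + l * exp (- (s - r * D))"
proof -
  define z where "z = s - r * D"
  \<comment> \<open>Holding z fixed eliminates r: as r D = s - z, the term r sinh D equals (alpha l
    D^2 / 2 - z) (sinh D / D). The claim becomes \<open>\<Phi> D \<ge> 0\<close>, an inequality in
    one variable with parameter z.\<close>
  define \<Phi> where "\<Phi> x = exp z + l * exp (- z) - (1 + l) * cosh x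
    + (1 - l) * (alpha l * x\<^sup>2 / 2 - z) * (sinh x / x)" for x
  have al: "(1 - l) * alpha l = 1 + l" "alpha l > 0"
    using l by (auto simp: alpha_def)
  have "\<Phi> D \<ge> 0"
  \<comment> \<open>For z \<le> 0 the tangent bounds for exp, together with D \<le> sinh D and 2
    (cosh D - 1) \<le> D sinh D, suffice. For z > 0 the minimum of \<Phi> is located
    instead.\<close>
  proof (cases "z \<le> 0")
    case True
    have S: "1 \<le> sinh D / D"
      using le_sinh[of D] D by simp
    have "1 + z \<le> exp z" "1 - z \<le> exp (- z)"
      using exp_ge_add_one_self[of z] exp_ge_add_one_self[of "-z"] by (auto simp del: exp_ge_add_one_self)
    then have 1: "1 + l + (1 - l) * z \<le> exp z + l * exp (- z)"
      using l mult_left_mono[of "1 - z" "exp (- z)" l] unfolding right_diff_distrib left_diff_distrib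
      by linarith
    have 2: "0 \<le> (1 - l) * - z * (sinh D / D - 1)"
      using S True l by (intro mult_nonneg_nonneg) auto
    have c: "cosh D = 1 + 2 * sinh (D / 2) * sinh (D / 2)"
      using cosh_double[of "D / 2"] cosh_square_eq[of "D/2"] by (simp add: power2_eq_square)
    have s: "sinh D = 2 * sinh (D / 2) * cosh (D / 2)"
      using sinh_double[of "D / 2"] by simp
    have "2 * sinh (D / 2) * sinh (D / 2) \<le> 2 * sinh (D / 2) * (D / 2 * cosh (D / 2))"
      using D by (intro mult_left_mono sinh_le_mult_cosh) auto
    then have 3: "0 \<le> (1 + l) * (1 - cosh D + D * sinh D / 2)"
      unfolding c s using l by (intro mult_nonneg_nonneg) (auto simp: algebra_simps)
    have "(1 - l) * (alpha l * D\<^sup>2 / 2 - z) * (sinh D / D)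
      = ((1 - l) * alpha l) * (D * sinh D / 2) + (1 - l) * - z * (sinh D / D - 1) - (1 - l) * z"
      using D by (simp add: field_simps power2_eq_square)
    then have "\<Phi> D = (exp z + l * exp (- z) - (1 + l + (1 - l) * z)) + (1 - l) * - z * (sinh D / D - 1)
      + (1 + l) * (1 - cosh D + D * sinh D / 2)"
      unfolding \<Phi>_def al by (simp add: algebra_simps)
    then show ?thesis using 1 2 3 by linarith
  next
    case False
    then have z: "0 < z" by simp
    \<comment> \<open>The derivative of \<Phi> has the sign of alpha l x^2 / 2 - z, so \<Phi> is
      smallest here. At this point the sinh term vanishes, which is the symmetric case r =
      0.\<close>
    define D0 where "D0 = sqrt (2 * z / alpha l)"
    have D0: "0 < D0" "alpha l * D0\<^sup>2 / 2 = z"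
      using z al by (auto simp: D0_def)
    define d where "d x = (1 - l) * (alpha l * x\<^sup>2 / 2 - z) * ((x * cosh x - sinh x) / x\<^sup>2)" for x
    have deriv: "(\<Phi> has_real_derivative d x) (at x)" if "0 < x" for x
    proof -
      have "- (1 + l) * sinh x + (1 - l) * alpha l * x * (sinh x / x) = 0"
        using that unfolding al by simp (simp add: algebra_simps)
      then have "- (1 + l) * sinh x + ((1 - l) * alpha l * x * (sinh x / x)
          + (x * cosh x - sinh x) / x\<^sup>2 * ((1 - l) * (alpha l * x\<^sup>2 / 2 - z))) = d x"
        unfolding add.assoc[symmetric] by (simp add: d_def)
      moreover have "(\<Phi> has_real_derivative - (1 + l) * sinh x
          + ((1 - l) * alpha l * x * (sinh x / x)
             + (x * cosh x - sinh x) / x\<^sup>2 * ((1 - l) * (alpha l * x\<^sup>2 / 2 - z)))) (at x)"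
        unfolding \<Phi>_def
      proof (intro DERIV_add DERIV_mult)
        show "((\<lambda>x. exp z + l * exp (- z) - (1 + l) * cosh x) has_real_derivative
            - (1 + l) * sinh x) (at x)"
          by (auto intro!: derivative_eq_intros simp: algebra_simps)
        show "((\<lambda>x. (1 - l) * (alpha l * x\<^sup>2 / 2 - z)) has_real_derivative
            (1 - l) * alpha l * x) (at x)"
          by (auto intro!: derivative_eq_intros)
        show "((\<lambda>x. sinh x / x) has_real_derivative (x * cosh x - sinh x) / x\<^sup>2) (at x)"
          using that by (auto intro!: derivative_eq_intros simp: power2_eq_square mult.commute)
      qed
      ultimately show ?thesis by simp
    qed
    have S: "0 \<le> (x * cosh x - sinh x) / x\<^sup>2" if "0 < x" for x :: real
      using sinh_le_mult_cosh[of x] that by simp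
    have "\<Phi> D0 \<le> \<Phi> D"
    proof (cases "D0 \<le> D")
      case True
      show ?thesis
      proof (rule DERIV_nonneg_imp_nondecreasing[OF True, where f = \<Phi>])
        fix x assume x: "D0 \<le> x" "x \<le> D"
        have "D0\<^sup>2 \<le> x\<^sup>2"
          using x D0 by (intro power_mono) auto
        then have "alpha l * D0\<^sup>2 / 2 \<le> alpha l * x\<^sup>2 / 2"
          using al by (simp add: divide_right_mono mult_left_mono)
        then have "0 \<le> d x"
          unfolding d_def using D0 x l by (intro mult_nonneg_nonneg S) auto
        then show "\<exists>y. (\<Phi> has_real_derivative y) (at x) \<and> 0 \<le> y"
          using deriv[of x] x D0 by auto
      qed
    next
      case False
      show ?thesis
      proof (rule DERIV_nonpos_imp_nonincreasing[where f = \<Phi>])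
        show "D \<le> D0" using False by simp
        fix x assume x: "D \<le> x" "x \<le> D0"
        have "x\<^sup>2 \<le> D0\<^sup>2"
          using x D by (intro power_mono) auto
        then have "alpha l * x\<^sup>2 / 2 \<le> alpha l * D0\<^sup>2 / 2"
          using al by (simp add: divide_right_mono mult_left_mono)
        then have "d x \<le> 0"
          unfolding d_def using D0 D x l
          by (intro mult_nonpos_nonneg mult_nonneg_nonpos S) auto
        then show "\<exists>y. (\<Phi> has_real_derivative y) (at x) \<and> y \<le> 0"
          using deriv[of x] x D by auto
      qed
    qed
    moreover have "0 \<le> \<Phi> D0"
    proof -
      \<comment> \<open>The weights w and l w sum to 1, and the points z and -z then have mean z /
        alpha l = D0^2 / 2. Convexity of exp therefore bounds exp (D0^2 / 2), hence cosh D0, by the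
        weighted sum.\<close>
      define w where "w = 1 / (1 + l)"
      have "exp ((1 - l * w) *\<^sub>R z + (l * w) *\<^sub>R (- z)) \<le> (1 - l * w) * exp z + (l * w) * exp (- z)"
        using l by (intro convex_onD[OF exp_convex]) (auto simp: w_def)
      moreover have "(1 - l * w) = w"
        using l by (simp add: w_def field_simps)
      moreover have "w * z + (l * w) * (- z) = D0\<^sup>2 / 2"
      proof -
        have "D0\<^sup>2 / 2 = z / alpha l"
          using D0 al by (simp add: field_simps)
        also have "\<dots> = w * z + (l * w) * (- z)"
          by (simp add: w_def alpha_def diff_divide_distrib[symmetric] algebra_simps)
        finally show ?thesis ..
      qed
      ultimately have "exp (D0\<^sup>2 / 2) \<le> w * exp z + l * w * exp (- z)"
        by (simp only: real_scaleR_def)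
      then have "cosh D0 \<le> w * exp z + l * w * exp (- z)"
        using cosh_le_exp_square[of D0] by linarith
      then have "(1 + l) * cosh D0 \<le> (1 + l) * (w * exp z + l * w * exp (- z))"
        using l by (intro mult_left_mono) auto
      also have "\<dots> = ((1 + l) * w) * (exp z + l * exp (- z))"
        by (simp add: algebra_simps)
      also have "(1 + l) * w = 1"
        using l by (simp add: w_def)
      finally have "(1 + l) * cosh D0 \<le> exp z + l * exp (- z)"
        by simp
      then show ?thesis
        unfolding \<Phi>_def D0 by simp
    qed
    ultimately show ?thesis by simp
  qed
  moreover have "(1 - l) * (alpha l * D\<^sup>2 / 2 - z) * (sinh D / D) = (1 - l) * r * sinh D"
    using D by (simp add: z_def s_def)
  ultimately show ?thesis
    unfolding \<Phi>_def z_def[symmetric] by linarith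
qed

text \<open>In \<open>exp_two_point\<close> this keeps \<open>w\<close> above
  \<open>l * exp yb\<close>, so that the denominators stay positive. The difference of the two sides
  vanishes at 1 and has derivative -(1 - x)^2 / (x (1 + x)^2).\<close>

lemma minus_ln_gt:
  fixes l :: real
  assumes "0 < l" "l < 1"
  shows "2 / alpha l < - ln l"
proof -
  define g where "g x = - ln x - 2 * (1 - x) / (1 + x)" for x :: real
  have "g 1 < g l"
  proof (rule DERIV_neg_imp_decreasing_open[OF assms(2)])
    fix x assume x: "l < x" "x < 1"
    have "1 + x \<noteq> 0" "x \<noteq> 0" using x assms by auto
    then have "- 1 / x + 4 / (1 + x)\<^sup>2 = - (1 - x)\<^sup>2 / (x * (1 + x)\<^sup>2)"
      by (simp add: divide_simps) (simp add: algebra_simps power2_eq_square)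
    then have "- 1 / x + 4 / (1 + x)\<^sup>2 < 0"
      using x assms by (simp add: divide_neg_pos)
    moreover have "(g has_real_derivative (- 1 / x + 4 / (1 + x)\<^sup>2)) (at x)"
      unfolding g_def using x assms
      by (auto intro!: derivative_eq_intros) (simp add: power2_eq_square)
    ultimately show "\<exists>y. (g has_real_derivative y) (at x) \<and> y < 0" by blast
  next
    show "continuous_on {l..1} g"
      unfolding g_def using assms by (auto intro!: continuous_intros)
  qed
  then show ?thesis by (simp add: g_def alpha_def)
qed

text \<open>The operator in question is a rank one perturbation of a diagonal one, and the second
  conclusion is its secular equation, relaxed to an inequality, for a law on two points. The weight
  p at the upper point makes the mean zero.\<close>

lemma exp_two_point:
  fixes l ya yb :: real
  assumes l: "0 \<le> l" "l < 1" and y: "ya \<le> 0" "0 \<le> yb" "ya < yb"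
  defines "w \<equiv> exp (alpha l * (yb - ya)\<^sup>2 / 8)" and "p \<equiv> - ya / (yb - ya)"
  shows "l * exp yb < w"
    and "(1 - l) * ((1 - p) * (exp ya / (w - l * exp ya)) + p * (exp yb / (w - l * exp yb))) \<le> 1"
proof -
  define d where "d = yb - ya"
  have d: "0 < d" using y by (simp add: d_def)
  have al: "0 < alpha l" using l by (simp add: alpha_def)
  show gap: "l * exp yb < w"
  proof (cases "l = 0")
    case False
    \<comment> \<open>Completing the square: over all d, the least value of alpha d^2 / 8 - d is -2
      / alpha, and \<open>minus_ln_gt\<close> compares this with ln l. Afterwards yb \<le> d because
      ya \<le> 0.\<close>
    have "0 \<le> (alpha l * d - 4)\<^sup>2 / (8 * alpha l)"
      using al by simp
    also have "\<dots> = alpha l * d\<^sup>2 / 8 - d + 2 / alpha l"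
      using al by (simp add: field_simps power2_eq_square)
    also have "\<dots> < alpha l * d\<^sup>2 / 8 - d - ln l"
      using minus_ln_gt[of l] l False by simp
    finally have "ln l + d < alpha l * d\<^sup>2 / 8"
      by simp
    then have "exp (ln l + yb) < exp (alpha l * d\<^sup>2 / 8)"
      using y by (simp add: d_def)
    then show ?thesis
      using l False by (simp add: exp_add w_def d_def)
  qed (simp add: w_def)
  have gap': "l * exp ya < w"
    using gap y l by (intro le_less_trans[OF _ gap] mult_left_mono) auto
  define D r where "D = d / 2" and "r = 1 - 2 * p"
  define s where "s = alpha l * D\<^sup>2 / 2"
  define A B where "A = exp yb" and "B = exp ya"
  have w: "w = exp s"
    by (simp add: w_def s_def D_def d_def power2_eq_square)
  have rD: "r * D = (yb + ya) / 2"
    using d by (simp add: r_def D_def p_def d_def field_simps)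
  have AD: "A = exp (r * D) * exp D" and BD: "B = exp (r * D) * exp (- D)"
    unfolding A_def B_def exp_add[symmetric] rD by (simp_all add: D_def d_def field_simps)
  have "(1 + l) * cosh D - (1 - l) * r * sinh D \<le> exp (s - r * D) + l * exp (- (s - r * D))"
    unfolding s_def using l d by (intro two_state_bound) (auto simp: D_def)
  \<comment> \<open>This factor undoes the normalization in \<open>two_state_bound\<close>: the
    result is w^2 - w * trace + l * A * B \<ge> 0, which is the claim with denominators
    cleared.\<close>
  then have "w * exp (r * D) * ((1 + l) * cosh D - (1 - l) * r * sinh D)
    \<le> w * exp (r * D) * (exp (s - r * D) + l * exp (- (s - r * D)))"
    by (intro mult_left_mono) (auto simp: w)
  also have "\<dots> = w\<^sup>2 + l * (A * B)"
    by (simp add: w AD BD power2_eq_square algebra_simps flip: exp_add)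
  also have "w * exp (r * D) * ((1 + l) * cosh D - (1 - l) * r * sinh D)
    = w * ((l + (1 - l) * p) * A + (l + (1 - l) * (1 - p)) * B)"
    by (simp add: AD BD cosh_def sinh_def r_def field_simps)
  finally have "(1 - l) * (p * A * (w - l * B) + (1 - p) * B * (w - l * A)) \<le> (w - l * A) * (w - l * B)"
    by (simp add: algebra_simps power2_eq_square)
  moreover have quotient: "(1 - l) * ((1 - p) * (B / b) + p * (A / a)) = (1 - l) * (p * A * b + (1 - p) * B * a) / (a * b)"
    if "a > 0" "b > 0" for a b
    using that by (simp add: field_simps)
  moreover have "w - l * A > 0" "w - l * B > 0"
    using gap gap' by (auto simp: A_def B_def)
  ultimately show "(1 - l) * ((1 - p) * (exp ya / (w - l * exp ya)) + p * (exp yb / (w - l * exp yb))) \<le> 1"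
    unfolding A_def[symmetric] B_def[symmetric]
    by (subst quotient) (auto simp: divide_le_eq_1_pos)
qed

subsection \<open>The Leon-Perron form\<close>

lemma (in prob_space) integrable_bounded:
  fixes f :: "'a \<Rightarrow> real"
  assumes "f \<in> borel_measurable M" "\<And>x. x \<in> space M \<Longrightarrow> \<bar>f x\<bar> \<le> B"
  shows "integrable M f"
  using assms by (intro integrable_const_bound[of f B] AE_I2) auto

lemma integral_Cauchy_Schwarz:
  fixes f g :: "'a \<Rightarrow> real"
  assumes "integrable M (\<lambda>x. (f x)\<^sup>2)" "integrable M (\<lambda>x. (g x)\<^sup>2)" "integrable M (\<lambda>x. f x * g x)"
  shows "(\<integral>x. f x * g x \<partial>M)\<^sup>2 \<le> (\<integral>x. (f x)\<^sup>2 \<partial>M) * (\<integral>x. (g x)\<^sup>2 \<partial>M)"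
proof -
  define a b c where "a = (\<integral>x. (f x)\<^sup>2 \<partial>M)" and "b = (\<integral>x. f x * g x \<partial>M)" and "c = (\<integral>x. (g x)\<^sup>2 \<partial>M)"
  have *: "0 \<le> u\<^sup>2 * a - 2 * u * v * b + v\<^sup>2 * c" for u v
  proof -
    have "0 \<le> (\<integral>x. (u * f x - v * g x)\<^sup>2 \<partial>M)" by simp
    also have "\<dots> = (\<integral>x. u\<^sup>2 * (f x)\<^sup>2 - 2 * u * v * (f x * g x) + v\<^sup>2 * (g x)\<^sup>2 \<partial>M)"
      by (intro Bochner_Integration.integral_cong) (auto simp: power2_eq_square algebra_simps)
    also have "\<dots> = u\<^sup>2 * a - 2 * u * v * b + v\<^sup>2 * c"
      using assms by (simp add: a_def b_def c_def)
    finally show ?thesis .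
  qed
  have "0 \<le> a" "0 \<le> c" by (auto simp: a_def c_def)
  have "b\<^sup>2 \<le> a * c"
  proof (cases "c = 0")
    case True
    show ?thesis
    proof (rule ccontr)
      assume "\<not> ?thesis"
      then have "b\<^sup>2 > 0" using True by simp
      \<comment> \<open>With c = 0 the form is linear in v, and this v makes it equal to -1.\<close>
      then have "0 \<le> a - 2 * ((a + 1) / (2 * b)) * b"
        using *[of 1 "(a + 1) / (2 * b)"] True by simp
      then show False using \<open>b\<^sup>2 > 0\<close> by simp
    qed
  next
    case False
    then have "c > 0" using \<open>0 \<le> c\<close> by simp
    have "0 \<le> c * (a * c - b\<^sup>2)"
      using *[of c b] by (simp add: algebra_simps power2_eq_square)
    then show ?thesis using \<open>c > 0\<close> by (simp add: zero_le_mult_iff)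
  qed
  then show ?thesis by (simp add: a_def b_def c_def)
qed

lemma convex_on_exp_quotient:
  fixes w l yb :: real
  assumes "0 \<le> l" "l * exp yb < w"
  shows "convex_on {..yb} (\<lambda>y. exp y / (w - l * exp y))"
proof (rule f''_ge0_imp_convex)
  define W where "W y = w - l * exp y" for y
  have W: "0 < W y" if "y \<in> {..yb}" for y
  proof -
    have "l * exp y \<le> l * exp yb" using that assms by (intro mult_left_mono) auto
    then show ?thesis using assms by (simp add: W_def)
  qed
  have w: "0 < w" using assms by (smt (verit) exp_ge_zero mult_nonneg_nonneg)
  fix y assume y: "y \<in> {..yb}"
  show "((\<lambda>y. exp y / (w - l * exp y)) has_real_derivative w * exp y / (W y)\<^sup>2) (at y)"
    using W[OF y] unfolding W_def
    by (auto intro!: derivative_eq_intros simp: power2_eq_square) (simp add: algebra_simps)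
  show "((\<lambda>y. w * exp y / (W y)\<^sup>2) has_real_derivative w * exp y * (w + l * exp y) / (W y) ^ 3) (at y)"
    using W[OF y] unfolding W_def
    by (auto intro!: derivative_eq_intros) (simp add: divide_simps, simp add: algebra_simps eval_nat_numeral)
  show "0 \<le> w * exp y * (w + l * exp y) / (W y) ^ 3"
    using W[OF y] w assms by simp
qed simp

text \<open>
  The left-hand side is the quadratic form of the operator \<open>l I + (1 - l) \<Pi>\<close> multiplied on both
  sides by \<open>exp (Y / 2)\<close>, where \<open>\<Pi>\<close> is the projection onto the constants.  Its top
  eigenvalue is at most \<open>w\<close> as soon as \<open>(1 - l) E [exp Y / (w - l exp Y)] \<le> 1\<close>, and by convexity
  this has to be checked only when \<open>Y\<close> is supported on the two endpoints.
\<close>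

lemma (in prob_space) leon_perron_form_le:
  fixes Y h :: "'a \<Rightarrow> real" and l ya yb :: real
  assumes l: "0 \<le> l" "l < 1"
    and Y[measurable]: "Y \<in> borel_measurable M" and Yb: "\<And>x. x \<in> space M \<Longrightarrow> ya \<le> Y x \<and> Y x \<le> yb"
    and Y0: "expectation Y = 0"
    and h[measurable]: "h \<in> borel_measurable M" and hb: "\<And>x. x \<in> space M \<Longrightarrow> \<bar>h x\<bar> \<le> B"
  shows "l * expectation (\<lambda>x. exp (Y x) * (h x)\<^sup>2) + (1 - l) * (expectation (\<lambda>x. exp (Y x / 2) * h x))\<^sup>2
    \<le> exp (alpha l * (yb - ya)\<^sup>2 / 8) * expectation (\<lambda>x. (h x)\<^sup>2)"
proof -
  define e where "e x = exp (Y x / 2)" for x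
  have e[measurable]: "e \<in> borel_measurable M" unfolding e_def by measurable
  have e2: "exp (Y x) = (e x)\<^sup>2" for x
    by (simp add: e_def power2_eq_square flip: exp_add)
  have eb: "0 \<le> e x" "e x \<le> exp (yb / 2)" if "x \<in> space M" for x
    using Yb[OF that] by (auto simp: e_def)
  have h2: "(h x)\<^sup>2 \<le> B\<^sup>2" if "x \<in> space M" for x
    using power_mono[OF hb[OF that], of 2] by simp
  have iY: "integrable M Y"
    using Yb by (intro integrable_bounded[where B = "max \<bar>ya\<bar> \<bar>yb\<bar>"]) (auto, fastforce)
  have ih2: "integrable M (\<lambda>x. (h x)\<^sup>2)"
    using h2 by (intro integrable_bounded[where B = "B\<^sup>2"]) auto
  have ieh: "integrable M (\<lambda>x. e x * h x)"
    using eb hb by (intro integrable_bounded[where B = "exp (yb / 2) * B"])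
      (measurable, unfold abs_mult, intro mult_mono, auto)
  have ieh2: "integrable M (\<lambda>x. (e x)\<^sup>2 * (h x)\<^sup>2)"
    using eb h2 by (intro integrable_bounded[where B = "(exp (yb / 2))\<^sup>2 * B\<^sup>2"])
      (measurable, unfold abs_mult, intro mult_mono, auto simp: power_mono)
  have ya: "ya \<le> 0"
    using integral_mono[of M "\<lambda>x. ya" Y] iY Yb Y0 by (auto simp: prob_space)
  have yb: "0 \<le> yb"
    using integral_mono[of M Y "\<lambda>x. yb"] iY Yb Y0 by (auto simp: prob_space)
  show ?thesis
  \<comment> \<open>\<open>exp_two_point\<close> needs distinct endpoints. Equal ones force Y = 0,
    and the claim is then the Cauchy-Schwarz inequality against the constant 1.\<close>
  proof (cases "ya = yb")
    case True
    then have "Y x = 0" if "x \<in> space M" for x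
      using Yb[OF that] ya yb by simp
    then have *: "expectation (\<lambda>x. exp (Y x) * (h x)\<^sup>2) = expectation (\<lambda>x. (h x)\<^sup>2)"
      "expectation (\<lambda>x. exp (Y x / 2) * h x) = expectation (\<lambda>x. 1 * h x)"
      by (auto intro!: Bochner_Integration.integral_cong)
    have "integrable M h" using hb by (intro integrable_bounded) auto
    then have "(expectation (\<lambda>x. 1 * h x))\<^sup>2 \<le> expectation (\<lambda>x. (h x)\<^sup>2)"
      using integral_Cauchy_Schwarz[of M "\<lambda>x. 1" h] ih2 by (simp add: prob_space)
    then show ?thesis
      unfolding * using True l mult_left_mono[of _ "expectation (\<lambda>x. (h x)\<^sup>2)" "1 - l"]
      by (fastforce simp: algebra_simps)
  next
    case False
    have "ya < yb"
      using False ya yb by simp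
    define w where "w = exp (alpha l * (yb - ya)\<^sup>2 / 8)"
    define p where "p = - ya / (yb - ya)"
    define \<psi> where "\<psi> y = exp y / (w - l * exp y)" for y
    note tp = exp_two_point[OF l ya yb \<open>ya < yb\<close>, folded w_def p_def]
    have W: "w - l * (e x)\<^sup>2 \<ge> w - l * exp yb" if "x \<in> space M" for x
      using Yb[OF that] l unfolding e2[symmetric] by (simp add: mult_left_mono)
    then have W0: "w - l * (e x)\<^sup>2 > 0" if "x \<in> space M" for x
      using tp(1) that by fastforce
    have chord: "\<psi> (Y x) \<le> (1 - (Y x - ya) / (yb - ya)) * \<psi> ya + (Y x - ya) / (yb - ya) * \<psi> yb"
      if x: "x \<in> space M" for x
    proof -
      define u where "u = (Y x - ya) / (yb - ya)"
      have "convex_on {ya..yb} \<psi>"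
        unfolding \<psi>_def using convex_on_exp_quotient[OF l(1) tp(1)] by (rule convex_on_subset) auto
      then have "\<psi> ((1 - u) *\<^sub>R ya + u *\<^sub>R yb) \<le> (1 - u) * \<psi> ya + u * \<psi> yb"
        using Yb[OF x] \<open>ya < yb\<close> by (intro convex_onD_Icc) (auto simp: u_def)
      moreover have "(1 - u) *\<^sub>R ya + u *\<^sub>R yb = ya + u * (yb - ya)"
        by (simp add: algebra_simps)
      moreover have "u * (yb - ya) = Y x - ya"
        using \<open>ya < yb\<close> by (simp add: u_def)
      ultimately show ?thesis by (simp add: u_def)
    qed
    \<comment> \<open>Cauchy-Schwarz with the weight w - l e^2: the product F G is e h, the integral
      of F^2 is at most 1 / (1 - l) by the chord bound, and the integral of G^2 is w E[h^2] - l
      E[e^2 h^2]. Rearranged, this is the claim.\<close>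
    define F G where "F x = e x / sqrt (w - l * (e x)\<^sup>2)" and "G x = sqrt (w - l * (e x)\<^sup>2) * h x" for x
    have [measurable]: "F \<in> borel_measurable M" "G \<in> borel_measurable M"
      unfolding F_def G_def by measurable
    have F2: "(F x)\<^sup>2 = \<psi> (Y x)" and G2: "(G x)\<^sup>2 = w * (h x)\<^sup>2 - l * ((e x)\<^sup>2 * (h x)\<^sup>2)"
      and FG: "F x * G x = e x * h x" if "x \<in> space M" for x
      using W0[OF that] by (auto simp: F_def G_def \<psi>_def e2 power_divide power_mult_distrib algebra_simps)
    have iF2: "integrable M (\<lambda>x. (F x)\<^sup>2)"
    proof (rule integrable_bounded)
      fix x assume x: "x \<in> space M"
      have "(e x)\<^sup>2 / (w - l * (e x)\<^sup>2) \<le> exp yb / (w - l * exp yb)"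
        using W[OF x] tp(1) Yb[OF x] by (intro frac_le) (auto simp: e2[symmetric])
      then show "\<bar>(F x)\<^sup>2\<bar> \<le> exp yb / (w - l * exp yb)"
        using W0[OF x] by (simp add: F_def power_divide)
    qed measurable
    have iG2: "integrable M (\<lambda>x. (G x)\<^sup>2)"
      using ih2 ieh2 by (subst Bochner_Integration.integrable_cong[OF refl G2]) auto
    have iFG: "integrable M (\<lambda>x. F x * G x)"
      using ieh by (subst Bochner_Integration.integrable_cong[OF refl FG]) auto
    \<comment> \<open>The chord is affine in Y and Y has mean zero, so its expectation is its value
      at 0, with weight p on the upper endpoint.\<close>
    have "expectation (\<lambda>x. (F x)\<^sup>2)
      \<le> expectation (\<lambda>x. (1 - (Y x - ya) / (yb - ya)) * \<psi> ya + (Y x - ya) / (yb - ya) * \<psi> yb)"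
      using iF2 iY chord F2 by (intro integral_mono) auto
    also have "\<dots> = (1 - p) * \<psi> ya + p * \<psi> yb"
      using iY Y0 by (simp add: p_def prob_space)
    finally have "(1 - l) * expectation (\<lambda>x. (F x)\<^sup>2) \<le> (1 - l) * ((1 - p) * \<psi> ya + p * \<psi> yb)"
      using l by (intro mult_left_mono) auto
    also have "\<dots> \<le> 1"
      using tp(2) unfolding \<psi>_def .
    finally have FF: "(1 - l) * expectation (\<lambda>x. (F x)\<^sup>2) \<le> 1" .
    have "(expectation (\<lambda>x. e x * h x))\<^sup>2 = (expectation (\<lambda>x. F x * G x))\<^sup>2"
      using FG by (simp cong: Bochner_Integration.integral_cong)
    also have "\<dots> \<le> expectation (\<lambda>x. (F x)\<^sup>2) * expectation (\<lambda>x. (G x)\<^sup>2)"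
      using iF2 iG2 iFG by (rule integral_Cauchy_Schwarz)
    finally have "(1 - l) * (expectation (\<lambda>x. e x * h x))\<^sup>2
      \<le> ((1 - l) * expectation (\<lambda>x. (F x)\<^sup>2)) * expectation (\<lambda>x. (G x)\<^sup>2)"
      using l by (simp add: mult_left_mono mult.assoc)
    also have "\<dots> \<le> 1 * expectation (\<lambda>x. (G x)\<^sup>2)"
      using FF by (intro mult_right_mono) auto
    also have "1 * expectation (\<lambda>x. (G x)\<^sup>2)
      = w * expectation (\<lambda>x. (h x)\<^sup>2) - l * expectation (\<lambda>x. (e x)\<^sup>2 * (h x)\<^sup>2)"
      using ih2 ieh2 G2 by (simp cong: Bochner_Integration.integral_cong)
    finally show ?thesis
      by (simp add: e2 w_def) (simp add: e_def)
  qed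
qed

subsection \<open>Bounded measurable functions\<close>

text \<open>A class stable under the kernel and under all operations used on moment generating
  functions, whose members are integrable for \<pi> and for every \<open>P x\<close>. Within it the
  kernel acts linearly at every point, not only almost everywhere.\<close>

definition bmeas :: "'a measure \<Rightarrow> ('a \<Rightarrow> real) set" where
  "bmeas S = {f \<in> borel_measurable S. \<exists>B. \<forall>x\<in>space S. \<bar>f x\<bar> \<le> B}"

lemma bmeasI: "f \<in> borel_measurable S \<Longrightarrow> (\<And>x. x \<in> space S \<Longrightarrow> \<bar>f x\<bar> \<le> B) \<Longrightarrow> f \<in> bmeas S"
  by (auto simp: bmeas_def)

lemma bmeasD[measurable_dest]: "f \<in> bmeas S \<Longrightarrow> f \<in> borel_measurable S"
  by (simp add: bmeas_def)

lemma bmeasE: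
  assumes "f \<in> bmeas S"
  obtains B where "f \<in> borel_measurable S" "0 \<le> B" "\<And>x. x \<in> space S \<Longrightarrow> \<bar>f x\<bar> \<le> B"
proof -
  obtain B where "\<forall>x\<in>space S. \<bar>f x\<bar> \<le> B" using assms by (auto simp: bmeas_def)
  then show ?thesis by (intro that[of "max B 0"]) (use assms in \<open>auto simp: bmeas_def le_max_iff_disj\<close>)
qed

lemma bmeas_const[intro, simp]: "(\<lambda>x. c) \<in> bmeas S"
  by (rule bmeasI[of _ _ "\<bar>c\<bar>"]) auto

lemma bmeas_add[intro]:
  assumes "f \<in> bmeas S" "g \<in> bmeas S"
  shows "(\<lambda>x. f x + g x) \<in> bmeas S"
proof -
  obtain B C where "\<And>x. x \<in> space S \<Longrightarrow> \<bar>f x\<bar> \<le> B" "\<And>x. x \<in> space S \<Longrightarrow> \<bar>g x\<bar> \<le> C"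
    using assms by (metis bmeasE)
  then show ?thesis
    using assms by (intro bmeasI[of _ _ "B + C"]) (auto dest: bmeasD intro: order_trans[OF abs_triangle_ineq] add_mono)
qed

lemma bmeas_mult[intro]:
  assumes "f \<in> bmeas S" "g \<in> bmeas S"
  shows "(\<lambda>x. f x * g x) \<in> bmeas S"
proof -
  obtain B C where "0 \<le> B" "\<And>x. x \<in> space S \<Longrightarrow> \<bar>f x\<bar> \<le> B" "\<And>x. x \<in> space S \<Longrightarrow> \<bar>g x\<bar> \<le> C"
    using assms by (metis bmeasE)
  then show ?thesis
    using assms by (intro bmeasI[of _ _ "B * C"]) (auto dest: bmeasD simp: abs_mult intro!: mult_mono)
qed

lemma bmeas_minus[intro]: "f \<in> bmeas S \<Longrightarrow> (\<lambda>x. - f x) \<in> bmeas S"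
  by (auto simp: bmeas_def)

lemma bmeas_diff[intro]: "f \<in> bmeas S \<Longrightarrow> g \<in> bmeas S \<Longrightarrow> (\<lambda>x. f x - g x) \<in> bmeas S"
  using bmeas_add[OF _ bmeas_minus] by fastforce

lemma bmeas_divide[intro]: "f \<in> bmeas S \<Longrightarrow> (\<lambda>x. f x / c) \<in> bmeas S" for c :: real
  using bmeas_mult[OF _ bmeas_const, of f S "1 / c"] by simp

lemma bmeas_power[intro]: "f \<in> bmeas S \<Longrightarrow> (\<lambda>x. f x ^ k) \<in> bmeas S"
  by (induction k) auto

lemma bmeas_abs[intro]: "f \<in> bmeas S \<Longrightarrow> (\<lambda>x. \<bar>f x\<bar>) \<in> bmeas S"
  by (auto simp: bmeas_def)

lemma bmeas_max[intro]:
  assumes "f \<in> bmeas S" "g \<in> bmeas S"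
  shows "(\<lambda>x. max (f x) (g x)) \<in> bmeas S"
proof -
  have "(\<lambda>x. max (f x) (g x)) = (\<lambda>x. (f x + g x + \<bar>f x - g x\<bar>) / 2)"
    by (auto simp: max_def)
  then show ?thesis
    using assms by (simp only: bmeas_divide bmeas_add bmeas_abs bmeas_diff)
qed

lemma bmeas_sum[intro]: "(\<And>i. i \<in> I \<Longrightarrow> f i \<in> bmeas S) \<Longrightarrow> (\<lambda>x. \<Sum>i\<in>I. f i x) \<in> bmeas S"
  by (induction I rule: infinite_finite_induct) auto

lemma bmeas_exp[intro]:
  assumes "f \<in> bmeas S"
  shows "(\<lambda>x. exp (f x)) \<in> bmeas S"
proof -
  obtain B where "\<And>x. x \<in> space S \<Longrightarrow> \<bar>f x\<bar> \<le> B"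
    using assms by (metis bmeasE)
  then show ?thesis
    using assms by (intro bmeasI[of _ _ "exp B"]) (auto dest: bmeasD abs_le_D1)
qed

lemma bmeas_sqrt[intro]:
  assumes "f \<in> bmeas S"
  shows "(\<lambda>x. sqrt (f x)) \<in> bmeas S"
proof -
  obtain B where "\<And>x. x \<in> space S \<Longrightarrow> \<bar>f x\<bar> \<le> B"
    using assms by (metis bmeasE)
  then show ?thesis
    using assms by (intro bmeasI[of _ _ "sqrt B"]) (auto dest: bmeasD simp flip: real_sqrt_abs')
qed

subsection \<open>Kernels with an invariant law\<close>

locale invariant_kernel =
  fixes S :: "'a measure" and P :: "'a \<Rightarrow> 'a measure" and \<pi> :: "'a measure"
  assumes kernel: "P \<in> measurable S (prob_algebra S)"
    and invariant: "invariant_prob S P \<pi>"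
begin

sublocale prob_space \<pi>
  using invariant by (simp add: invariant_prob_def)

lemma sets_pi[measurable_cong, simp]: "sets \<pi> = sets S"
  using invariant by (simp add: invariant_prob_def)

lemma space_pi[simp]: "space \<pi> = space S"
  by (rule sets_eq_imp_space_eq) simp

lemma space_S_nonempty: "space S \<noteq> {}"
  using not_empty by simp

lemma kernel_subprob[measurable]: "P \<in> measurable S (subprob_algebra S)"
  by (rule measurable_prob_algebraD[OF kernel])

lemma prob_space_kernel: "x \<in> space S \<Longrightarrow> prob_space (P x)"
  and sets_kernel_eq: "x \<in> space S \<Longrightarrow> sets (P x) = sets S"
  using measurable_space[OF kernel] by (auto simp: space_prob_algebra)

lemma space_kernel_eq: "x \<in> space S \<Longrightarrow> space (P x) = space S"
  by (rule sets_eq_imp_space_eq[OF sets_kernel_eq])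

lemma borel_measurable_kernel: "x \<in> space S \<Longrightarrow> borel_measurable (P x) = borel_measurable S"
  by (intro measurable_cong_sets sets_kernel_eq refl)

lemma borel_measurable_pi: "borel_measurable \<pi> = borel_measurable S"
  by (intro measurable_cong_sets sets_pi refl)

lemma nn_kernel_measurable[measurable]:
  "f \<in> borel_measurable S \<Longrightarrow> (\<lambda>x. \<integral>\<^sup>+y. f y \<partial>P x) \<in> borel_measurable S"
  by (rule measurable_compose[OF kernel_subprob nn_integral_measurable_subprob_algebra])

lemma kernel_op_measurable[measurable]:
  "f \<in> borel_measurable S \<Longrightarrow> kernel_op P f \<in> borel_measurable S"
  unfolding kernel_op_def
  by (rule measurable_compose[OF kernel_subprob integral_measurable_subprob_algebra])

text \<open>Invariance in monadic form, so that \<open>nn_integral_bind\<close> carries it from sets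
  to all nonnegative measurable functions.\<close>

lemma bind_kernel: "\<pi> \<bind> P = \<pi>"
proof (rule measure_eqI)
  show "sets (\<pi> \<bind> P) = sets \<pi>"
    by (subst sets_bind_measurable[where B = S]) (auto simp: space_S_nonempty)
  fix A assume "A \<in> sets (\<pi> \<bind> P)"
  then have "A \<in> sets S"
    by (subst (asm) sets_bind_measurable[where B = S]) (auto simp: space_S_nonempty)
  then show "emeasure (\<pi> \<bind> P) A = emeasure \<pi> A"
    using invariant by (subst emeasure_bind[where N = S]) (auto simp: space_S_nonempty invariant_prob_def)
qed

lemma nn_integral_kernel:
  "f \<in> borel_measurable S \<Longrightarrow> (\<integral>\<^sup>+x. \<integral>\<^sup>+y. f y \<partial>P x \<partial>\<pi>) = (\<integral>\<^sup>+x. f x \<partial>\<pi>)"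
  using nn_integral_bind[of f S P \<pi>] by (simp add: bind_kernel)

lemma integrable_bmeas[intro, simp]: "f \<in> bmeas S \<Longrightarrow> integrable \<pi> f"
  by (erule bmeasE) (rule integrable_bounded, auto dest: bmeasD)

lemma integrable_kernel_bmeas[intro]: "f \<in> bmeas S \<Longrightarrow> x \<in> space S \<Longrightarrow> integrable (P x) f"
  by (erule bmeasE, rule prob_space.integrable_bounded)
     (auto dest: bmeasD simp: prob_space_kernel borel_measurable_kernel space_kernel_eq)

lemma kernel_op_const[simp]: "x \<in> space S \<Longrightarrow> kernel_op P (\<lambda>y. c) x = c"
  by (simp add: kernel_op_def prob_space.prob_space[OF prob_space_kernel])

lemma kernel_op_add: "f \<in> bmeas S \<Longrightarrow> g \<in> bmeas S \<Longrightarrow> x \<in> space S \<Longrightarrow>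
    kernel_op P (\<lambda>y. f y + g y) x = kernel_op P f x + kernel_op P g x"
  by (simp add: kernel_op_def integrable_kernel_bmeas)

lemma kernel_op_diff: "f \<in> bmeas S \<Longrightarrow> g \<in> bmeas S \<Longrightarrow> x \<in> space S \<Longrightarrow>
    kernel_op P (\<lambda>y. f y - g y) x = kernel_op P f x - kernel_op P g x"
  by (simp add: kernel_op_def integrable_kernel_bmeas)

lemma kernel_op_mult: "kernel_op P (\<lambda>y. c * f y) x = c * kernel_op P f x"
  by (simp add: kernel_op_def)

lemma kernel_op_divide: "kernel_op P (\<lambda>y. f y / c) x = kernel_op P f x / c"
  by (simp add: kernel_op_def)

lemma kernel_op_sum: "(\<And>i. i \<in> I \<Longrightarrow> f i \<in> bmeas S) \<Longrightarrow> x \<in> space S \<Longrightarrow>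
    kernel_op P (\<lambda>y. \<Sum>i\<in>I. f i y) x = (\<Sum>i\<in>I. kernel_op P (f i) x)"
  by (simp add: kernel_op_def integrable_kernel_bmeas Bochner_Integration.integral_sum)

lemma kernel_op_cong: "(\<And>y. y \<in> space S \<Longrightarrow> f y = g y) \<Longrightarrow> x \<in> space S \<Longrightarrow>
    kernel_op P f x = kernel_op P g x"
  unfolding kernel_op_def by (intro Bochner_Integration.integral_cong) (auto simp: space_kernel_eq)

lemma kernel_op_mono: "f \<in> bmeas S \<Longrightarrow> g \<in> bmeas S \<Longrightarrow> (\<And>y. y \<in> space S \<Longrightarrow> f y \<le> g y) \<Longrightarrow>
    x \<in> space S \<Longrightarrow> kernel_op P f x \<le> kernel_op P g x"
  unfolding kernel_op_def by (intro integral_mono) (auto simp: space_kernel_eq)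

lemma kernel_op_nonneg: "(\<And>y. y \<in> space S \<Longrightarrow> 0 \<le> f y) \<Longrightarrow> x \<in> space S \<Longrightarrow> 0 \<le> kernel_op P f x"
  unfolding kernel_op_def by (intro integral_nonneg_AE AE_I2) (auto simp: space_kernel_eq)

lemma kernel_op_bmeas[intro]: "f \<in> bmeas S \<Longrightarrow> kernel_op P f \<in> bmeas S"
proof -
  assume f: "f \<in> bmeas S"
  then obtain B where B: "0 \<le> B" "\<And>x. x \<in> space S \<Longrightarrow> \<bar>f x\<bar> \<le> B"
    by (metis bmeasE)
  show ?thesis
  proof (rule bmeasI)
    show "kernel_op P f \<in> borel_measurable S" using f by (auto dest: bmeasD)
    fix x assume x: "x \<in> space S"
    have "kernel_op P f x \<le> kernel_op P (\<lambda>y. B) x" "kernel_op P (\<lambda>y. - B) x \<le> kernel_op P f x"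
      using f B by (intro kernel_op_mono x; force simp: abs_le_iff)+
    then show "\<bar>kernel_op P f x\<bar> \<le> B" using x by simp
  qed
qed

lemma ennreal_kernel_op:
  assumes "f \<in> bmeas S" "\<And>y. y \<in> space S \<Longrightarrow> 0 \<le> f y" "x \<in> space S"
  shows "ennreal (kernel_op P f x) = (\<integral>\<^sup>+y. ennreal (f y) \<partial>P x)"
  unfolding kernel_op_def using assms
  by (intro nn_integral_eq_integral[symmetric]) (auto simp: space_kernel_eq)

lemma integral_kernel_op:
  assumes f: "f \<in> bmeas S"
  shows "(\<integral>x. kernel_op P f x \<partial>\<pi>) = (\<integral>x. f x \<partial>\<pi>)"
proof -
  have nonneg: "(\<integral>x. kernel_op P g x \<partial>\<pi>) = (\<integral>x. g x \<partial>\<pi>)"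
    if g: "g \<in> bmeas S" "\<And>y. y \<in> space S \<Longrightarrow> 0 \<le> g y" for g
  proof -
    have "ennreal (\<integral>x. kernel_op P g x \<partial>\<pi>) = (\<integral>\<^sup>+x. ennreal (kernel_op P g x) \<partial>\<pi>)"
      using g by (intro nn_integral_eq_integral[symmetric]) (auto simp: kernel_op_nonneg)
    also have "\<dots> = (\<integral>\<^sup>+x. \<integral>\<^sup>+y. ennreal (g y) \<partial>P x \<partial>\<pi>)"
      using g by (intro nn_integral_cong ennreal_kernel_op) auto
    also have "\<dots> = (\<integral>\<^sup>+x. ennreal (g x) \<partial>\<pi>)"
      using g by (intro nn_integral_kernel) (auto dest: bmeasD)
    also have "\<dots> = ennreal (\<integral>x. g x \<partial>\<pi>)"
      using g by (intro nn_integral_eq_integral) auto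
    finally show ?thesis
      using g by (subst (asm) ennreal_inj) (auto intro!: integral_nonneg_AE simp: kernel_op_nonneg)
  qed
  \<comment> \<open>Adding the bound B makes the function nonnegative, and the kernel fixes
    constants.\<close>
  obtain B where B: "\<And>x. x \<in> space S \<Longrightarrow> \<bar>f x\<bar> \<le> B" using f by (metis bmeasE)
  have "(\<integral>x. kernel_op P (\<lambda>y. f y + B) x \<partial>\<pi>) = (\<integral>x. f x + B \<partial>\<pi>)"
    using f B by (intro nonneg) (auto, force simp: abs_le_iff)
  also have "(\<integral>x. kernel_op P (\<lambda>y. f y + B) x \<partial>\<pi>) = (\<integral>x. kernel_op P f x + B \<partial>\<pi>)"
    using f by (intro Bochner_Integration.integral_cong) (auto simp: kernel_op_add)
  finally show ?thesis
    using f by (simp add: kernel_op_bmeas)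
qed

lemma kernel_op_square_le:
  assumes "f \<in> bmeas S" "x \<in> space S"
  shows "(kernel_op P f x)\<^sup>2 \<le> kernel_op P (\<lambda>y. (f y)\<^sup>2) x"
proof -
  have "(\<integral>y. 1 * f y \<partial>P x)\<^sup>2 \<le> (\<integral>y. 1\<^sup>2 \<partial>P x) * (\<integral>y. (f y)\<^sup>2 \<partial>P x)"
    using assms by (intro integral_Cauchy_Schwarz integrable_kernel_bmeas) auto
  then show ?thesis
    by (simp add: kernel_op_def prob_space.prob_space[OF prob_space_kernel[OF assms(2)]])
qed

text \<open>
  The adjoint of a Markov kernel on nonnegative functions: \<open>k\<close> is the density of the law at the
  second step of the chain that starts from \<open>u \<pi>\<close>.
\<close>

lemma nn_adjoint:
  fixes u :: "'a \<Rightarrow> real"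
  assumes u[measurable]: "u \<in> borel_measurable S" and fin: "(\<integral>\<^sup>+x. ennreal (u x) \<partial>\<pi>) < \<infinity>"
  obtains k :: "'a \<Rightarrow> real" where "k \<in> borel_measurable S" "\<And>x. 0 \<le> k x"
    "(\<integral>\<^sup>+x. ennreal (k x) \<partial>\<pi>) = (\<integral>\<^sup>+x. ennreal (u x) \<partial>\<pi>)"
    "\<And>f. f \<in> borel_measurable S \<Longrightarrow>
       (\<integral>\<^sup>+x. ennreal (u x) * (\<integral>\<^sup>+y. f y \<partial>P x) \<partial>\<pi>) = (\<integral>\<^sup>+x. ennreal (k x) * f x \<partial>\<pi>)"
proof -
  define \<mu> where "\<mu> = density \<pi> (\<lambda>x. ennreal (u x))"
  have [measurable_cong]: "sets \<mu> = sets S" by (simp add: \<mu>_def)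
  define \<rho> where "\<rho> = \<mu> \<bind> P"
  have P: "P \<in> measurable \<mu> (subprob_algebra S)" by measurable
  have ne: "space \<mu> \<noteq> {}" by (simp add: \<mu>_def space_S_nonempty)
  have sets_\<rho>: "sets \<rho> = sets S"
    unfolding \<rho>_def by (rule sets_bind_measurable[OF P ne])
  have nn: "(\<integral>\<^sup>+x. f x \<partial>\<rho>) = (\<integral>\<^sup>+x. ennreal (u x) * (\<integral>\<^sup>+y. f y \<partial>P x) \<partial>\<pi>)"
    if [measurable]: "f \<in> borel_measurable S" for f
  proof -
    have "(\<integral>\<^sup>+x. f x \<partial>\<rho>) = (\<integral>\<^sup>+x. \<integral>\<^sup>+y. f y \<partial>P x \<partial>\<mu>)"
      unfolding \<rho>_def by (rule nn_integral_bind[OF that P])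
    also have "\<dots> = (\<integral>\<^sup>+x. ennreal (u x) * (\<integral>\<^sup>+y. f y \<partial>P x) \<partial>\<pi>)"
      unfolding \<mu>_def by (subst nn_integral_density) auto
    finally show ?thesis .
  qed
  have em: "emeasure \<rho> A = (\<integral>\<^sup>+x. ennreal (u x) * emeasure (P x) A \<partial>\<pi>)" if "A \<in> sets S" for A
  proof -
    have "emeasure \<rho> A = (\<integral>\<^sup>+x. indicator A x \<partial>\<rho>)"
      using that sets_\<rho> by simp
    also have "\<dots> = (\<integral>\<^sup>+x. ennreal (u x) * (\<integral>\<^sup>+y. indicator A y \<partial>P x) \<partial>\<pi>)"
      using that by (intro nn) auto
    also have "\<dots> = (\<integral>\<^sup>+x. ennreal (u x) * emeasure (P x) A \<partial>\<pi>)"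
      using that by (intro nn_integral_cong) (simp add: sets_kernel_eq)
    finally show ?thesis .
  qed
  have total: "(\<integral>\<^sup>+x. 1 \<partial>\<rho>) = (\<integral>\<^sup>+x. ennreal (u x) \<partial>\<pi>)"
    by (subst nn) (auto intro!: nn_integral_cong simp: prob_space.emeasure_space_1[OF prob_space_kernel])
  have fin_\<rho>: "finite_measure \<rho>"
    using fin total by (intro finite_measureI) auto
  \<comment> \<open>Invariance enters here: a \<pi>-null set N has \<open>P x\<close>-measure 0 for
    \<pi>-almost every x, hence also \<rho>-measure 0.\<close>
  have ac: "absolutely_continuous \<pi> \<rho>"
    unfolding absolutely_continuous_def
  proof
    fix N assume N: "N \<in> null_sets \<pi>"
    then have NS: "N \<in> sets S" by auto
    then have "(\<integral>\<^sup>+x. emeasure (P x) N \<partial>\<pi>) = 0"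
      using invariant N by (auto simp: invariant_prob_def null_sets_def)
    then have "AE x in \<pi>. emeasure (P x) N = 0"
      using NS by (subst (asm) nn_integral_0_iff_AE) auto
    then have "emeasure \<rho> N = 0"
      unfolding em[OF NS] using NS by (subst nn_integral_0_iff_AE) auto
    then show "N \<in> null_sets \<rho>" using NS sets_\<rho> by auto
  qed
  define k where "k x = enn2real (RN_deriv \<pi> \<rho> x)" for x
  have [measurable]: "k \<in> borel_measurable S"
    using borel_measurable_RN_deriv[of \<pi> \<rho>] unfolding k_def borel_measurable_pi by measurable
  have "AE x in \<pi>. RN_deriv \<pi> \<rho> x \<noteq> \<infinity>"
    using fin_\<rho> ac sets_\<rho> by (intro RN_deriv_finite) (auto simp: finite_measure_def)
  then have k: "AE x in \<pi>. RN_deriv \<pi> \<rho> x = ennreal (k x)"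
    by eventually_elim (simp add: k_def less_top)
  have k_int: "(\<integral>\<^sup>+x. f x \<partial>\<rho>) = (\<integral>\<^sup>+x. ennreal (k x) * f x \<partial>\<pi>)" if [measurable]: "f \<in> borel_measurable S" for f
  proof -
    have "(\<integral>\<^sup>+x. f x \<partial>\<rho>) = (\<integral>\<^sup>+x. RN_deriv \<pi> \<rho> x * f x \<partial>\<pi>)"
      using ac sets_\<rho> that by (intro RN_deriv_nn_integral) (auto simp: borel_measurable_pi)
    also have "\<dots> = (\<integral>\<^sup>+x. ennreal (k x) * f x \<partial>\<pi>)"
      using k by (intro nn_integral_cong_AE) auto
    finally show ?thesis .
  qed
  show ?thesis
  proof (rule that[of k])
    show "(\<integral>\<^sup>+x. ennreal (k x) \<partial>\<pi>) = (\<integral>\<^sup>+x. ennreal (u x) \<partial>\<pi>)"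
      using k_int[of "\<lambda>x. 1"] total by simp
  qed (auto simp: k_def[abs_def, symmetric] simp flip: nn k_int, simp add: k_def)
qed


lemma prob_space_S[simp]: "prob (space S) = 1"
  using prob_space by simp

section \<open>Iterated adjoints on nonnegative functions, and the pairing with the kernel\<close>

abbreviation nn_kernel :: "('a \<Rightarrow> ennreal) \<Rightarrow> 'a \<Rightarrow> ennreal" where
  "nn_kernel f \<equiv> \<lambda>x. \<integral>\<^sup>+y. f y \<partial>P x"

lemma nn_kernel_pow_measurable[measurable]:
  "f \<in> borel_measurable S \<Longrightarrow> (nn_kernel ^^ n) f \<in> borel_measurable S"
  by (induction n) auto

lemma nn_integral_kernel_pow:
  "f \<in> borel_measurable S \<Longrightarrow> (\<integral>\<^sup>+x. (nn_kernel ^^ n) f x \<partial>\<pi>) = (\<integral>\<^sup>+x. f x \<partial>\<pi>)"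
  by (induction n) (auto simp: nn_integral_kernel)

text \<open>Here \<open>k\<close> is the density of the law reached from u \<pi> after n steps, that
  is, the n-th power of the adjoint applied to \<open>u\<close>.\<close>

lemma nn_adjoint_pow:
  fixes u :: "'a \<Rightarrow> real"
  assumes "u \<in> borel_measurable S" "(\<integral>\<^sup>+x. ennreal (u x) \<partial>\<pi>) < \<infinity>"
  obtains k :: "'a \<Rightarrow> real" where "k \<in> borel_measurable S" "\<And>x. 0 \<le> k x"
    "(\<integral>\<^sup>+x. ennreal (k x) \<partial>\<pi>) = (\<integral>\<^sup>+x. ennreal (u x) \<partial>\<pi>)"
    "\<And>f. f \<in> borel_measurable S \<Longrightarrow>
       (\<integral>\<^sup>+x. ennreal (u x) * (nn_kernel ^^ n) f x \<partial>\<pi>) = (\<integral>\<^sup>+x. ennreal (k x) * f x \<partial>\<pi>)"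
  using assms
proof (induction n arbitrary: u thesis)
  case 0
  \<comment> \<open>\<open>u\<close> may be negative somewhere, where \<open>ennreal\<close> reads
    it as 0, while \<open>k\<close> must be nonnegative as a real function.\<close>
  have "ennreal (max 0 (u x)) = ennreal (u x)" for x
    by (auto simp: max_def ennreal_neg)
  then show ?case
    by (intro 0(1)[of "\<lambda>x. max 0 (u x)"]) (use 0(2) in auto)
next
  case (Suc n)
  obtain k where k: "k \<in> borel_measurable S" "\<And>x. 0 \<le> k x"
    "(\<integral>\<^sup>+x. ennreal (k x) \<partial>\<pi>) = (\<integral>\<^sup>+x. ennreal (u x) \<partial>\<pi>)"
    "\<And>f. f \<in> borel_measurable S \<Longrightarrow>
       (\<integral>\<^sup>+x. ennreal (u x) * nn_kernel f x \<partial>\<pi>) = (\<integral>\<^sup>+x. ennreal (k x) * f x \<partial>\<pi>)"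
    by (rule nn_adjoint[OF Suc.prems(2,3)]) (rule that; assumption)
  obtain k' where k': "k' \<in> borel_measurable S" "\<And>x. 0 \<le> k' x"
    "(\<integral>\<^sup>+x. ennreal (k' x) \<partial>\<pi>) = (\<integral>\<^sup>+x. ennreal (k x) \<partial>\<pi>)"
    "\<And>f. f \<in> borel_measurable S \<Longrightarrow>
       (\<integral>\<^sup>+x. ennreal (k x) * (nn_kernel ^^ n) f x \<partial>\<pi>) = (\<integral>\<^sup>+x. ennreal (k' x) * f x \<partial>\<pi>)"
    by (rule Suc.IH[of k]) (use k(1,3) Suc.prems(3) in simp_all)
  show ?case
  proof (rule Suc.prems(1))
    fix f :: "'a \<Rightarrow> ennreal" assume f: "f \<in> borel_measurable S"
    have "(\<integral>\<^sup>+x. ennreal (u x) * (nn_kernel ^^ Suc n) f x \<partial>\<pi>) = (\<integral>\<^sup>+x. ennreal (k x) * (nn_kernel ^^ n) f x \<partial>\<pi>)"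
      using k(4)[OF nn_kernel_pow_measurable[OF f, of n]] by simp
    then show "(\<integral>\<^sup>+x. ennreal (u x) * (nn_kernel ^^ Suc n) f x \<partial>\<pi>) = (\<integral>\<^sup>+x. ennreal (k' x) * f x \<partial>\<pi>)"
      using k'(4)[OF f] by simp
  qed (use k k' in auto)
qed

text \<open>Tested on the set where c < k, the hypothesis forces the excess k - c to integrate to 0
  there; c \<pi>(A) is finite, so it may be cancelled.\<close>

lemma AE_le_of_integral_indicator:
  fixes k :: "'a \<Rightarrow> real"
  assumes k[measurable]: "k \<in> borel_measurable S" and c: "0 \<le> c"
    and le: "\<And>A. A \<in> sets S \<Longrightarrow> (\<integral>\<^sup>+x. ennreal (k x) * indicator A x \<partial>\<pi>) \<le> ennreal c * emeasure \<pi> A"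
  shows "AE x in \<pi>. k x \<le> c"
proof -
  define A where "A = {x \<in> space S. c < k x}"
  have A[measurable]: "A \<in> sets S" unfolding A_def by measurable
  have "(\<integral>\<^sup>+x. ennreal (k x - c) * indicator A x \<partial>\<pi>) + ennreal c * emeasure \<pi> A
    = (\<integral>\<^sup>+x. ennreal (k x - c) * indicator A x + ennreal c * indicator A x \<partial>\<pi>)"
    by (subst nn_integral_add) (auto simp: nn_integral_cmult_indicator)
  also have "\<dots> = (\<integral>\<^sup>+x. ennreal (k x) * indicator A x \<partial>\<pi>)"
    using c by (intro nn_integral_cong) (auto simp: A_def split: split_indicator simp flip: ennreal_plus)
  also have "\<dots> \<le> 0 + ennreal c * emeasure \<pi> A"
    using le[OF A] by simp
  finally have "(\<integral>\<^sup>+x. ennreal (k x - c) * indicator A x \<partial>\<pi>) = 0"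
    unfolding add.commute[of _ "ennreal c * emeasure \<pi> A"] ennreal_add_left_cancel_le
    by (auto simp: ennreal_mult_eq_top_iff)
  then have "AE x in \<pi>. ennreal (k x - c) * indicator A x = 0"
    by (subst (asm) nn_integral_0_iff_AE) auto
  then show ?thesis
    by (rule AE_mp) (auto intro!: AE_I2 simp: A_def ennreal_eq_0_iff split: split_indicator_asm)
qed

text \<open>The adjoint preserves upper bounds, the L\<infinity> end of the interpolation: by
  invariance the iterated kernel applied to an indicator of A integrates to \<pi>(A).\<close>

lemma nn_adjoint_bound:
  fixes u k :: "'a \<Rightarrow> real"
  assumes "k \<in> borel_measurable S" "0 \<le> c" "\<And>x. x \<in> space S \<Longrightarrow> u x \<le> c"
    and adj: "\<And>f. f \<in> borel_measurable S \<Longrightarrow>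
       (\<integral>\<^sup>+x. ennreal (u x) * (nn_kernel ^^ n) f x \<partial>\<pi>) = (\<integral>\<^sup>+x. ennreal (k x) * f x \<partial>\<pi>)"
  shows "AE x in \<pi>. k x \<le> c"
proof (rule AE_le_of_integral_indicator)
  fix A assume A[measurable]: "A \<in> sets S"
  have "(\<integral>\<^sup>+x. ennreal (k x) * indicator A x \<partial>\<pi>) = (\<integral>\<^sup>+x. ennreal (u x) * (nn_kernel ^^ n) (indicator A) x \<partial>\<pi>)"
    by (rule adj[symmetric]) auto
  also have "\<dots> \<le> (\<integral>\<^sup>+x. ennreal c * (nn_kernel ^^ n) (indicator A) x \<partial>\<pi>)"
    using assms by (intro nn_integral_mono mult_right_mono) (auto intro: ennreal_leI)
  also have "\<dots> = ennreal c * emeasure \<pi> A"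
    by (subst nn_integral_cmult) (auto simp: nn_integral_kernel_pow)
  finally show "(\<integral>\<^sup>+x. ennreal (k x) * indicator A x \<partial>\<pi>) \<le> ennreal c * emeasure \<pi> A" .
qed (use assms in auto)

text \<open>For unbounded \<open>h\<close> the Bochner integral \<open>kernel_op P h x\<close> is 0
  by default wherever \<open>h\<close> fails to be integrable for \<open>P x\<close>. Invariance
  confines these x to a null set, so linearity survives almost everywhere.\<close>

lemma AE_integrable_kernel:
  fixes h :: "'a \<Rightarrow> real"
  assumes h[measurable]: "h \<in> borel_measurable S" and int: "integrable \<pi> h"
  shows "AE x in \<pi>. integrable (P x) h"
proof -
  have "(\<integral>\<^sup>+x. nn_kernel (\<lambda>y. ennreal \<bar>h y\<bar>) x \<partial>\<pi>) \<noteq> \<infinity>"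
    using int by (subst nn_integral_kernel) (auto simp: integrable_iff_bounded)
  then have "AE x in \<pi>. nn_kernel (\<lambda>y. ennreal \<bar>h y\<bar>) x \<noteq> \<infinity>"
    by (intro nn_integral_noteq_infinite) auto
  then show ?thesis
    by (rule AE_mp) (auto intro!: AE_I2 simp: integrable_iff_bounded borel_measurable_kernel less_top)
qed

lemma integral_adjoint_nonneg:
  fixes u h k :: "'a \<Rightarrow> real"
  assumes u: "u \<in> bmeas S" "\<And>x. x \<in> space S \<Longrightarrow> 0 \<le> u x"
    and k[measurable]: "k \<in> borel_measurable S" and kb: "\<And>x. 0 \<le> k x" "AE x in \<pi>. k x \<le> B"
    and adj: "\<And>f. f \<in> borel_measurable S \<Longrightarrow>
       (\<integral>\<^sup>+x. ennreal (u x) * nn_kernel f x \<partial>\<pi>) = (\<integral>\<^sup>+x. ennreal (k x) * f x \<partial>\<pi>)"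
    and h[measurable]: "h \<in> borel_measurable S" and int: "integrable \<pi> h" and h0: "\<And>x. 0 \<le> h x"
  shows "integrable \<pi> (\<lambda>x. kernel_op P h x * u x)"
    and "integrable \<pi> (\<lambda>x. h x * k x)"
    and "(\<integral>x. kernel_op P h x * u x \<partial>\<pi>) = (\<integral>x. h x * k x \<partial>\<pi>)"
proof -
  note [measurable] = bmeasD[OF u(1)]
  obtain C where C: "\<And>x. x \<in> space S \<Longrightarrow> \<bar>u x\<bar> \<le> C" using u(1) by (metis bmeasE)
  have P0: "0 \<le> kernel_op P h x" for x
    unfolding kernel_op_def by (intro integral_nonneg_AE AE_I2 h0)
  have eq: "AE x in \<pi>. ennreal (kernel_op P h x) = nn_kernel (\<lambda>y. ennreal (h y)) x"
    using AE_integrable_kernel[OF h int]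
    by eventually_elim (auto simp: kernel_op_def h0 intro!: nn_integral_eq_integral[symmetric])
  have "(\<integral>\<^sup>+x. ennreal (kernel_op P h x) \<partial>\<pi>) = (\<integral>\<^sup>+x. nn_kernel (\<lambda>y. ennreal (h y)) x \<partial>\<pi>)"
    using eq by (rule nn_integral_cong_AE)
  also have "\<dots> = (\<integral>\<^sup>+x. ennreal (h x) \<partial>\<pi>)"
    by (rule nn_integral_kernel) measurable
  also have "\<dots> < \<infinity>"
    using int h0 by (simp add: integrable_iff_bounded)
  finally have Pint: "integrable \<pi> (kernel_op P h)"
    using P0 by (intro integrableI_nonneg) auto
  show 1: "integrable \<pi> (\<lambda>x. kernel_op P h x * u x)"
    using C by (intro Bochner_Integration.integrable_bound[OF integrable_mult_left[OF Pint, of C]])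
      (auto intro!: AE_I2 simp: abs_mult mult_left_mono order_trans[OF C abs_ge_self])
  show 2: "integrable \<pi> (\<lambda>x. h x * k x)"
  proof (rule Bochner_Integration.integrable_bound[OF integrable_mult_left[OF int, of B]])
    show "AE x in \<pi>. norm (h x * k x) \<le> norm (h x * B)"
      using kb(2)
    proof eventually_elim
      case (elim x)
      then show ?case
        using kb(1)[of x] by (auto simp: abs_mult intro!: mult_left_mono)
    qed
  qed measurable
  have "ennreal (\<integral>x. kernel_op P h x * u x \<partial>\<pi>) = (\<integral>\<^sup>+x. ennreal (kernel_op P h x * u x) \<partial>\<pi>)"
    using 1 P0 u by (intro nn_integral_eq_integral[symmetric]) (auto intro!: AE_I2)
  also have "\<dots> = (\<integral>\<^sup>+x. ennreal (u x) * nn_kernel (\<lambda>y. ennreal (h y)) x \<partial>\<pi>)"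
    using eq AE_space by (intro nn_integral_cong_AE, eventually_elim)
      (auto simp: ennreal_mult' u(2) mult.commute)
  also have "\<dots> = (\<integral>\<^sup>+x. ennreal (k x) * ennreal (h x) \<partial>\<pi>)"
    by (rule adj) measurable
  also have "\<dots> = (\<integral>\<^sup>+x. ennreal (h x * k x) \<partial>\<pi>)"
    by (intro nn_integral_cong) (simp add: ennreal_mult h0 kb(1) mult.commute)
  also have "\<dots> = ennreal (\<integral>x. h x * k x \<partial>\<pi>)"
    using 2 h0 kb(1) by (intro nn_integral_eq_integral) (auto intro!: AE_I2)
  finally show "(\<integral>x. kernel_op P h x * u x \<partial>\<pi>) = (\<integral>x. h x * k x \<partial>\<pi>)"
    using P0 u h0 kb by (subst (asm) ennreal_inj) (auto intro!: integral_nonneg_AE AE_I2)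
qed

section \<open>The adjoint on L2 and the symmetrized form\<close>

lemma integrable_L2: "h \<in> L2 \<pi> \<Longrightarrow> integrable \<pi> h"
  by (auto simp: L2_def intro: square_integrable_imp_integrable)

lemma integrable_L2_mult:
  assumes "g \<in> L2 \<pi>" "h \<in> L2 \<pi>"
  shows "integrable \<pi> (\<lambda>x. g x * h x)"
proof (rule Bochner_Integration.integrable_bound)
  show "integrable \<pi> (\<lambda>x. (g x)\<^sup>2 + (h x)\<^sup>2)" "(\<lambda>x. g x * h x) \<in> borel_measurable \<pi>"
    using assms by (auto simp: L2_def)
  have "\<bar>a * b\<bar> \<le> a\<^sup>2 + b\<^sup>2" for a b :: real
    using sum_squares_bound[of "\<bar>a\<bar>" "\<bar>b\<bar>"] mult_nonneg_nonneg[OF abs_ge_zero[of a] abs_ge_zero[of b]]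
    unfolding abs_mult power2_abs by linarith
  then show "AE x in \<pi>. norm (g x * h x) \<le> norm ((g x)\<^sup>2 + (h x)\<^sup>2)"
    by (intro AE_I2) (simp add: abs_of_nonneg)
qed

lemma bmeas_L2: "f \<in> bmeas S \<Longrightarrow> f \<in> L2 \<pi>"
  by (auto simp: L2_def borel_measurable_pi dest: bmeasD)

text \<open>\<open>adjoint_op\<close> is defined by choice, so its characteristic property needs a
  witness first. The densities obtained from the positive and negative parts of \<open>g\<close> are
  bounded almost everywhere, and their difference is the required element of L2.\<close>

lemma adjoint_exists:
  assumes g: "g \<in> bmeas S"
  obtains k where "k \<in> L2 \<pi>" "\<And>h. h \<in> L2 \<pi> \<Longrightarrow> L2_inner \<pi> (kernel_op P h) g = L2_inner \<pi> h k"
proof -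
  have part: "\<exists>k B. k \<in> borel_measurable S \<and> (\<forall>x. 0 \<le> k x) \<and> (AE x in \<pi>. k x \<le> B) \<and>
     (\<forall>f\<in>borel_measurable S. (\<integral>\<^sup>+x. ennreal (u x) * nn_kernel f x \<partial>\<pi>) = (\<integral>\<^sup>+x. ennreal (k x) * f x \<partial>\<pi>))"
    if u: "u \<in> bmeas S" "\<And>x. 0 \<le> u x" for u
  proof -
    note [measurable] = bmeasD[OF u(1)]
    obtain B where B: "0 \<le> B" "\<And>x. x \<in> space S \<Longrightarrow> \<bar>u x\<bar> \<le> B" using u by (metis bmeasE)
    have "(\<integral>\<^sup>+x. ennreal (u x) \<partial>\<pi>) < \<infinity>"
      using integrable_bmeas[OF u(1)] u(2) by (simp add: integrable_iff_bounded)
    then obtain k :: "'a \<Rightarrow> real" where k: "k \<in> borel_measurable S" "\<And>x. 0 \<le> k x"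
      "(\<integral>\<^sup>+x. ennreal (k x) \<partial>\<pi>) = (\<integral>\<^sup>+x. ennreal (u x) \<partial>\<pi>)"
      "\<And>f. f \<in> borel_measurable S \<Longrightarrow>
       (\<integral>\<^sup>+x. ennreal (u x) * (nn_kernel ^^ 1) f x \<partial>\<pi>) = (\<integral>\<^sup>+x. ennreal (k x) * f x \<partial>\<pi>)"
      by (rule nn_adjoint_pow[OF bmeasD[OF u(1)], where n = 1]) (rule that; assumption)
    have "AE x in \<pi>. k x \<le> B"
      using k B by (intro nn_adjoint_bound[of k B u 1]) (auto dest: abs_le_D1)
    then show ?thesis
      using k(1,2) k(4)[simplified] by (intro exI[of _ k] exI[of _ B]) auto
  qed
  define gp gm where "gp x = max (g x) 0" and "gm x = max (- g x) 0" for x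
  have gpm: "gp \<in> bmeas S" "gm \<in> bmeas S" "\<And>x. 0 \<le> gp x" "\<And>x. 0 \<le> gm x"
    using g unfolding gp_def[abs_def] gm_def[abs_def] by auto
  have g_eq: "g x = gp x - gm x" for x by (simp add: gp_def gm_def)
  obtain k1 B1 where k1: "k1 \<in> borel_measurable S" "\<And>x. 0 \<le> k1 x" "AE x in \<pi>. k1 x \<le> B1"
     "\<And>f. f \<in> borel_measurable S \<Longrightarrow> (\<integral>\<^sup>+x. ennreal (gp x) * nn_kernel f x \<partial>\<pi>) = (\<integral>\<^sup>+x. ennreal (k1 x) * f x \<partial>\<pi>)"
    using part[OF gpm(1,3)] by blast
  obtain k2 B2 where k2: "k2 \<in> borel_measurable S" "\<And>x. 0 \<le> k2 x" "AE x in \<pi>. k2 x \<le> B2"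
     "\<And>f. f \<in> borel_measurable S \<Longrightarrow> (\<integral>\<^sup>+x. ennreal (gm x) * nn_kernel f x \<partial>\<pi>) = (\<integral>\<^sup>+x. ennreal (k2 x) * f x \<partial>\<pi>)"
    using part[OF gpm(2,4)] by blast
  note [measurable] = k1(1) k2(1)
  define k where "k x = k1 x - k2 x" for x
  have [measurable]: "k \<in> borel_measurable S" unfolding k_def[abs_def] by measurable
  have "AE x in \<pi>. norm ((k x)\<^sup>2) \<le> (max B1 B2)\<^sup>2"
    using k1(3) k2(3)
  proof eventually_elim
    case (elim x)
    have "\<bar>k x\<bar> \<le> max B1 B2" using elim k1(2)[of x] k2(2)[of x] by (auto simp: k_def)
    then have "\<bar>k x\<bar>\<^sup>2 \<le> (max B1 B2)\<^sup>2" by (intro power_mono) auto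
    then show ?case by simp
  qed
  then have "integrable \<pi> (\<lambda>x. (k x)\<^sup>2)"
    by (rule integrable_const_bound) measurable
  then have kL2: "k \<in> L2 \<pi>"
    by (simp add: L2_def borel_measurable_pi)
  show ?thesis
  proof (rule that[OF kL2])
    fix h assume hL2: "h \<in> L2 \<pi>"
    then have h[measurable]: "h \<in> borel_measurable S"
      by (simp add: L2_def borel_measurable_pi)
    have int: "integrable \<pi> h" using hL2 by (rule integrable_L2)
    define hp hm where "hp x = max (h x) 0" and "hm x = max (- h x) 0" for x
    have hp: "hp \<in> borel_measurable S" "integrable \<pi> hp" "\<And>x. 0 \<le> hp x"
      and hm: "hm \<in> borel_measurable S" "integrable \<pi> hm" "\<And>x. 0 \<le> hm x"
      using int unfolding hp_def[abs_def] hm_def[abs_def] by auto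
    have h_eq: "h x = hp x - hm x" for x by (simp add: hp_def hm_def)
    then have h_fun: "h = (\<lambda>x. hp x - hm x)" by (rule ext)
    note [measurable] = hp(1) hm(1) bmeasD[OF gpm(1)] bmeasD[OF gpm(2)]
    note pp = integral_adjoint_nonneg[OF gpm(1) gpm(3) k1 hp]
    note pm = integral_adjoint_nonneg[OF gpm(1) gpm(3) k1 hm]
    note mp = integral_adjoint_nonneg[OF gpm(2) gpm(4) k2 hp]
    note mm = integral_adjoint_nonneg[OF gpm(2) gpm(4) k2 hm]
    have "AE x in \<pi>. kernel_op P h x * g x = kernel_op P hp x * gp x - kernel_op P hm x * gp x
        - (kernel_op P hp x * gm x - kernel_op P hm x * gm x)"
      using AE_integrable_kernel[OF hp(1,2)] AE_integrable_kernel[OF hm(1,2)]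
    proof eventually_elim
      case (elim x)
      then have Ph: "kernel_op P h x = kernel_op P hp x - kernel_op P hm x"
        unfolding kernel_op_def by (subst h_fun) simp
      show ?case unfolding Ph g_eq by (simp add: algebra_simps)
    qed
    then have "L2_inner \<pi> (kernel_op P h) g = (\<integral>x. kernel_op P hp x * gp x - kernel_op P hm x * gp x
        - (kernel_op P hp x * gm x - kernel_op P hm x * gm x) \<partial>\<pi>)"
      unfolding L2_inner_def using bmeasD[OF g] by (intro integral_cong_AE) auto
    also have "\<dots> = (\<integral>x. hp x * k1 x - hm x * k1 x - (hp x * k2 x - hm x * k2 x) \<partial>\<pi>)"
      using pp pm mp mm by simp
    also have "\<dots> = L2_inner \<pi> h k"
      unfolding L2_inner_def by (simp add: h_eq k_def algebra_simps)
    finally show "L2_inner \<pi> (kernel_op P h) g = L2_inner \<pi> h k" .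
  qed
qed

text \<open>An operator and its adjoint have the same quadratic form, so the right gap speaks about
  \<open>P\<close> itself.\<close>

lemma L2_inner_reversibilization:
  assumes h: "h \<in> bmeas S"
  shows "L2_inner \<pi> (reversibilization \<pi> P h) h = L2_inner \<pi> (kernel_op P h) h"
proof -
  define k where "k = adjoint_op \<pi> (kernel_op P) h"
  obtain k0 where "k0 \<in> L2 \<pi>" "\<And>f. f \<in> L2 \<pi> \<Longrightarrow> L2_inner \<pi> (kernel_op P f) h = L2_inner \<pi> f k0"
    by (rule adjoint_exists[OF h]) (rule that; assumption)
  then have "\<exists>k. k \<in> L2 \<pi> \<and> (\<forall>f\<in>L2 \<pi>. L2_inner \<pi> (kernel_op P f) h = L2_inner \<pi> f k)"
    by blast
  from someI_ex[OF this]
  have "k \<in> L2 \<pi> \<and> (\<forall>f\<in>L2 \<pi>. L2_inner \<pi> (kernel_op P f) h = L2_inner \<pi> f k)"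
    unfolding k_def adjoint_op_def .
  then have k: "k \<in> L2 \<pi>" "L2_inner \<pi> (kernel_op P h) h = L2_inner \<pi> h k"
    using bmeas_L2[OF h] by auto
  have "L2_inner \<pi> (reversibilization \<pi> P h) h = (\<integral>x. (kernel_op P h x * h x + k x * h x) / 2 \<partial>\<pi>)"
    unfolding L2_inner_def reversibilization_def k_def[symmetric]
    by (intro Bochner_Integration.integral_cong) (auto simp: algebra_simps add_divide_distrib)
  also have "\<dots> = (L2_inner \<pi> (kernel_op P h) h + L2_inner \<pi> k h) / 2"
    unfolding L2_inner_def using h k(1) by (simp add: integrable_L2_mult bmeas_L2 kernel_op_bmeas)
  also have "L2_inner \<pi> k h = L2_inner \<pi> h k"
    by (simp add: L2_inner_def mult.commute)
  finally show ?thesis using k(2) by simp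
qed

lemma Lp_norm_2:
  assumes "integrable \<pi> (\<lambda>x. (h x)\<^sup>2)"
  shows "Lp_norm \<pi> 2 h = ennreal (sqrt (\<integral>x. (h x)\<^sup>2 \<partial>\<pi>))"
proof -
  have [simp]: "(2 :: ennreal) \<noteq> \<infinity>" by simp
  have "(\<integral>\<^sup>+x. ennreal (\<bar>h x\<bar> powr 2) \<partial>\<pi>) = ennreal (\<integral>x. (h x)\<^sup>2 \<partial>\<pi>)"
    using assms by (subst nn_integral_eq_integral[symmetric]) (auto simp: powr_numeral)
  then show ?thesis
    by (simp add: Lp_norm_def powr_half_sqrt)
qed

lemma unit_centered_normalize:
  assumes "h \<in> bmeas S" "(\<integral>x. h x \<partial>\<pi>) = 0" "0 < (\<integral>x. (h x)\<^sup>2 \<partial>\<pi>)"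
  defines "s \<equiv> sqrt (\<integral>x. (h x)\<^sup>2 \<partial>\<pi>)"
  shows "(\<lambda>x. h x / s) \<in> unit_centered \<pi>"
proof -
  have "s\<^sup>2 = (\<integral>x. (h x)\<^sup>2 \<partial>\<pi>)" "0 < s" using assms by (auto simp: s_def)
  then have "(\<integral>x. (h x / s)\<^sup>2 \<partial>\<pi>) = 1"
    using assms(3) by (simp add: power_divide)
  moreover have "(\<lambda>x. h x / s) \<in> bmeas S" using assms by auto
  ultimately show ?thesis
    using assms by (simp add: unit_centered_def bmeas_L2 Lp_norm_2 bmeas_power)
qed

subsection \<open>Spectral gaps\<close>

lemma abs_gap:
  assumes h: "h \<in> bmeas S" "(\<integral>x. h x \<partial>\<pi>) = 0" and gap: "abs_lambda \<pi> P < 1"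
  shows "(\<integral>x. (kernel_op P h x)\<^sup>2 \<partial>\<pi>) \<le> (enn2real (abs_lambda \<pi> P))\<^sup>2 * (\<integral>x. (h x)\<^sup>2 \<partial>\<pi>)"
proof (cases "(\<integral>x. (h x)\<^sup>2 \<partial>\<pi>) = 0")
  case True
  \<comment> \<open>A function of norm 0 cannot be normalized; the kernel being a contraction of L2,
    its image has norm 0 too.\<close>
  have "(\<integral>x. (kernel_op P h x)\<^sup>2 \<partial>\<pi>) \<le> (\<integral>x. kernel_op P (\<lambda>y. (h y)\<^sup>2) x \<partial>\<pi>)"
    using h by (intro integral_mono kernel_op_square_le) auto
  then show ?thesis using True h by (simp add: integral_kernel_op bmeas_power)
next
  case False
  define s where "s = sqrt (\<integral>x. (h x)\<^sup>2 \<partial>\<pi>)"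
  have "0 \<le> (\<integral>x. (h x)\<^sup>2 \<partial>\<pi>)" by simp
  with False have pos: "0 < (\<integral>x. (h x)\<^sup>2 \<partial>\<pi>)" by linarith
  then have s: "0 < s" "s\<^sup>2 = (\<integral>x. (h x)\<^sup>2 \<partial>\<pi>)" by (auto simp: s_def)
  have u: "(\<lambda>x. h x / s) \<in> unit_centered \<pi>"
    using unit_centered_normalize[OF h pos] by (simp add: s_def)
  have "Lp_norm \<pi> 2 (kernel_op P (\<lambda>x. h x / s)) \<le> abs_lambda \<pi> P"
    unfolding abs_lambda_def using u by (rule SUP_upper)
  also have "\<dots> = ennreal (enn2real (abs_lambda \<pi> P))"
    using gap by (intro ennreal_enn2real[symmetric]) (auto intro: less_trans)
  also have "Lp_norm \<pi> 2 (kernel_op P (\<lambda>x. h x / s)) = ennreal (sqrt (\<integral>x. (kernel_op P (\<lambda>x. h x / s) x)\<^sup>2 \<partial>\<pi>))"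
    using h by (intro Lp_norm_2 integrable_bmeas bmeas_power kernel_op_bmeas bmeas_divide)
  also have "(\<integral>x. (kernel_op P (\<lambda>x. h x / s) x)\<^sup>2 \<partial>\<pi>) = (\<integral>x. (kernel_op P h x)\<^sup>2 \<partial>\<pi>) / s\<^sup>2"
    by (simp add: kernel_op_divide power_divide)
  finally have "sqrt ((\<integral>x. (kernel_op P h x)\<^sup>2 \<partial>\<pi>) / s\<^sup>2) \<le> enn2real (abs_lambda \<pi> P)"
    by (subst (asm) ennreal_le_iff) auto
  then have "(\<integral>x. (kernel_op P h x)\<^sup>2 \<partial>\<pi>) / s\<^sup>2 \<le> (enn2real (abs_lambda \<pi> P))\<^sup>2"
    by (rule sqrt_le_D)
  then show ?thesis
    using s pos by (simp add: pos_divide_le_eq)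
qed

text \<open>Write u = h + c with c the mean. The cross terms vanish because h and P h have mean
  zero, so the form is at most l \<parallel>h\<parallel>^2 + c^2, and \<parallel>h\<parallel>^2 =
  \<parallel>u\<parallel>^2 - c^2.\<close>

lemma right_gap:
  assumes u: "u \<in> bmeas S" and gap: "right_lambda \<pi> P < 1"
  defines "l \<equiv> real_of_ereal (max (right_lambda \<pi> P) 0)"
  shows "(\<integral>x. kernel_op P u x * u x \<partial>\<pi>) \<le> l * (\<integral>x. (u x)\<^sup>2 \<partial>\<pi>) + (1 - l) * (\<integral>x. u x \<partial>\<pi>)\<^sup>2"
proof -
  define c where "c = (\<integral>x. u x \<partial>\<pi>)"
  define h where "h x = u x - c" for x
  have h: "h \<in> bmeas S" "(\<integral>x. h x \<partial>\<pi>) = 0"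
    using u unfolding h_def[abs_def] by (auto simp: c_def prob_space)
  define v where "v = (\<integral>x. (h x)\<^sup>2 \<partial>\<pi>)"
  have v0: "0 \<le> v" by (simp add: v_def)
  have "v = (\<integral>x. (u x)\<^sup>2 - 2 * c * u x + c\<^sup>2 \<partial>\<pi>)"
    unfolding v_def h_def by (intro Bochner_Integration.integral_cong) (auto simp: power2_eq_square algebra_simps)
  also have "\<dots> = (\<integral>x. (u x)\<^sup>2 \<partial>\<pi>) - c\<^sup>2"
    using u by (simp add: bmeas_power prob_space c_def[symmetric]) (simp add: power2_eq_square)
  finally have v: "v = (\<integral>x. (u x)\<^sup>2 \<partial>\<pi>) - c\<^sup>2" .
  have "(\<integral>x. kernel_op P u x * u x \<partial>\<pi>) = (\<integral>x. kernel_op P h x * h x + c * kernel_op P h x + c * h x + c\<^sup>2 \<partial>\<pi>)"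
  proof (intro Bochner_Integration.integral_cong refl)
    fix x assume "x \<in> space \<pi>"
    then have Pu: "kernel_op P u x = kernel_op P h x + c"
      using kernel_op_diff[OF u bmeas_const, of x c] unfolding h_def[abs_def] by simp
    then show "kernel_op P u x * u x = kernel_op P h x * h x + c * kernel_op P h x + c * h x + c\<^sup>2"
      unfolding Pu by (simp add: h_def power2_eq_square algebra_simps)
  qed
  also have "\<dots> = (\<integral>x. kernel_op P h x * h x \<partial>\<pi>) + c\<^sup>2"
    using h by (simp add: bmeas_mult kernel_op_bmeas integral_kernel_op prob_space)
  finally have Q: "(\<integral>x. kernel_op P u x * u x \<partial>\<pi>) = (\<integral>x. kernel_op P h x * h x \<partial>\<pi>) + c\<^sup>2" .
  have "(\<integral>x. kernel_op P h x * h x \<partial>\<pi>) \<le> l * v"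
  proof (cases "v = 0")
    case True
    then have "AE x in \<pi>. (h x)\<^sup>2 = 0"
      using h unfolding v_def by (subst (asm) integral_nonneg_eq_0_iff_AE) (auto simp: bmeas_power)
    then have "AE x in \<pi>. kernel_op P h x * h x = 0"
      by eventually_elim simp
    then have "(\<integral>x. kernel_op P h x * h x \<partial>\<pi>) = 0"
      by (rule integral_eq_zero_AE)
    then show ?thesis using True by simp
  next
    case False
    then have pos: "0 < (\<integral>x. (h x)\<^sup>2 \<partial>\<pi>)" using v0 unfolding v_def by linarith
    define s where "s = sqrt v"
    have s: "0 < s" "s\<^sup>2 = v" using pos by (auto simp: s_def v_def)
    have "(\<lambda>x. h x / s) \<in> unit_centered \<pi>"
      using unit_centered_normalize[OF h pos] by (simp add: s_def v_def)
    then have "ereal (L2_inner \<pi> (reversibilization \<pi> P (\<lambda>x. h x / s)) (\<lambda>x. h x / s)) \<le> right_lambda \<pi> P"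
      unfolding right_lambda_def by (rule SUP_upper)
    also have "\<dots> \<le> max (right_lambda \<pi> P) 0" by simp
    \<comment> \<open>The maximum lies in [0, 1), hence is finite whatever the supremum, so
      \<open>real_of_ereal\<close> loses nothing.\<close>
    also have "\<dots> = ereal l"
      using gap unfolding l_def by (cases "right_lambda \<pi> P") (auto simp: max_def)
    also have "L2_inner \<pi> (reversibilization \<pi> P (\<lambda>x. h x / s)) (\<lambda>x. h x / s)
      = (\<integral>x. (kernel_op P h x * h x) / s\<^sup>2 \<partial>\<pi>)"
      using h by (subst L2_inner_reversibilization)
        (auto simp: L2_inner_def kernel_op_divide power2_eq_square)
    finally have "(\<integral>x. kernel_op P h x * h x \<partial>\<pi>) / v \<le> l"
      by (simp add: s)
    then show ?thesis
      using pos by (simp add: v_def pos_divide_le_eq)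
  qed
  then show ?thesis
    unfolding Q v by (simp add: c_def algebra_simps)
qed

end

subsection \<open>The stationary chain\<close>

text \<open>\<open>chain_fn P G n x\<close> is the expectation of \<open>G (X 1) * \<dots> * G (X n)\<close> for the chain started at \<open>x\<close>.\<close>

definition chain_fn :: "('a \<Rightarrow> 'a measure) \<Rightarrow> ('a \<Rightarrow> real) \<Rightarrow> nat \<Rightarrow> 'a \<Rightarrow> real" where
  "chain_fn P G n = ((\<lambda>f x. G x * kernel_op P f x) ^^ n) (\<lambda>x. 1)"

lemma chain_fn_0[simp]: "chain_fn P G 0 = (\<lambda>x. 1)"
  and chain_fn_Suc: "chain_fn P G (Suc n) = (\<lambda>x. G x * kernel_op P (chain_fn P G n) x)"
  by (simp_all add: chain_fn_def)

context invariant_kernel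
begin

lemma chain_fn_bmeas[intro]: "G \<in> bmeas S \<Longrightarrow> chain_fn P G n \<in> bmeas S"
  by (induction n) (auto simp: chain_fn_Suc)

lemma chain_fn_nonneg: "(\<And>x. x \<in> space S \<Longrightarrow> 0 \<le> G x) \<Longrightarrow> x \<in> space S \<Longrightarrow> 0 \<le> chain_fn P G n x"
  by (induction n arbitrary: x) (auto simp: chain_fn_Suc kernel_op_nonneg)

text \<open>
  For \<open>A\<close> a nonnegative operator with \<open>\<langle>A u, u\<rangle> \<le> w \<parallel>u\<parallel>\<^sup>2\<close> for nonnegative \<open>u\<close>, the power
  inequality \<open>\<langle>A\<^sup>m v, v\<rangle> \<le> w\<^sup>m \<parallel>v\<parallel>\<^sup>2\<close>, although \<open>A\<close> need not be symmetric: put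
  \<open>x\<^sub>j = A\<^sup>j v / w\<^sup>j\<close> for \<open>j < m\<close>, arranged in a cycle.  Positivity and the Cauchy-Schwarz inequality
  bound \<open>\<Sum>\<^sub>j \<langle>A x\<^sub>j, x\<^sub>j\<^sub>+\<^sub>1\<rangle>\<close> by \<open>\<langle>A s, s\<rangle>\<close> with \<open>s\<^sup>2 = \<Sum>\<^sub>j x\<^sub>j\<^sup>2\<close>, and all terms but one telescope.
\<close>

lemma kernel_form_power_le:
  fixes e v :: "'a \<Rightarrow> real" and w :: real
  defines "A \<equiv> \<lambda>f x. e x * kernel_op P (\<lambda>y. e y * f y) x"
  assumes e: "e \<in> bmeas S" "\<And>x. x \<in> space S \<Longrightarrow> 0 \<le> e x"
    and v: "v \<in> bmeas S" "\<And>x. x \<in> space S \<Longrightarrow> 0 \<le> v x" and w: "0 < w"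
    and form: "\<And>u. u \<in> bmeas S \<Longrightarrow> (\<integral>x. A u x * u x \<partial>\<pi>) \<le> w * (\<integral>x. (u x)\<^sup>2 \<partial>\<pi>)"
  shows "(\<integral>x. (A ^^ m) v x * v x \<partial>\<pi>) \<le> w ^ m * (\<integral>x. (v x)\<^sup>2 \<partial>\<pi>)"
proof (cases m)
  case (Suc k)
  define X where "X j x = (A ^^ j) v x / w ^ j" for j x
  \<comment> \<open>The successor of X j in the cycle: the last index wraps around to X 0 instead of
    going on to X (Suc k).\<close>
  define Y where "Y j x = (if j = k then X 0 x else X (Suc j) x)" for j x
  define s where "s x = sqrt (\<Sum>j<Suc k. (X j x)\<^sup>2)" for x
  have Abm: "A f \<in> bmeas S" if "f \<in> bmeas S" for f
    unfolding A_def using e that by auto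
  have powbm: "(A ^^ j) v \<in> bmeas S" for j
    by (induction j) (auto intro: v Abm)
  have Xbm[intro]: "X j \<in> bmeas S" for j
    using powbm unfolding X_def[abs_def] by auto
  have Ybm[intro]: "Y j \<in> bmeas S" for j
    by (cases "j = k") (auto simp: Y_def[abs_def])
  have sbm[intro]: "s \<in> bmeas S"
    unfolding s_def[abs_def] by (intro bmeas_sqrt bmeas_sum bmeas_power Xbm)
  have X0: "X 0 = v"
    by (simp add: X_def[abs_def])
  have AX: "A (X j) x = w * X (Suc j) x" for j x
    using w by (simp add: A_def X_def kernel_op_divide)
  have s2: "(s x)\<^sup>2 = (\<Sum>j<Suc k. (X j x)\<^sup>2)" for x
    unfolding s_def by (intro real_sqrt_pow2 sum_nonneg) auto
  have sumY: "(\<Sum>j<Suc k. f (Y j x)) = (\<Sum>j<Suc k. f (X j x))" for f :: "real \<Rightarrow> real" and x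
  proof -
    have "(\<Sum>j<Suc k. f (Y j x)) = (\<Sum>j<k. f (X (Suc j) x)) + f (X 0 x)"
      by (simp add: Y_def)
    then show ?thesis by (simp only: sum.lessThan_Suc_shift add.commute)
  qed
  have CS: "(\<Sum>j<Suc k. X j y * Y j x) \<le> s y * s x" for x y
  proof -
    have "(\<Sum>j<Suc k. X j y * Y j x)\<^sup>2 \<le> (\<Sum>j<Suc k. (X j y)\<^sup>2) * (\<Sum>j<Suc k. (Y j x)\<^sup>2)"
      by (rule Cauchy_Schwarz_ineq_sum)
    also have "\<dots> = (s y * s x)\<^sup>2"
      unfolding power_mult_distrib s2 sumY[of "\<lambda>a. a\<^sup>2"] ..
    finally show ?thesis
      by (rule power2_le_imp_le) (unfold s_def, intro mult_nonneg_nonneg real_sqrt_ge_zero sum_nonneg zero_le_power2)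
  qed
  \<comment> \<open>Cauchy-Schwarz is applied to the vectors (X j y) and (Y j x) at two different
    points, under the kernel from x to y. Positivity of \<open>e\<close> and of the kernel preserves
    the inequality.\<close>
  have pointwise: "(\<Sum>j<Suc k. A (X j) x * Y j x) \<le> A s x * s x" if x: "x \<in> space S" for x
  proof -
    have "(\<Sum>j<Suc k. A (X j) x * Y j x) = e x * (\<Sum>j<Suc k. kernel_op P (\<lambda>y. Y j x * (e y * X j y)) x)"
      unfolding A_def kernel_op_mult by (simp add: sum_distrib_left algebra_simps)
    also have "\<dots> = e x * kernel_op P (\<lambda>y. \<Sum>j<Suc k. Y j x * (e y * X j y)) x"
      using x by (subst kernel_op_sum) (simp_all add: bmeas_mult e Xbm)
    also have "\<dots> = e x * kernel_op P (\<lambda>y. e y * (\<Sum>j<Suc k. X j y * Y j x)) x"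
      by (intro arg_cong2[where f = "(*)"] kernel_op_cong refl x)
        (simp only: sum_distrib_left mult_ac)
    also have "\<dots> \<le> e x * kernel_op P (\<lambda>y. s x * (e y * s y)) x"
    proof (intro mult_left_mono kernel_op_mono x)
      fix y assume "y \<in> space S"
      then have "e y * (\<Sum>j<Suc k. X j y * Y j x) \<le> e y * (s y * s x)"
        using e by (intro mult_left_mono CS) auto
      then show "e y * (\<Sum>j<Suc k. X j y * Y j x) \<le> s x * (e y * s y)"
        by (simp add: mult_ac)
    next
      show "(\<lambda>y. e y * (\<Sum>j<Suc k. X j y * Y j x)) \<in> bmeas S"
        by (intro bmeas_mult e bmeas_sum bmeas_const Xbm)
    qed (simp_all add: bmeas_mult e sbm x)
    also have "\<dots> = A s x * s x"
      by (simp add: A_def kernel_op_mult)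
    finally show ?thesis .
  qed
  have "(\<integral>x. (\<Sum>j<Suc k. A (X j) x * Y j x) \<partial>\<pi>) \<le> (\<integral>x. A s x * s x \<partial>\<pi>)"
    using pointwise by (intro integral_mono integrable_bmeas bmeas_sum bmeas_mult Abm Xbm Ybm sbm) auto
  also have "\<dots> \<le> w * (\<integral>x. (s x)\<^sup>2 \<partial>\<pi>)"
    by (intro form) auto
  also have "\<dots> = w * (\<Sum>j<Suc k. \<integral>x. (X j x)\<^sup>2 \<partial>\<pi>)"
    unfolding s2 by (subst Bochner_Integration.integral_sum) (auto intro!: integrable_bmeas)
  also have "\<dots> = w * (\<Sum>j<k. \<integral>x. (X (Suc j) x)\<^sup>2 \<partial>\<pi>) + w * (\<integral>x. (v x)\<^sup>2 \<partial>\<pi>)"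
    by (simp only: sum.lessThan_Suc_shift X0 distrib_left add.commute)
  \<comment> \<open>For j < k the term is w times the square of X (Suc j), which also occurs on the
    right. What survives is the wrap-around term on the left and v^2 on the right.\<close>
  also have "(\<integral>x. (\<Sum>j<Suc k. A (X j) x * Y j x) \<partial>\<pi>)
      = (\<integral>x. (\<Sum>j<k. w * (X (Suc j) x)\<^sup>2) + w * (X (Suc k) x * v x) \<partial>\<pi>)"
    by (intro Bochner_Integration.integral_cong)
      (auto simp: AX Y_def X0 power2_eq_square mult.assoc)
  also have "\<dots> = w * (\<Sum>j<k. \<integral>x. (X (Suc j) x)\<^sup>2 \<partial>\<pi>) + w * (\<integral>x. X (Suc k) x * v x \<partial>\<pi>)"
    by (subst Bochner_Integration.integral_add)
      (simp_all add: Bochner_Integration.integral_sum sum_distrib_left bmeas_sum bmeas_mult bmeas_power Xbm v)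
  finally have "(\<integral>x. X (Suc k) x * v x \<partial>\<pi>) \<le> (\<integral>x. (v x)\<^sup>2 \<partial>\<pi>)"
    using w by simp
  also have "(\<integral>x. X (Suc k) x * v x \<partial>\<pi>) = (\<integral>x. (A ^^ m) v x * v x \<partial>\<pi>) / w ^ m"
    by (simp add: X_def Suc)
  finally show ?thesis
    using w by (simp add: pos_divide_le_eq mult.commute)
qed (simp add: power2_eq_square)

lemma hoeffding_stationary:
  assumes f: "f \<in> bmeas S" "\<And>x. x \<in> space S \<Longrightarrow> f x \<in> {a..b}"
    and gap: "right_lambda \<pi> P < 1" and l: "l = real_of_ereal (max (right_lambda \<pi> P) 0)"
  shows "(\<integral>x. chain_fn P (\<lambda>x. exp (t * (f x - (\<integral>x. f x \<partial>\<pi>)))) n x \<partial>\<pi>)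
    \<le> exp (t\<^sup>2 / 2 * (alpha l * (real n * (b - a)\<^sup>2 / 4)))"
proof (cases n)
  case (Suc m)
  define Y where "Y x = t * (f x - (\<integral>x. f x \<partial>\<pi>))" for x
  \<comment> \<open>Minimum and maximum serve both signs of t; the width of the interval is
    \<open>\<bar>t * (b - a)\<bar>\<close> in either case.\<close>
  define ya yb where "ya = min (t * (a - (\<integral>x. f x \<partial>\<pi>))) (t * (b - (\<integral>x. f x \<partial>\<pi>)))"
    and "yb = max (t * (a - (\<integral>x. f x \<partial>\<pi>))) (t * (b - (\<integral>x. f x \<partial>\<pi>)))"
  define w where "w = exp (alpha l * (yb - ya)\<^sup>2 / 8)"
  define e where "e x = exp (Y x / 2)" for x
  have l01: "0 \<le> l" "l < 1"
    using gap unfolding l by (cases "right_lambda \<pi> P"; auto simp: max_def)+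
  have "yb - ya = \<bar>t * (b - a)\<bar>"
    by (auto simp: ya_def yb_def min_def max_def algebra_simps)
  then have d2: "(yb - ya)\<^sup>2 = t\<^sup>2 * (b - a)\<^sup>2"
    by (simp add: power_mult_distrib)
  have Yb: "ya \<le> Y x \<and> Y x \<le> yb" if "x \<in> space \<pi>" for x
    using f(2)[of x] that unfolding Y_def ya_def yb_def
    by (cases "0 \<le> t") (auto simp: min_le_iff_disj le_max_iff_disj mult_left_mono mult_left_mono_neg)
  have Ybm: "Y \<in> bmeas S"
    using f unfolding Y_def[abs_def] by (intro bmeas_mult bmeas_diff bmeas_const)
  then have ebm: "e \<in> bmeas S"
    unfolding e_def[abs_def] by auto
  have ee: "e x * e x = exp (Y x)" for x
    by (simp add: e_def flip: exp_add)
  have EY: "(\<integral>x. Y x \<partial>\<pi>) = 0"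
    using f by (simp add: Y_def)
  note LP = leon_perron_form_le[OF _ _ _ Yb EY, unfolded borel_measurable_pi space_pi]
  have form: "(\<integral>x. e x * kernel_op P (\<lambda>y. e y * u y) x * u x \<partial>\<pi>) \<le> w * (\<integral>x. (u x)\<^sup>2 \<partial>\<pi>)"
    if u: "u \<in> bmeas S" for u
  proof -
    obtain B where B: "\<And>x. x \<in> space S \<Longrightarrow> \<bar>u x\<bar> \<le> B" using u by (metis bmeasE)
    have "(\<integral>x. e x * kernel_op P (\<lambda>y. e y * u y) x * u x \<partial>\<pi>)
        = (\<integral>x. kernel_op P (\<lambda>y. e y * u y) x * (e x * u x) \<partial>\<pi>)"
      by (simp add: mult_ac)
    also have "\<dots> \<le> l * (\<integral>x. (e x * u x)\<^sup>2 \<partial>\<pi>) + (1 - l) * (\<integral>x. e x * u x \<partial>\<pi>)\<^sup>2"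
      unfolding l using ebm u gap by (intro right_gap) auto
    also have "\<dots> = l * (\<integral>x. exp (Y x) * (u x)\<^sup>2 \<partial>\<pi>) + (1 - l) * (\<integral>x. exp (Y x / 2) * u x \<partial>\<pi>)\<^sup>2"
      by (simp add: power_mult_distrib power2_eq_square[of "e _"] ee) (simp add: e_def)
    also have "\<dots> \<le> w * (\<integral>x. (u x)\<^sup>2 \<partial>\<pi>)"
      unfolding w_def by (rule LP[OF l01]) (use Ybm u B in \<open>auto dest: bmeasD\<close>)
    finally show ?thesis .
  qed
  \<comment> \<open>Each factor exp Y is split as e * e between the two neighbouring kernel steps,
    so the n factors make n - 1 copies of \<open>A\<close> with one \<open>e\<close> left at either
    end.\<close>
  define A where "A f x = e x * kernel_op P (\<lambda>y. e y * f y) x" for f x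
  have chain: "chain_fn P (\<lambda>x. exp (Y x)) (Suc k) x = (A ^^ k) e x * e x" if "x \<in> space S" for k x
    using that
  proof (induction k arbitrary: x)
    case 0
    then show ?case by (simp add: chain_fn_Suc ee)
  next
    case (Suc k)
    have "chain_fn P (\<lambda>x. exp (Y x)) (Suc (Suc k)) x
        = exp (Y x) * kernel_op P (\<lambda>y. (A ^^ k) e y * e y) x"
      by (subst chain_fn_Suc) (intro arg_cong2[where f = "(*)"] kernel_op_cong refl Suc)
    moreover have "(A ^^ Suc k) e x = e x * kernel_op P (\<lambda>y. e y * (A ^^ k) e y) x"
      by (simp only: funpow.simps o_apply A_def[of "(A ^^ k) e" x])
    ultimately show ?case
      by (simp add: ee[symmetric] mult_ac)
  qed
  \<comment> \<open>The remaining factor is the square norm of e. The form bound with l = 0 and h =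
    e reads I^2 \<le> w0 I, which is Hoeffding's lemma; w0 \<le> w because \<open>alpha\<close> is
    increasing on [0, 1).\<close>
  have E: "(\<integral>x. exp (Y x) \<partial>\<pi>) \<le> w"
  proof -
    define I where "I = (\<integral>x. exp (Y x) \<partial>\<pi>)"
    obtain B where B: "\<And>x. x \<in> space S \<Longrightarrow> \<bar>e x\<bar> \<le> B" using ebm by (metis bmeasE)
    have "I\<^sup>2 \<le> exp (alpha 0 * (yb - ya)\<^sup>2 / 8) * (\<integral>x. (e x)\<^sup>2 \<partial>\<pi>)"
      using LP[of 0 e B] Ybm ebm B by (auto dest: bmeasD simp: I_def ee[unfolded e_def] e_def)
    also have "(\<integral>x. (e x)\<^sup>2 \<partial>\<pi>) = I"
      by (simp add: I_def power2_eq_square ee)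
    finally have "I * I \<le> exp (alpha 0 * (yb - ya)\<^sup>2 / 8) * I"
      by (simp add: power2_eq_square)
    moreover have "0 < I"
      using integral_less_AE_space[of "\<lambda>x. 0" "\<lambda>x. exp (Y x)"] Ybm unfolding I_def
      by (auto simp: emeasure_space_1[unfolded space_pi])
    ultimately have "I \<le> exp (alpha 0 * (yb - ya)\<^sup>2 / 8)"
      by simp
    also have "alpha 0 \<le> alpha l"
      using l01 by (simp add: alpha_def)
    then have "exp (alpha 0 * (yb - ya)\<^sup>2 / 8) \<le> w"
      unfolding w_def by (simp add: mult_right_mono)
    finally show ?thesis unfolding I_def .
  qed
  have "(\<integral>x. chain_fn P (\<lambda>x. exp (Y x)) n x \<partial>\<pi>) = (\<integral>x. (A ^^ m) e x * e x \<partial>\<pi>)"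
    unfolding Suc by (intro Bochner_Integration.integral_cong) (auto simp: chain)
  also have "\<dots> \<le> w ^ m * (\<integral>x. (e x)\<^sup>2 \<partial>\<pi>)"
    unfolding A_def[abs_def] using form by (intro kernel_form_power_le ebm) (auto simp: e_def w_def)
  also have "\<dots> \<le> w ^ m * w"
    using E by (intro mult_left_mono) (auto simp: power2_eq_square ee w_def)
  also have "\<dots> = w ^ n"
    by (simp add: Suc)
  also have "\<dots> = exp (t\<^sup>2 / 2 * (alpha l * (real n * (b - a)\<^sup>2 / 4)))"
    unfolding w_def d2 by (simp add: exp_of_nat_mult[symmetric] algebra_simps)
  finally show ?thesis
    by (simp add: Y_def)
qed simp

section \<open>Jensen's inequality along the chain\<close>

lemma kernel_op_pos:
  assumes "f \<in> bmeas S" "\<And>y. y \<in> space S \<Longrightarrow> 0 < f y" "x \<in> space S"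
  shows "0 < kernel_op P f x"
proof -
  interpret Px: prob_space "P x" using assms by (intro prob_space_kernel)
  have "(\<integral>y. 0 \<partial>P x) < (\<integral>y. f y \<partial>P x)"
    using assms Px.emeasure_space_1
    by (intro Px.integral_less_AE_space integrable_kernel_bmeas AE_I2) (auto simp: space_kernel_eq)
  then show ?thesis by (simp add: kernel_op_def)
qed

lemma chain_fn_pos:
  "G \<in> bmeas S \<Longrightarrow> (\<And>x. x \<in> space S \<Longrightarrow> 0 < G x) \<Longrightarrow> x \<in> space S \<Longrightarrow> 0 < chain_fn P G n x"
  by (induction n arbitrary: x) (auto simp: chain_fn_Suc kernel_op_pos chain_fn_bmeas)

lemma bmeas_powr:
  assumes "f \<in> bmeas S" "\<And>x. x \<in> space S \<Longrightarrow> 0 \<le> f x" "0 \<le> q"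
  shows "(\<lambda>x. f x powr q) \<in> bmeas S"
proof -
  obtain B where B: "\<And>x. x \<in> space S \<Longrightarrow> \<bar>f x\<bar> \<le> B" using assms by (metis bmeasE)
  show ?thesis
  proof (rule bmeasI)
    show "(\<lambda>x. f x powr q) \<in> borel_measurable S"
      using bmeasD[OF assms(1)] by measurable
    show "\<bar>f x powr q\<bar> \<le> B powr q" if "x \<in> space S" for x
      using B[OF that] assms(2)[OF that] assms(3) by (auto intro: powr_mono2)
  qed
qed

lemma kernel_op_powr_le:
  assumes f: "f \<in> bmeas S" "\<And>y. y \<in> space S \<Longrightarrow> 0 < f y" and q: "1 \<le> q" and x: "x \<in> space S"
  shows "kernel_op P f x powr q \<le> kernel_op P (\<lambda>y. f y powr q) x"
proof -
  interpret Px: prob_space "P x" using x by (rule prob_space_kernel)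
  have "(\<lambda>y. f y powr q) \<in> bmeas S"
    using f q by (intro bmeas_powr) (auto intro: less_imp_le)
  then show ?thesis
    unfolding kernel_op_def using f q x
    by (intro Px.jensens_inequality[where I = "{0<..}"] powr_convex integrable_kernel_bmeas AE_I2)
      (auto simp: space_kernel_eq)
qed

text \<open>Jensen's inequality at each kernel step. For G = exp (t F) the power G^q is exp (q t F),
  so the right-hand side is again a moment generating function, at q t.\<close>

lemma chain_fn_powr_le:
  assumes G: "G \<in> bmeas S" "\<And>x. x \<in> space S \<Longrightarrow> 0 < G x" and q: "1 \<le> q" and x: "x \<in> space S"
  shows "chain_fn P G n x powr q \<le> chain_fn P (\<lambda>x. G x powr q) n x"
  using x
proof (induction n arbitrary: x)
  case (Suc n)
  have Gq: "(\<lambda>x. G x powr q) \<in> bmeas S"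
    using G q by (intro bmeas_powr) (auto intro: less_imp_le)
  note cb = chain_fn_bmeas[OF G(1), of n] and cp = chain_fn_pos[OF G, of _ n]
  have "kernel_op P (chain_fn P G n) x powr q \<le> kernel_op P (\<lambda>y. chain_fn P G n y powr q) x"
    using cb cp q Suc.prems by (intro kernel_op_powr_le) auto
  also have "\<dots> \<le> kernel_op P (chain_fn P (\<lambda>x. G x powr q) n) x"
    using cp q Suc by (intro kernel_op_mono bmeas_powr[OF cb] chain_fn_bmeas[OF Gq]) (auto intro: less_imp_le)
  finally have "G x powr q * kernel_op P (chain_fn P G n) x powr q
      \<le> G x powr q * kernel_op P (chain_fn P (\<lambda>x. G x powr q) n) x"
    by (intro mult_left_mono) auto
  moreover have "0 < kernel_op P (chain_fn P G n) x"
    using cb cp Suc.prems by (intro kernel_op_pos) auto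
  ultimately show ?case
    using G(2)[OF Suc.prems] by (simp add: chain_fn_Suc powr_mult)
qed simp

end

subsection \<open>Interpolation\<close>

lemma integral_Holder:
  fixes f g :: "'a \<Rightarrow> real" and p q :: real
  assumes p: "1 < p" "1 < q" "1 / p + 1 / q = 1"
    and [measurable]: "f \<in> borel_measurable M" "g \<in> borel_measurable M"
    and pos: "\<And>x. x \<in> space M \<Longrightarrow> 0 \<le> f x" "\<And>x. x \<in> space M \<Longrightarrow> 0 \<le> g x"
    and int: "integrable M (\<lambda>x. f x powr p)" "integrable M (\<lambda>x. g x powr q)"
  shows "integrable M (\<lambda>x. f x * g x)"
    and "(\<integral>x. f x * g x \<partial>M) \<le> (\<integral>x. f x powr p \<partial>M) powr (1 / p) * (\<integral>x. g x powr q \<partial>M) powr (1 / q)"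
proof -
  have young: "a * b \<le> a powr p / p + b powr q / q" if "0 \<le> a" "0 \<le> b" for a b
    using p that by (intro Youngs_inequality)
  show fg: "integrable M (\<lambda>x. f x * g x)"
  proof (rule Bochner_Integration.integrable_bound)
    show "integrable M (\<lambda>x. f x powr p / p + g x powr q / q)"
      using int by auto
    show "AE x in M. norm (f x * g x) \<le> norm (f x powr p / p + g x powr q / q)"
      using pos young by (intro AE_I2) (auto intro: order_trans[OF _ abs_ge_self])
  qed measurable
  define A B where "A = (\<integral>x. f x powr p \<partial>M)" and "B = (\<integral>x. g x powr q \<partial>M)"
  have "0 \<le> A" "0 \<le> B" by (auto simp: A_def B_def)
  consider "A = 0" | "B = 0" | "0 < A" "0 < B"
    using \<open>0 \<le> A\<close> \<open>0 \<le> B\<close> by linarith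
  then show "(\<integral>x. f x * g x \<partial>M) \<le> A powr (1 / p) * B powr (1 / q)"
  proof cases
    case 1
    then have "AE x in M. f x powr p = 0"
      using int unfolding A_def by (subst (asm) integral_nonneg_eq_0_iff_AE) auto
    then have "AE x in M. f x * g x = 0" by eventually_elim auto
    then show ?thesis using 1 by (simp add: integral_eq_zero_AE)
  next
    case 2
    then have "AE x in M. g x powr q = 0"
      using int unfolding B_def by (subst (asm) integral_nonneg_eq_0_iff_AE) auto
    then have "AE x in M. f x * g x = 0" by eventually_elim auto
    then show ?thesis using 2 by (simp add: integral_eq_zero_AE)
  next
    case 3
    define a b where "a = A powr (1 / p)" and "b = B powr (1 / q)"
    have ab: "0 < a" "0 < b" "a powr p = A" "b powr q = B"
      using 3 p by (auto simp: a_def b_def powr_powr)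
    have "(\<integral>x. f x * g x \<partial>M) \<le> (\<integral>x. a * b * (f x powr p / (p * A) + g x powr q / (q * B)) \<partial>M)"
    proof (intro integral_mono)
      fix x assume x: "x \<in> space M"
      have "(f x / a) * (g x / b) \<le> (f x / a) powr p / p + (g x / b) powr q / q"
        using pos[OF x] ab by (intro young) auto
      also have "\<dots> = f x powr p / (p * A) + g x powr q / (q * B)"
        using pos[OF x] ab by (simp add: powr_divide mult.commute)
      finally have "a * b * ((f x / a) * (g x / b)) \<le> a * b * (f x powr p / (p * A) + g x powr q / (q * B))"
        using ab by (intro mult_left_mono) auto
      then show "f x * g x \<le> a * b * (f x powr p / (p * A) + g x powr q / (q * B))"
        using ab by simp
    qed (use int fg in auto)
    also have "\<dots> = a * b * (A / (p * A) + B / (q * B))"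
      using int by (simp add: A_def B_def)
    also have "\<dots> = a * b"
      using 3 p by simp
    finally show ?thesis by (simp add: a_def b_def)
  qed
qed

text \<open>The constant is the Beta value B(r - 2, 3). The condition 2 < r makes s^(r-3) integrable
  at 0, and this is what limits the interpolation to exponents above 2.\<close>

lemma nn_integral_powr_layer:
  fixes r y :: real
  assumes r: "2 < r" and y: "0 \<le> y"
  shows "(\<integral>\<^sup>+s. ennreal (indicator {0<..} s * s powr (r - 3) * (max (y - s) 0)\<^sup>2) \<partial>lborel)
    = ennreal (2 / (r * (r - 1) * (r - 2)) * y powr r)"
proof -
  define f where "f s = (if s \<in> {0..y} then y\<^sup>2 * s powr (r - 3) - 2 * y * s powr (r - 2) + s powr (r - 1) else 0)" for s
  have [measurable]: "f \<in> borel_measurable borel"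
    unfolding f_def[abs_def] by measurable
  have f_eq: "f s = indicator {0<..} s * s powr (r - 3) * (max (y - s) 0)\<^sup>2" for s
  proof -
    have "s powr (r - 2) = s powr (r - 3) * s" "s powr (r - 1) = s powr (r - 3) * s\<^sup>2" if "0 < s"
      using that powr_add[of s "r - 3" 1] powr_add[of s "r - 3" 2] by (simp_all add: powr_numeral)
    then show ?thesis
      using y by (cases "0 < s") (auto simp: f_def max_def power2_eq_square algebra_simps)
  qed
  have pw: "((\<lambda>s. s powr a) has_integral y powr (a + 1) / (a + 1)) {0..y}" if "-1 < a" for a
    using has_integral_powr_from_0[OF that y] .
  have "((\<lambda>s. y\<^sup>2 * s powr (r - 3) - 2 * y * s powr (r - 2) + s powr (r - 1)) has_integral
      y\<^sup>2 * (y powr (r - 3 + 1) / (r - 3 + 1)) - 2 * y * (y powr (r - 2 + 1) / (r - 2 + 1))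
        + y powr (r - 1 + 1) / (r - 1 + 1)) {0..y}"
    using r by (intro has_integral_add has_integral_diff has_integral_mult_right pw) auto
  also have "y\<^sup>2 * (y powr (r - 3 + 1) / (r - 3 + 1)) - 2 * y * (y powr (r - 2 + 1) / (r - 2 + 1))
        + y powr (r - 1 + 1) / (r - 1 + 1) = 2 / (r * (r - 1) * (r - 2)) * y powr r"
  proof (cases "y = 0")
    case False
    then have "y\<^sup>2 * y powr (r - 2) = y powr r" "y * y powr (r - 1) = y powr r"
      using y powr_add[of y 2 "r - 2"] powr_add[of y 1 "r - 1"] by (simp_all add: powr_numeral)
    then have *: "y\<^sup>2 * (y powr (r - 2) / (r - 2)) = y powr r / (r - 2)"
      "2 * y * (y powr (r - 1) / (r - 1)) = 2 * (y powr r / (r - 1))" by simp_all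
    have "y powr r / (r - 2) - 2 * (y powr r / (r - 1)) + y powr r / r
        = (1 / (r - 2) - 2 / (r - 1) + 1 / r) * y powr r"
      by (simp add: algebra_simps)
    also have "1 / (r - 2) - 2 / (r - 1) + 1 / r = 2 / (r * (r - 1) * (r - 2))"
      using r by (simp add: divide_simps) (simp add: algebra_simps)
    finally have "y powr r / (r - 2) - 2 * (y powr r / (r - 1)) + y powr r / r
        = 2 / (r * (r - 1) * (r - 2)) * y powr r" .
    moreover have "r - 3 + 1 = r - 2" "r - 2 + 1 = r - 1" "r - 1 + 1 = r" by auto
    ultimately show ?thesis by (simp only: *)
  qed simp
  finally have "(f has_integral 2 / (r * (r - 1) * (r - 2)) * y powr r) UNIV"
    unfolding f_def[abs_def] by (subst has_integral_restrict_UNIV)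
  then have "(\<integral>\<^sup>+s. ennreal (f s) \<partial>lborel) = ennreal (2 / (r * (r - 1) * (r - 2)) * y powr r)"
    by (rule nn_integral_has_integral_lborel[rotated 2]) (auto simp: f_eq)
  then show ?thesis by (simp add: f_eq)
qed

text \<open>
  A real interpolation principle between \<open>L\<^sub>2\<close> and \<open>L\<^sub>\<infinity>\<close> without loss in the constant, based on
  \<open>y\<^sup>r = c\<^sub>r \<integral>\<^sub>0\<^sup>\<infinity> s\<^sup>r\<^sup>-\<^sup>3 ((y - s)\<^sub>+)\<^sup>2 ds\<close>.
\<close>

lemma (in sigma_finite_measure) powr_integral_le_of_truncations:
  fixes k u :: "'a \<Rightarrow> real" and r c :: real
  assumes [measurable]: "k \<in> borel_measurable M" "u \<in> borel_measurable M"
    and u: "\<And>x. x \<in> space M \<Longrightarrow> 0 \<le> u x" and r: "2 < r" and c: "0 \<le> c"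
    and le: "\<And>s. 0 < s \<Longrightarrow> (\<integral>\<^sup>+x. ennreal ((max (\<bar>k x\<bar> - s) 0)\<^sup>2) \<partial>M)
        \<le> ennreal c * (\<integral>\<^sup>+x. ennreal ((max (u x - s) 0)\<^sup>2) \<partial>M)"
  shows "(\<integral>\<^sup>+x. ennreal (\<bar>k x\<bar> powr r) \<partial>M) \<le> ennreal c * (\<integral>\<^sup>+x. ennreal (u x powr r) \<partial>M)"
proof -
  define \<kappa> where "\<kappa> = 2 / (r * (r - 1) * (r - 2))"
  have \<kappa>: "0 < \<kappa>" using r by (simp add: \<kappa>_def)
  define \<omega> where "\<omega> s = indicator {0<..} s * s powr (r - 3)" for s :: real
  have \<omega>0: "0 \<le> \<omega> s" for s by (simp add: \<omega>_def)
  have [measurable]: "\<omega> \<in> borel_measurable borel"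
    unfolding \<omega>_def[abs_def] by measurable
  interpret pair_sigma_finite M lborel ..
  have layer: "ennreal \<kappa> * (\<integral>\<^sup>+x. ennreal (v x powr r) \<partial>M)
      = (\<integral>\<^sup>+s. ennreal (\<omega> s) * (\<integral>\<^sup>+x. ennreal ((max (v x - s) 0)\<^sup>2) \<partial>M) \<partial>lborel)"
    if [measurable]: "v \<in> borel_measurable M" and v: "\<And>x. x \<in> space M \<Longrightarrow> 0 \<le> v x" for v
  proof -
    have "ennreal \<kappa> * (\<integral>\<^sup>+x. ennreal (v x powr r) \<partial>M) = (\<integral>\<^sup>+x. ennreal (\<kappa> * v x powr r) \<partial>M)"
      using \<kappa> by (subst nn_integral_cmult[symmetric]) (auto simp: ennreal_mult)
    also have "\<dots> = (\<integral>\<^sup>+x. \<integral>\<^sup>+s. ennreal (\<omega> s * (max (v x - s) 0)\<^sup>2) \<partial>lborel \<partial>M)"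
      unfolding \<kappa>_def \<omega>_def using v r by (intro nn_integral_cong) (subst nn_integral_powr_layer, auto)
    also have "\<dots> = (\<integral>\<^sup>+s. \<integral>\<^sup>+x. ennreal (\<omega> s * (max (v x - s) 0)\<^sup>2) \<partial>M \<partial>lborel)"
      by (rule Fubini'[symmetric]) measurable
    also have "\<dots> = (\<integral>\<^sup>+s. ennreal (\<omega> s) * (\<integral>\<^sup>+x. ennreal ((max (v x - s) 0)\<^sup>2) \<partial>M) \<partial>lborel)"
      using \<omega>0 by (subst nn_integral_cmult[symmetric]) (auto simp: ennreal_mult)
    finally show ?thesis .
  qed
  have "ennreal \<kappa> * (\<integral>\<^sup>+x. ennreal (\<bar>k x\<bar> powr r) \<partial>M)
      = (\<integral>\<^sup>+s. ennreal (\<omega> s) * (\<integral>\<^sup>+x. ennreal ((max (\<bar>k x\<bar> - s) 0)\<^sup>2) \<partial>M) \<partial>lborel)"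
    by (rule layer) auto
  also have "\<dots> \<le> (\<integral>\<^sup>+s. ennreal c * (ennreal (\<omega> s) * (\<integral>\<^sup>+x. ennreal ((max (u x - s) 0)\<^sup>2) \<partial>M)) \<partial>lborel)"
  proof (intro nn_integral_mono)
    fix s :: real
    show "ennreal (\<omega> s) * (\<integral>\<^sup>+x. ennreal ((max (\<bar>k x\<bar> - s) 0)\<^sup>2) \<partial>M)
      \<le> ennreal c * (ennreal (\<omega> s) * (\<integral>\<^sup>+x. ennreal ((max (u x - s) 0)\<^sup>2) \<partial>M))"
    proof (cases "0 < s")
      case True
      then show ?thesis
        using mult_left_mono[OF le[OF True], of "ennreal (\<omega> s)"] by (simp add: mult_ac)
    qed (simp add: \<omega>_def)
  qed
  also have "\<dots> = ennreal c * (ennreal \<kappa> * (\<integral>\<^sup>+x. ennreal (u x powr r) \<partial>M))"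
    using u by (subst nn_integral_cmult) (auto simp: layer)
  finally have "ennreal \<kappa> * (\<integral>\<^sup>+x. ennreal (\<bar>k x\<bar> powr r) \<partial>M)
      \<le> ennreal \<kappa> * (ennreal c * (\<integral>\<^sup>+x. ennreal (u x powr r) \<partial>M))"
    by (simp add: mult_ac)
  then show ?thesis
    using \<kappa> by (subst (asm) ennreal_mult_le_mult_iff) auto
qed

context invariant_kernel
begin

section \<open>Decay of the iterated kernel\<close>

abbreviation kernel_pow :: "nat \<Rightarrow> ('a \<Rightarrow> real) \<Rightarrow> 'a \<Rightarrow> real" where
  "kernel_pow n \<equiv> kernel_op P ^^ n"

lemma kernel_pow_bmeas[intro]: "f \<in> bmeas S \<Longrightarrow> kernel_pow n f \<in> bmeas S"
  by (induction n) auto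

lemma kernel_pow_add: "f \<in> bmeas S \<Longrightarrow> g \<in> bmeas S \<Longrightarrow> x \<in> space S \<Longrightarrow>
    kernel_pow n (\<lambda>y. f y + g y) x = kernel_pow n f x + kernel_pow n g x"
proof (induction n arbitrary: x)
  case (Suc n)
  then have "kernel_pow (Suc n) (\<lambda>y. f y + g y) x = kernel_op P (\<lambda>y. kernel_pow n f y + kernel_pow n g y) x"
    by (auto intro!: kernel_op_cong)
  then show ?case using Suc by (simp add: kernel_op_add kernel_pow_bmeas)
qed simp

lemma kernel_pow_const[simp]: "x \<in> space S \<Longrightarrow> kernel_pow n (\<lambda>y. c) x = c"
proof (induction n arbitrary: x)
  case (Suc n)
  have "kernel_pow (Suc n) (\<lambda>y. c) x = kernel_op P (kernel_pow n (\<lambda>y. c)) x"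
    by simp
  also have "\<dots> = kernel_op P (\<lambda>y. c) x"
    using Suc by (intro kernel_op_cong)
  finally show ?case using Suc by simp
qed simp

lemma kernel_pow_mono: "f \<in> bmeas S \<Longrightarrow> g \<in> bmeas S \<Longrightarrow> (\<And>y. y \<in> space S \<Longrightarrow> f y \<le> g y) \<Longrightarrow>
    x \<in> space S \<Longrightarrow> kernel_pow n f x \<le> kernel_pow n g x"
  by (induction n arbitrary: x) (auto intro!: kernel_op_mono)

lemma kernel_pow_nonneg: "(\<And>y. y \<in> space S \<Longrightarrow> 0 \<le> f y) \<Longrightarrow> x \<in> space S \<Longrightarrow> 0 \<le> kernel_pow n f x"
  by (induction n arbitrary: x) (auto intro!: kernel_op_nonneg)

lemma integral_kernel_pow: "f \<in> bmeas S \<Longrightarrow> (\<integral>x. kernel_pow n f x \<partial>\<pi>) = (\<integral>x. f x \<partial>\<pi>)"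
  by (induction n) (auto simp: integral_kernel_op kernel_pow_bmeas)

lemma ennreal_kernel_pow:
  "f \<in> bmeas S \<Longrightarrow> (\<And>y. y \<in> space S \<Longrightarrow> 0 \<le> f y) \<Longrightarrow> x \<in> space S \<Longrightarrow>
    ennreal (kernel_pow n f x) = (nn_kernel ^^ n) (\<lambda>y. ennreal (f y)) x"
proof (induction n arbitrary: x)
  case (Suc n)
  have "ennreal (kernel_pow (Suc n) f x) = (\<integral>\<^sup>+y. ennreal (kernel_pow n f y) \<partial>P x)"
    using Suc.prems ennreal_kernel_op[of "kernel_pow n f" x] by (simp add: kernel_pow_bmeas kernel_pow_nonneg)
  also have "\<dots> = (\<integral>\<^sup>+y. (nn_kernel ^^ n) (\<lambda>y. ennreal (f y)) y \<partial>P x)"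
    using Suc by (intro nn_integral_cong) (auto simp: space_kernel_eq)
  finally show ?case by simp
qed simp

text \<open>Centering commutes with the iterates since constants are fixed, and by invariance every
  iterate of a centered function is centered, so the gap applies n times. At the end the variance is
  bounded by the second moment.\<close>

lemma kernel_pow_gap:
  assumes gap: "abs_lambda \<pi> P < 1" and h: "h \<in> bmeas S"
  shows "(\<integral>x. (kernel_pow n h x - (\<integral>x. h x \<partial>\<pi>))\<^sup>2 \<partial>\<pi>)
    \<le> (enn2real (abs_lambda \<pi> P) ^ n)\<^sup>2 * (\<integral>x. (h x)\<^sup>2 \<partial>\<pi>)"
proof -
  define l where "l = enn2real (abs_lambda \<pi> P)"
  define c where "c = (\<integral>x. h x \<partial>\<pi>)"
  define h0 where "h0 x = h x + - c" for x
  have h0: "h0 \<in> bmeas S" "(\<integral>x. h0 x \<partial>\<pi>) = 0"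
    using h unfolding h0_def[abs_def] by (auto simp: c_def)
  have "(\<integral>x. (kernel_pow n h0 x)\<^sup>2 \<partial>\<pi>) \<le> (l ^ n)\<^sup>2 * (\<integral>x. (h0 x)\<^sup>2 \<partial>\<pi>)"
  proof (induction n)
    case (Suc n)
    have "(\<integral>x. (kernel_pow (Suc n) h0 x)\<^sup>2 \<partial>\<pi>) \<le> l\<^sup>2 * (\<integral>x. (kernel_pow n h0 x)\<^sup>2 \<partial>\<pi>)"
      unfolding l_def using h0 gap abs_gap[of "kernel_pow n h0"] by (simp add: kernel_pow_bmeas integral_kernel_pow)
    also have "\<dots> \<le> l\<^sup>2 * ((l ^ n)\<^sup>2 * (\<integral>x. (h0 x)\<^sup>2 \<partial>\<pi>))"
      by (intro mult_left_mono Suc) auto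
    finally show ?case by (simp add: power_mult_distrib mult.assoc)
  qed simp
  moreover have "(\<integral>x. (kernel_pow n h0 x)\<^sup>2 \<partial>\<pi>) = (\<integral>x. (kernel_pow n h x - c)\<^sup>2 \<partial>\<pi>)"
  proof (intro Bochner_Integration.integral_cong refl)
    fix x assume "x \<in> space \<pi>"
    then have "kernel_pow n h0 x = kernel_pow n h x + - c"
      using kernel_pow_add[OF h bmeas_const, of x n "- c"] unfolding h0_def[abs_def] by simp
    then show "(kernel_pow n h0 x)\<^sup>2 = (kernel_pow n h x - c)\<^sup>2" by simp
  qed
  moreover have "(\<integral>x. (h0 x)\<^sup>2 \<partial>\<pi>) \<le> (\<integral>x. (h x)\<^sup>2 \<partial>\<pi>)"
  proof -
    have "(\<integral>x. (h0 x)\<^sup>2 \<partial>\<pi>) = (\<integral>x. (h x)\<^sup>2 - 2 * c * h x + c\<^sup>2 \<partial>\<pi>)"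
      unfolding h0_def by (intro Bochner_Integration.integral_cong) (auto simp: power2_eq_square algebra_simps)
    also have "\<dots> = (\<integral>x. (h x)\<^sup>2 \<partial>\<pi>) - c\<^sup>2"
      using h by (simp add: bmeas_power c_def[symmetric]) (simp add: power2_eq_square)
    finally show ?thesis by simp
  qed
  ultimately show ?thesis
    unfolding l_def[symmetric] c_def[symmetric] by (smt (verit) mult_left_mono zero_le_power2)
qed

text \<open>Cut h at height s. The lower piece and its images have values in [0, s], so T moves it
  to something of modulus at most s; hence the part of \<bar>T h\<bar> above s is at most
  \<bar>T\<bar> of the upper piece, to which the L2 decay applies.\<close>

lemma kernel_pow_gap_powr:
  assumes gap: "abs_lambda \<pi> P < 1" and h: "h \<in> bmeas S" "\<And>x. x \<in> space S \<Longrightarrow> 0 \<le> h x" and r: "2 < r"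
  shows "(\<integral>x. \<bar>kernel_pow n h x - (\<integral>x. h x \<partial>\<pi>)\<bar> powr r \<partial>\<pi>)
    \<le> (enn2real (abs_lambda \<pi> P) ^ n)\<^sup>2 * (\<integral>x. h x powr r \<partial>\<pi>)"
proof -
  define L where "L = (enn2real (abs_lambda \<pi> P) ^ n)\<^sup>2"
  define T where "T f x = kernel_pow n f x - (\<integral>x. f x \<partial>\<pi>)" for f x
  have L0: "0 \<le> L" by (simp add: L_def)
  have Tbm: "T f \<in> bmeas S" if "f \<in> bmeas S" for f
    using that unfolding T_def[abs_def] by auto
  have "(\<integral>\<^sup>+x. ennreal (\<bar>T h x\<bar> powr r) \<partial>\<pi>) \<le> ennreal L * (\<integral>\<^sup>+x. ennreal (h x powr r) \<partial>\<pi>)"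
  proof (rule powr_integral_le_of_truncations)
    fix s :: real assume s: "0 < s"
    define h1 h2 where "h1 x = h x - max (h x - s) 0" and "h2 x = max (h x - s) 0" for x
    have bm: "h1 \<in> bmeas S" "h2 \<in> bmeas S"
      unfolding h1_def[abs_def] h2_def[abs_def] by (intro bmeas_diff bmeas_max bmeas_const h)+
    have h1: "0 \<le> h1 x" "h1 x \<le> s" if "x \<in> space S" for x
      using h(2)[OF that] s by (auto simp: h1_def)
    have h_eq: "h = (\<lambda>x. h1 x + h2 x)" by (auto simp: h1_def h2_def)
    have Th: "T h x = T h1 x + T h2 x" if "x \<in> space S" for x
      unfolding T_def by (subst (1 2) h_eq) (use bm that in \<open>simp add: kernel_pow_add\<close>)
    have T1: "\<bar>T h1 x\<bar> \<le> s" if x: "x \<in> space S" for x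
    proof -
      have "0 \<le> kernel_pow n h1 x"
        using h1 x by (intro kernel_pow_nonneg) auto
      moreover have "kernel_pow n h1 x \<le> s"
        using kernel_pow_mono[OF bm(1) bmeas_const[of s] h1(2) x] x by simp
      moreover have "0 \<le> (\<integral>x. h1 x \<partial>\<pi>)"
        using h1 by (intro integral_nonneg_AE AE_I2) auto
      moreover have "(\<integral>x. h1 x \<partial>\<pi>) \<le> s"
        using integral_mono[of \<pi> h1 "\<lambda>x. s"] bm h1 by simp
      ultimately show ?thesis by (auto simp: T_def)
    qed
    have "(\<integral>\<^sup>+x. ennreal ((max (\<bar>T h x\<bar> - s) 0)\<^sup>2) \<partial>\<pi>) \<le> (\<integral>\<^sup>+x. ennreal ((T h2 x)\<^sup>2) \<partial>\<pi>)"
    proof (intro nn_integral_mono ennreal_leI)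
      fix x assume "x \<in> space \<pi>"
      then have "max (\<bar>T h x\<bar> - s) 0 \<le> \<bar>T h2 x\<bar>"
        using Th[of x] T1[of x] by auto
      then show "(max (\<bar>T h x\<bar> - s) 0)\<^sup>2 \<le> (T h2 x)\<^sup>2"
        using power_mono[of _ "\<bar>T h2 x\<bar>" 2] by fastforce
    qed
    also have "\<dots> = ennreal (\<integral>x. (T h2 x)\<^sup>2 \<partial>\<pi>)"
      using bm by (intro nn_integral_eq_integral) (auto intro: Tbm)
    also have "\<dots> \<le> ennreal (L * (\<integral>x. (h2 x)\<^sup>2 \<partial>\<pi>))"
      unfolding T_def L_def using bm gap by (intro ennreal_leI kernel_pow_gap)
    also have "\<dots> = ennreal L * (\<integral>\<^sup>+x. ennreal ((max (h x - s) 0)\<^sup>2) \<partial>\<pi>)"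
      using bm L0 unfolding h2_def[symmetric]
      by (subst nn_integral_eq_integral) (auto simp: ennreal_mult)
    finally show "(\<integral>\<^sup>+x. ennreal ((max (\<bar>T h x\<bar> - s) 0)\<^sup>2) \<partial>\<pi>)
      \<le> ennreal L * (\<integral>\<^sup>+x. ennreal ((max (h x - s) 0)\<^sup>2) \<partial>\<pi>)" .
  qed (use h r L0 Tbm in \<open>auto dest: bmeasD simp: borel_measurable_pi\<close>)
  also have "(\<integral>\<^sup>+x. ennreal (\<bar>T h x\<bar> powr r) \<partial>\<pi>) = ennreal (\<integral>x. \<bar>T h x\<bar> powr r \<partial>\<pi>)"
    using h r by (intro nn_integral_eq_integral integrable_bmeas bmeas_powr bmeas_abs Tbm) auto
  also have "(\<integral>\<^sup>+x. ennreal (h x powr r) \<partial>\<pi>) = ennreal (\<integral>x. h x powr r \<partial>\<pi>)"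
    using h r by (intro nn_integral_eq_integral integrable_bmeas bmeas_powr) auto
  finally have "ennreal (\<integral>x. \<bar>T h x\<bar> powr r \<partial>\<pi>) \<le> ennreal (L * (\<integral>x. h x powr r \<partial>\<pi>))"
    using L0 by (simp add: ennreal_mult)
  then show ?thesis
    using L0 unfolding T_def L_def by (subst (asm) ennreal_le_iff) auto
qed


section \<open>Decay of the iterated adjoint\<close>

lemma integrable_mult_bmeas:
  assumes "integrable \<pi> f" "v \<in> bmeas S"
  shows "integrable \<pi> (\<lambda>x. f x * v x)"
proof -
  obtain B where B: "0 \<le> B" "\<And>x. x \<in> space S \<Longrightarrow> \<bar>v x\<bar> \<le> B" using assms by (metis bmeasE)
  have [measurable]: "f \<in> borel_measurable \<pi>" "v \<in> borel_measurable \<pi>"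
    using assms by (auto simp: borel_measurable_pi dest: bmeasD)
  show ?thesis
    using B by (intro Bochner_Integration.integrable_bound[OF integrable_mult_left[OF assms(1), of B]])
      (auto intro!: AE_I2 mult_left_mono simp: abs_mult)
qed

lemma integral_adjoint_pow:
  fixes u k v :: "'a \<Rightarrow> real"
  assumes u: "integrable \<pi> u" "\<And>x. x \<in> space S \<Longrightarrow> 0 \<le> u x"
    and k: "k \<in> borel_measurable S" "\<And>x. 0 \<le> k x"
    and adj: "\<And>f. f \<in> borel_measurable S \<Longrightarrow>
       (\<integral>\<^sup>+x. ennreal (u x) * (nn_kernel ^^ n) f x \<partial>\<pi>) = (\<integral>\<^sup>+x. ennreal (k x) * f x \<partial>\<pi>)"
    and v: "v \<in> bmeas S"
  shows "integrable \<pi> k" and "(\<integral>x. k x * v x \<partial>\<pi>) = (\<integral>x. u x * kernel_pow n v x \<partial>\<pi>)"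
proof -
  note [measurable] = k(1)
  have adj': "(\<integral>\<^sup>+x. ennreal (k x * w x) \<partial>\<pi>) = ennreal (\<integral>x. u x * kernel_pow n w x \<partial>\<pi>)"
    if w: "w \<in> bmeas S" "\<And>x. x \<in> space S \<Longrightarrow> 0 \<le> w x" for w
  proof -
    have [measurable]: "w \<in> borel_measurable S" using w by (auto dest: bmeasD)
    have "(\<integral>\<^sup>+x. ennreal (k x * w x) \<partial>\<pi>) = (\<integral>\<^sup>+x. ennreal (k x) * ennreal (w x) \<partial>\<pi>)"
      using k w by (intro nn_integral_cong) (auto simp: ennreal_mult)
    also have "\<dots> = (\<integral>\<^sup>+x. ennreal (u x) * (nn_kernel ^^ n) (\<lambda>y. ennreal (w y)) x \<partial>\<pi>)"
      by (rule adj[symmetric]) measurable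
    also have "\<dots> = (\<integral>\<^sup>+x. ennreal (u x * kernel_pow n w x) \<partial>\<pi>)"
      using u w by (intro nn_integral_cong) (auto simp: ennreal_mult kernel_pow_nonneg ennreal_kernel_pow)
    also have "\<dots> = ennreal (\<integral>x. u x * kernel_pow n w x \<partial>\<pi>)"
      using u w by (intro nn_integral_eq_integral integrable_mult_bmeas kernel_pow_bmeas)
        (auto intro!: AE_I2 simp: kernel_pow_nonneg)
    finally show ?thesis .
  qed
  show ki: "integrable \<pi> k"
    using adj'[of "\<lambda>x. 1"] k by (intro integrableI_nonneg) auto
  have nonneg: "(\<integral>x. k x * w x \<partial>\<pi>) = (\<integral>x. u x * kernel_pow n w x \<partial>\<pi>)"
    if w: "w \<in> bmeas S" "\<And>x. x \<in> space S \<Longrightarrow> 0 \<le> w x" for w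
  proof -
    have "ennreal (\<integral>x. k x * w x \<partial>\<pi>) = (\<integral>\<^sup>+x. ennreal (k x * w x) \<partial>\<pi>)"
      using ki k w by (intro nn_integral_eq_integral[symmetric] integrable_mult_bmeas) (auto intro!: AE_I2)
    also have "\<dots> = ennreal (\<integral>x. u x * kernel_pow n w x \<partial>\<pi>)"
      using w by (rule adj')
    finally show ?thesis
      using k w u by (subst (asm) ennreal_inj) (auto intro!: integral_nonneg_AE AE_I2 simp: kernel_pow_nonneg)
  qed
  \<comment> \<open>The identity holds for v + B and for the constant B, both nonnegative;
    subtracting them gives it for the signed function v.\<close>
  obtain B where B: "0 \<le> B" "\<And>x. x \<in> space S \<Longrightarrow> \<bar>v x\<bar> \<le> B" using v by (metis bmeasE)
  have vB: "(\<lambda>x. v x + B) \<in> bmeas S"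
    using v by (intro bmeas_add bmeas_const)
  have vB0: "0 \<le> v x + B" if "x \<in> space S" for x
    using B(2)[OF that] by auto
  have "(\<integral>x. k x * v x \<partial>\<pi>) + (\<integral>x. k x * B \<partial>\<pi>) = (\<integral>x. k x * (v x + B) \<partial>\<pi>)"
    using ki v by (simp add: distrib_left integrable_mult_bmeas)
  also have "\<dots> = (\<integral>x. u x * kernel_pow n (\<lambda>x. v x + B) x \<partial>\<pi>)"
    by (rule nonneg[OF vB vB0])
  also have "\<dots> = (\<integral>x. u x * kernel_pow n v x + u x * B \<partial>\<pi>)"
    using v by (intro Bochner_Integration.integral_cong) (auto simp: kernel_pow_add distrib_left)
  also have "\<dots> = (\<integral>x. u x * kernel_pow n v x \<partial>\<pi>) + (\<integral>x. u x * B \<partial>\<pi>)"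
    using u v by (intro Bochner_Integration.integral_add integrable_mult_bmeas kernel_pow_bmeas) auto
  also have "(\<integral>x. u x * B \<partial>\<pi>) = (\<integral>x. u x * kernel_pow n (\<lambda>x. B) x \<partial>\<pi>)"
    by (intro Bochner_Integration.integral_cong) auto
  also have "\<dots> = (\<integral>x. k x * B \<partial>\<pi>)"
    using B by (intro nonneg[symmetric]) auto
  finally show "(\<integral>x. k x * v x \<partial>\<pi>) = (\<integral>x. u x * kernel_pow n v x \<partial>\<pi>)"
    by simp
qed

text \<open>Duality: pairing k - c with a test function v equals pairing u with T v, and
  \<open>kernel_pow_gap\<close> bounds T v. Choosing v = k - c would finish, but square
  integrability of k is part of the claim, so truncations are used and monotone convergence
  concludes.\<close>

lemma nn_adjoint_gap_L2:
  fixes u k :: "'a \<Rightarrow> real"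
  assumes gap: "abs_lambda \<pi> P < 1"
    and u: "u \<in> borel_measurable S" "\<And>x. x \<in> space S \<Longrightarrow> 0 \<le> u x" "integrable \<pi> (\<lambda>x. (u x)\<^sup>2)"
    and k: "k \<in> borel_measurable S" "\<And>x. 0 \<le> k x"
    and adj: "\<And>f. f \<in> borel_measurable S \<Longrightarrow>
       (\<integral>\<^sup>+x. ennreal (u x) * (nn_kernel ^^ n) f x \<partial>\<pi>) = (\<integral>\<^sup>+x. ennreal (k x) * f x \<partial>\<pi>)"
  shows "(\<integral>\<^sup>+x. ennreal ((k x - (\<integral>x. u x \<partial>\<pi>))\<^sup>2) \<partial>\<pi>)
    \<le> ennreal ((enn2real (abs_lambda \<pi> P) ^ n)\<^sup>2 * (\<integral>x. (u x)\<^sup>2 \<partial>\<pi>))"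
proof -
  define L where "L = (enn2real (abs_lambda \<pi> P) ^ n)\<^sup>2"
  define c where "c = (\<integral>x. u x \<partial>\<pi>)"
  define U where "U = (\<integral>x. (u x)\<^sup>2 \<partial>\<pi>)"
  have uL2: "u \<in> L2 \<pi>" using u by (simp add: L2_def borel_measurable_pi)
  then have ui: "integrable \<pi> u" by (rule integrable_L2)
  note [measurable] = k(1) u(1)
  \<comment> \<open>Large values are replaced by 0 rather than clamped, so that (k - c) * v N is
    exactly the square of v N.\<close>
  define v where "v N x = (if \<bar>k x - c\<bar> \<le> real N then k x - c else 0)" for N x
  have vbm: "v N \<in> bmeas S" for N
    by (rule bmeasI[of _ _ "real N"]) (auto simp: v_def[abs_def])
  have bound: "(\<integral>x. (v N x)\<^sup>2 \<partial>\<pi>) \<le> L * U" for N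
  proof -
    define V where "V = (\<integral>x. (v N x)\<^sup>2 \<partial>\<pi>)"
    define T where "T x = kernel_pow n (v N) x - (\<integral>x. v N x \<partial>\<pi>)" for x
    have Tbm: "T \<in> bmeas S"
      unfolding T_def[abs_def] by (intro bmeas_diff kernel_pow_bmeas vbm bmeas_const)
    have "V = (\<integral>x. k x * v N x - c * v N x \<partial>\<pi>)"
      unfolding V_def by (intro Bochner_Integration.integral_cong) (auto simp: v_def power2_eq_square algebra_simps)
    also have "\<dots> = (\<integral>x. k x * v N x \<partial>\<pi>) - c * (\<integral>x. v N x \<partial>\<pi>)"
      using integral_adjoint_pow(1)[OF ui u(2) k adj vbm] vbm
      by (subst Bochner_Integration.integral_diff) (auto intro!: integrable_mult_bmeas)
    also have "(\<integral>x. k x * v N x \<partial>\<pi>) = (\<integral>x. u x * kernel_pow n (v N) x \<partial>\<pi>)"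
      by (rule integral_adjoint_pow(2)[OF ui u(2) k adj vbm])
    also have "\<dots> - c * (\<integral>x. v N x \<partial>\<pi>) = (\<integral>x. u x * kernel_pow n (v N) x - u x * (\<integral>x. v N x \<partial>\<pi>) \<partial>\<pi>)"
      using ui vbm[of N] by (subst Bochner_Integration.integral_diff)
        (auto intro!: integrable_mult_bmeas kernel_pow_bmeas simp: c_def)
    also have "\<dots> = (\<integral>x. u x * T x \<partial>\<pi>)"
      by (simp add: T_def algebra_simps)
    finally have "V\<^sup>2 \<le> U * (\<integral>x. (T x)\<^sup>2 \<partial>\<pi>)"
      using integral_Cauchy_Schwarz[OF u(3) integrable_bmeas[OF bmeas_power[OF Tbm]] integrable_mult_bmeas[OF ui Tbm]]
      by (simp only: U_def)
    also have "\<dots> \<le> U * (L * V)"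
      unfolding T_def L_def V_def using vbm gap by (intro mult_left_mono kernel_pow_gap) (auto simp: U_def)
    finally have "V * V \<le> (L * U) * V"
      by (simp add: power2_eq_square mult_ac)
    moreover have "0 \<le> V" "0 \<le> L * U" by (auto simp: V_def L_def U_def)
    ultimately have "V \<le> L * U"
      by (cases "V = 0") auto
    then show ?thesis by (simp add: V_def)
  qed
  have sup: "(SUP N. ennreal ((v N x)\<^sup>2)) = ennreal ((k x - c)\<^sup>2)" for x
  proof (rule antisym)
    show "(SUP N. ennreal ((v N x)\<^sup>2)) \<le> ennreal ((k x - c)\<^sup>2)"
      by (intro SUP_least ennreal_leI) (auto simp: v_def)
    obtain N :: nat where "\<bar>k x - c\<bar> \<le> real N" using real_arch_simple by blast
    then have "v N x = k x - c" by (simp add: v_def)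
    then show "ennreal ((k x - c)\<^sup>2) \<le> (SUP N. ennreal ((v N x)\<^sup>2))"
      by (metis SUP_upper UNIV_I)
  qed
  have "(\<integral>\<^sup>+x. ennreal ((k x - c)\<^sup>2) \<partial>\<pi>) = (SUP N. \<integral>\<^sup>+x. ennreal ((v N x)\<^sup>2) \<partial>\<pi>)"
    unfolding sup[symmetric]
  proof (rule nn_integral_monotone_convergence_SUP)
    show "incseq (\<lambda>N x. ennreal ((v N x)\<^sup>2))"
      by (intro incseq_SucI le_funI ennreal_leI) (auto simp: v_def)
    show "(\<lambda>x. ennreal ((v N x)\<^sup>2)) \<in> borel_measurable \<pi>" for N
      using bmeasD[OF vbm] by measurable
  qed
  also have "\<dots> \<le> ennreal (L * U)"
  proof (rule SUP_least)
    fix N :: nat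
    have "(\<integral>\<^sup>+x. ennreal ((v N x)\<^sup>2) \<partial>\<pi>) = ennreal (\<integral>x. (v N x)\<^sup>2 \<partial>\<pi>)"
      using vbm[of N] by (intro nn_integral_eq_integral integrable_bmeas bmeas_power) auto
    also have "\<dots> \<le> ennreal (L * U)" by (intro ennreal_leI bound)
    finally show "(\<integral>\<^sup>+x. ennreal ((v N x)\<^sup>2) \<partial>\<pi>) \<le> ennreal (L * U)" .
  qed
  finally show ?thesis by (simp add: L_def U_def c_def)
qed

text \<open>Adjoint densities come from existence statements, so the additivity needed for
  truncation, k = k1 + k2, holds only almost everywhere and rests on this uniqueness.\<close>

lemma nn_adjoint_unique:
  fixes k k' :: "'a \<Rightarrow> real"
  assumes "k \<in> borel_measurable S" "k' \<in> borel_measurable S" "\<And>x. 0 \<le> k x" "\<And>x. 0 \<le> k' x"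
    and eq: "\<And>f. f \<in> borel_measurable S \<Longrightarrow>
       (\<integral>\<^sup>+x. ennreal (k x) * f x \<partial>\<pi>) = (\<integral>\<^sup>+x. ennreal (k' x) * f x \<partial>\<pi>)"
  shows "AE x in \<pi>. k x = k' x"
proof -
  note [measurable] = assms(1,2)
  have "density \<pi> (\<lambda>x. ennreal (k x)) = density \<pi> (\<lambda>x. ennreal (k' x))"
  proof (rule measure_eqI)
    fix A assume "A \<in> sets (density \<pi> (\<lambda>x. ennreal (k x)))"
    then have [measurable]: "A \<in> sets S" by simp
    show "emeasure (density \<pi> (\<lambda>x. ennreal (k x))) A = emeasure (density \<pi> (\<lambda>x. ennreal (k' x))) A"
      by (subst (1 2) emeasure_density) (auto intro!: eq)
  qed simp
  then have "AE x in \<pi>. ennreal (k x) = ennreal (k' x)"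
    by (subst (asm) density_unique_iff) auto
  then show ?thesis
    by eventually_elim (use assms in auto)
qed

text \<open>The truncation argument of \<open>kernel_pow_gap_powr\<close> on the adjoint side. The
  lower piece u1 \<le> s has an adjoint density k1 and a mean c1 both in [0, s] (almost everywhere
  for k1), so the excess of \<bar>k - c\<bar> over s is controlled by the upper piece.\<close>

lemma nn_adjoint_gap_powr:
  fixes u k :: "'a \<Rightarrow> real" and r :: real
  assumes gap: "abs_lambda \<pi> P < 1" and r: "2 < r"
    and u: "u \<in> borel_measurable S" "\<And>x. x \<in> space S \<Longrightarrow> 0 \<le> u x" "integrable \<pi> (\<lambda>x. u x powr r)"
    and k: "k \<in> borel_measurable S" "\<And>x. 0 \<le> k x"
    and adj: "\<And>f. f \<in> borel_measurable S \<Longrightarrow>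
       (\<integral>\<^sup>+x. ennreal (u x) * (nn_kernel ^^ n) f x \<partial>\<pi>) = (\<integral>\<^sup>+x. ennreal (k x) * f x \<partial>\<pi>)"
  shows "integrable \<pi> (\<lambda>x. \<bar>k x - (\<integral>x. u x \<partial>\<pi>)\<bar> powr r)"
    and "(\<integral>x. \<bar>k x - (\<integral>x. u x \<partial>\<pi>)\<bar> powr r \<partial>\<pi>)
      \<le> (enn2real (abs_lambda \<pi> P) ^ n)\<^sup>2 * (\<integral>x. u x powr r \<partial>\<pi>)"
proof -
  define L where "L = (enn2real (abs_lambda \<pi> P) ^ n)\<^sup>2"
  have L0: "0 \<le> L" by (simp add: L_def)
  define c where "c = (\<integral>x. u x \<partial>\<pi>)"
  note [measurable] = u(1) k(1)
  \<comment> \<open>On a probability space this puts u into L2, and hence into L1.\<close>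
  have sq: "a\<^sup>2 \<le> 1 + a powr r" if "0 \<le> a" for a :: real
  proof (cases "a \<le> 1")
    case True
    then have "a\<^sup>2 \<le> 1" using that by (simp add: power_le_one)
    then show ?thesis by (rule order_trans) simp
  next
    case False
    then have "a powr 2 \<le> a powr r" using r by (intro powr_mono) auto
    then show ?thesis using False by (simp add: powr_numeral)
  qed
  have "integrable \<pi> (\<lambda>x. 1 + u x powr r)" using u(3) by simp
  then have u2: "integrable \<pi> (\<lambda>x. (u x)\<^sup>2)"
  proof (rule Bochner_Integration.integrable_bound)
    show "AE x in \<pi>. norm ((u x)\<^sup>2) \<le> norm (1 + u x powr r)"
    proof (rule AE_I2)
      fix x assume "x \<in> space \<pi>"
      then have "(u x)\<^sup>2 \<le> 1 + u x powr r" using u(2) by (intro sq) simp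
      then show "norm ((u x)\<^sup>2) \<le> norm (1 + u x powr r)" by (simp add: abs_of_nonneg)
    qed
  qed measurable
  then have "u \<in> L2 \<pi>" using u(1) by (simp add: L2_def borel_measurable_pi)
  then have ui: "integrable \<pi> u" by (rule integrable_L2)
  have "(\<integral>\<^sup>+x. ennreal (\<bar>k x - c\<bar> powr r) \<partial>\<pi>) \<le> ennreal L * (\<integral>\<^sup>+x. ennreal (u x powr r) \<partial>\<pi>)"
  proof (rule powr_integral_le_of_truncations)
    fix s :: real assume s: "0 < s"
    define u1 u2 where "u1 x = u x - max (u x - s) 0" and "u2 x = max (u x - s) 0" for x
    have u_eq: "u x = u1 x + u2 x" for x by (simp add: u1_def u2_def)
    have m[measurable]: "u1 \<in> borel_measurable S" "u2 \<in> borel_measurable S"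
      unfolding u1_def[abs_def] u2_def[abs_def] by measurable
    have u1: "0 \<le> u1 x" "u1 x \<le> s" and u20: "0 \<le> u2 x" "u2 x \<le> u x" if "x \<in> space S" for x
      using u(2)[OF that] s by (auto simp: u1_def u2_def)
    have u1i: "integrable \<pi> u1"
      using u1 by (intro integrable_bmeas bmeasI[of _ _ s]) auto
    have "integrable \<pi> (\<lambda>x. u x - u1 x)" using ui u1i by simp
    then have u2i: "integrable \<pi> u2" by (simp add: u_eq)
    have u22: "integrable \<pi> (\<lambda>x. (u2 x)\<^sup>2)"
      using u20 by (intro Bochner_Integration.integrable_bound[OF u2])
        (auto intro!: AE_I2 power_mono)
    have fin: "(\<integral>\<^sup>+x. ennreal (w x) \<partial>\<pi>) < \<infinity>" if "integrable \<pi> w" for w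
    proof -
      have "(\<integral>\<^sup>+x. ennreal (w x) \<partial>\<pi>) \<le> (\<integral>\<^sup>+x. ennreal (norm (w x)) \<partial>\<pi>)"
        by (intro nn_integral_mono ennreal_leI) auto
      also have "\<dots> < \<infinity>" using that by (simp add: integrable_iff_bounded)
      finally show ?thesis .
    qed
    obtain k1 where k1: "k1 \<in> borel_measurable S" "\<And>x. 0 \<le> k1 x"
      "(\<integral>\<^sup>+x. ennreal (k1 x) \<partial>\<pi>) = (\<integral>\<^sup>+x. ennreal (u1 x) \<partial>\<pi>)"
      "\<And>f. f \<in> borel_measurable S \<Longrightarrow>
       (\<integral>\<^sup>+x. ennreal (u1 x) * (nn_kernel ^^ n) f x \<partial>\<pi>) = (\<integral>\<^sup>+x. ennreal (k1 x) * f x \<partial>\<pi>)"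
      by (rule nn_adjoint_pow[OF m(1) fin[OF u1i], where n = n]) (rule that; assumption)
    obtain k2 where k2: "k2 \<in> borel_measurable S" "\<And>x. 0 \<le> k2 x"
      "(\<integral>\<^sup>+x. ennreal (k2 x) \<partial>\<pi>) = (\<integral>\<^sup>+x. ennreal (u2 x) \<partial>\<pi>)"
      "\<And>f. f \<in> borel_measurable S \<Longrightarrow>
       (\<integral>\<^sup>+x. ennreal (u2 x) * (nn_kernel ^^ n) f x \<partial>\<pi>) = (\<integral>\<^sup>+x. ennreal (k2 x) * f x \<partial>\<pi>)"
      by (rule nn_adjoint_pow[OF m(2) fin[OF u2i], where n = n]) (rule that; assumption)
    note [measurable] = k1(1) k2(1)
    have k_eq: "AE x in \<pi>. k x = k1 x + k2 x"
    proof (rule nn_adjoint_unique)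
      fix f :: "'a \<Rightarrow> ennreal" assume f[measurable]: "f \<in> borel_measurable S"
      have "(\<integral>\<^sup>+x. ennreal (k x) * f x \<partial>\<pi>) = (\<integral>\<^sup>+x. ennreal (u x) * (nn_kernel ^^ n) f x \<partial>\<pi>)"
        by (rule adj[symmetric, OF f])
      also have "\<dots> = (\<integral>\<^sup>+x. ennreal (u1 x) * (nn_kernel ^^ n) f x + ennreal (u2 x) * (nn_kernel ^^ n) f x \<partial>\<pi>)"
        using u1 u20 by (intro nn_integral_cong) (simp add: u_eq ennreal_plus distrib_right)
      also have "\<dots> = (\<integral>\<^sup>+x. ennreal (k1 x) * f x \<partial>\<pi>) + (\<integral>\<^sup>+x. ennreal (k2 x) * f x \<partial>\<pi>)"
        by (subst nn_integral_add) (auto simp: k1(4)[OF f] k2(4)[OF f])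
      also have "\<dots> = (\<integral>\<^sup>+x. ennreal (k1 x + k2 x) * f x \<partial>\<pi>)"
        using k1(2) k2(2) by (subst nn_integral_add[symmetric]) (auto simp: ennreal_plus distrib_right)
      finally show "(\<integral>\<^sup>+x. ennreal (k x) * f x \<partial>\<pi>) = (\<integral>\<^sup>+x. ennreal (k1 x + k2 x) * f x \<partial>\<pi>)" .
    qed (use k k1(2) k2(2) in auto)
    have k1_le: "AE x in \<pi>. k1 x \<le> s"
      using s u1 by (intro nn_adjoint_bound[OF k1(1) _ _ k1(4)]) auto
    define c1 c2 where "c1 = (\<integral>x. u1 x \<partial>\<pi>)" and "c2 = (\<integral>x. u2 x \<partial>\<pi>)"
    have c: "c = c1 + c2"
      unfolding c_def c1_def c2_def using u1i u2i by (subst ext[of u, OF u_eq]) simp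
    have c1: "0 \<le> c1"
      unfolding c1_def using u1 by (intro integral_nonneg_AE AE_I2) auto
    have c1s: "c1 \<le> s"
      using integral_mono[OF u1i, of "\<lambda>x. s"] u1 by (simp add: c1_def)
    have "AE x in \<pi>. (max (\<bar>k x - c\<bar> - s) 0)\<^sup>2 \<le> (k2 x - c2)\<^sup>2"
      using k_eq k1_le
    proof eventually_elim
      case (elim x)
      then have "max (\<bar>k x - c\<bar> - s) 0 \<le> \<bar>k2 x - c2\<bar>"
        using k1(2)[of x] c c1 c1s by auto
      then show ?case
        using power_mono[of _ "\<bar>k2 x - c2\<bar>" 2] by fastforce
    qed
    then have "(\<integral>\<^sup>+x. ennreal ((max (\<bar>k x - c\<bar> - s) 0)\<^sup>2) \<partial>\<pi>) \<le> (\<integral>\<^sup>+x. ennreal ((k2 x - c2)\<^sup>2) \<partial>\<pi>)"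
      by (intro nn_integral_mono_AE) (auto intro: ennreal_leI)
    also have "\<dots> \<le> ennreal (L * (\<integral>x. (u2 x)\<^sup>2 \<partial>\<pi>))"
      unfolding L_def c2_def using u20 u22 by (intro nn_adjoint_gap_L2 gap m k2) auto
    also have "\<dots> = ennreal L * (\<integral>\<^sup>+x. ennreal ((u2 x)\<^sup>2) \<partial>\<pi>)"
      using L0 u22 by (subst nn_integral_eq_integral) (auto simp: ennreal_mult)
    finally show "(\<integral>\<^sup>+x. ennreal ((max (\<bar>k x - c\<bar> - s) 0)\<^sup>2) \<partial>\<pi>)
        \<le> ennreal L * (\<integral>\<^sup>+x. ennreal ((max (u x - s) 0)\<^sup>2) \<partial>\<pi>)"
      by (simp add: u2_def)
  qed (use u r L0 in auto)
  also have "\<dots> = ennreal (L * (\<integral>x. u x powr r \<partial>\<pi>))"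
    using u(3) L0 by (subst nn_integral_eq_integral) (auto simp: ennreal_mult)
  finally have *: "(\<integral>\<^sup>+x. ennreal (\<bar>k x - c\<bar> powr r) \<partial>\<pi>) \<le> ennreal (L * (\<integral>x. u x powr r \<partial>\<pi>))" .
  then have i: "integrable \<pi> (\<lambda>x. \<bar>k x - c\<bar> powr r)"
    by (intro integrableI_nonneg) (auto intro: le_less_trans)
  then show "integrable \<pi> (\<lambda>x. \<bar>k x - (\<integral>x. u x \<partial>\<pi>)\<bar> powr r)"
    by (simp add: c_def)
  have "(\<integral>x. \<bar>k x - c\<bar> powr r \<partial>\<pi>) \<le> L * (\<integral>x. u x powr r \<partial>\<pi>)"
    using * L0 by (subst (asm) nn_integral_eq_integral[OF i]) (auto simp: ennreal_le_iff)
  then show "(\<integral>x. \<bar>k x - (\<integral>x. u x \<partial>\<pi>)\<bar> powr r \<partial>\<pi>)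
      \<le> (enn2real (abs_lambda \<pi> P) ^ n)\<^sup>2 * (\<integral>x. u x powr r \<partial>\<pi>)"
    by (simp add: c_def L_def)
qed

lemma correlation_le_of_exponent_le_2:
  fixes g h :: "'a \<Rightarrow> real" and r q :: real
  assumes gap: "abs_lambda \<pi> P < 1" and r: "1 < r" "2 \<le> q" "1 / r + 1 / q = 1"
    and g: "g \<in> borel_measurable S" "integrable \<pi> (\<lambda>x. \<bar>g x\<bar> powr r)"
    and h: "h \<in> bmeas S" "\<And>x. x \<in> space S \<Longrightarrow> 0 \<le> h x"
  shows "(\<integral>x. g x * (kernel_pow n h x - (\<integral>x. h x \<partial>\<pi>)) \<partial>\<pi>)
    \<le> (\<integral>x. \<bar>g x\<bar> powr r \<partial>\<pi>) powr (1 / r)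
      * (((enn2real (abs_lambda \<pi> P) ^ n)\<^sup>2) powr (1 / q) * (\<integral>x. h x powr q \<partial>\<pi>) powr (1 / q))"
proof -
  define T where "T x = kernel_pow n h x - (\<integral>x. h x \<partial>\<pi>)" for x
  have Tbm: "T \<in> bmeas S"
    unfolding T_def[abs_def] by (intro bmeas_diff kernel_pow_bmeas h bmeas_const)
  note [measurable] = g(1) bmeasD[OF Tbm]
  have Tq: "(\<integral>x. \<bar>T x\<bar> powr q \<partial>\<pi>) \<le> (enn2real (abs_lambda \<pi> P) ^ n)\<^sup>2 * (\<integral>x. h x powr q \<partial>\<pi>)"
  \<comment> \<open>The endpoint q = 2 is the L2 decay itself; the layer formula behind
    \<open>kernel_pow_gap_powr\<close> requires q > 2.\<close>
  proof (cases "q = 2")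
    case True
    have "(\<integral>x. h x powr q \<partial>\<pi>) = (\<integral>x. (h x)\<^sup>2 \<partial>\<pi>)"
      using h by (intro Bochner_Integration.integral_cong) (auto simp: True powr_numeral)
    then show ?thesis
      using kernel_pow_gap[OF gap h(1), of n] by (simp add: True T_def powr_numeral)
  next
    case False
    then show ?thesis
      unfolding T_def using gap h r by (intro kernel_pow_gap_powr) auto
  qed
  have iT: "integrable \<pi> (\<lambda>x. \<bar>T x\<bar> powr q)"
    using r by (intro integrable_bmeas bmeas_powr bmeas_abs Tbm) auto
  have H: "integrable \<pi> (\<lambda>x. \<bar>g x\<bar> * \<bar>T x\<bar>)"
    "(\<integral>x. \<bar>g x\<bar> * \<bar>T x\<bar> \<partial>\<pi>) \<le> (\<integral>x. \<bar>g x\<bar> powr r \<partial>\<pi>) powr (1 / r) * (\<integral>x. \<bar>T x\<bar> powr q \<partial>\<pi>) powr (1 / q)"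
    using r g(2) iT by (intro integral_Holder[where p = r and q = q]; simp)+
  have "integrable \<pi> (\<lambda>x. g x * T x)"
    by (rule Bochner_Integration.integrable_bound[OF H(1)]) (auto simp: abs_mult)
  then have "(\<integral>x. g x * T x \<partial>\<pi>) \<le> (\<integral>x. \<bar>g x\<bar> * \<bar>T x\<bar> \<partial>\<pi>)"
    using H(1) by (rule integral_mono) (metis abs_ge_self abs_mult)
  also note H(2)
  also have "(\<integral>x. \<bar>T x\<bar> powr q \<partial>\<pi>) powr (1 / q)
      \<le> ((enn2real (abs_lambda \<pi> P) ^ n)\<^sup>2 * (\<integral>x. h x powr q \<partial>\<pi>)) powr (1 / q)"
    using Tq r by (intro powr_mono2) auto
  finally show ?thesis
    by (simp add: T_def powr_mult mult_left_mono)
qed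

text \<open>Now q < 2, so the decay is applied to the adjoint acting on g. The factor 2 is the cost
  of splitting g into its positive and negative parts, each of which is dominated by
  \<bar>g\<bar>.\<close>

lemma correlation_le_of_exponent_gt_2:
  fixes g h :: "'a \<Rightarrow> real" and r q :: real
  assumes gap: "abs_lambda \<pi> P < 1" and r: "2 < r" "1 < q" "1 / r + 1 / q = 1"
    and g: "g \<in> borel_measurable S" "integrable \<pi> (\<lambda>x. \<bar>g x\<bar> powr r)"
    and h: "h \<in> bmeas S" "\<And>x. x \<in> space S \<Longrightarrow> 0 \<le> h x"
  shows "(\<integral>x. g x * (kernel_pow n h x - (\<integral>x. h x \<partial>\<pi>)) \<partial>\<pi>)
    \<le> 2 * ((((enn2real (abs_lambda \<pi> P) ^ n)\<^sup>2) powr (1 / r) * (\<integral>x. \<bar>g x\<bar> powr r \<partial>\<pi>) powr (1 / r))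
      * (\<integral>x. h x powr q \<partial>\<pi>) powr (1 / q))"
proof -
  define T where "T x = kernel_pow n h x - (\<integral>x. h x \<partial>\<pi>)" for x
  have Tbm: "T \<in> bmeas S"
    unfolding T_def[abs_def] by (intro bmeas_diff kernel_pow_bmeas h bmeas_const)
  note [measurable] = g(1) bmeasD[OF Tbm] bmeasD[OF h(1)]
  define L where "L = (enn2real (abs_lambda \<pi> P) ^ n)\<^sup>2"
  define G H where "G = (\<integral>x. \<bar>g x\<bar> powr r \<partial>\<pi>)" and "H = (\<integral>x. h x powr q \<partial>\<pi>)"
  have part: "integrable \<pi> u \<and> \<bar>\<integral>x. u x * T x \<partial>\<pi>\<bar> \<le> (L powr (1 / r) * G powr (1 / r)) * H powr (1 / q)"
    if um[measurable]: "u \<in> borel_measurable S" and u: "\<And>x. 0 \<le> u x" "\<And>x. u x \<le> \<bar>g x\<bar>" for u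
  proof -
    have le: "u x powr r \<le> \<bar>g x\<bar> powr r" for x
      using u[of x] r by (intro powr_mono2) auto
    have ur: "integrable \<pi> (\<lambda>x. u x powr r)"
      using le by (intro Bochner_Integration.integrable_bound[OF g(2)]) auto
    have ui: "integrable \<pi> u"
    proof (rule Bochner_Integration.integrable_bound)
      show "integrable \<pi> (\<lambda>x. 1 + u x powr r)" using ur by simp
      have le1: "a \<le> 1 + a powr r" if "0 \<le> a" for a :: real
      proof (cases "a \<le> 1")
        case False
        then have "a powr 1 \<le> a powr r" using r by (intro powr_mono) auto
        then show ?thesis using False by simp
      qed (simp add: add_increasing2)
      show "AE x in \<pi>. norm (u x) \<le> norm (1 + u x powr r)"
        using le1[OF u(1)] u(1) by (intro AE_I2) (simp add: abs_of_nonneg)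
    qed measurable
    have "(\<integral>\<^sup>+x. ennreal (u x) \<partial>\<pi>) < \<infinity>"
      using ui u by (simp add: integrable_iff_bounded)
    then obtain k where k: "k \<in> borel_measurable S" "\<And>x. 0 \<le> k x"
      "(\<integral>\<^sup>+x. ennreal (k x) \<partial>\<pi>) = (\<integral>\<^sup>+x. ennreal (u x) \<partial>\<pi>)"
      "\<And>f. f \<in> borel_measurable S \<Longrightarrow>
       (\<integral>\<^sup>+x. ennreal (u x) * (nn_kernel ^^ n) f x \<partial>\<pi>) = (\<integral>\<^sup>+x. ennreal (k x) * f x \<partial>\<pi>)"
      by (rule nn_adjoint_pow[OF um, where n = n]) (rule that; assumption)
    note [measurable] = k(1)
    define c where "c = (\<integral>x. u x \<partial>\<pi>)"
    note ki = integral_adjoint_pow[OF ui u(1) k(1,2,4) h(1)]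
    note gp = nn_adjoint_gap_powr[OF gap r(1) um u(1) ur k(1,2,4), folded c_def L_def]
    have hq: "integrable \<pi> (\<lambda>x. h x powr q)"
      using h r by (intro integrable_bmeas bmeas_powr) auto
    have Hl: "integrable \<pi> (\<lambda>x. \<bar>k x - c\<bar> * h x)"
      "(\<integral>x. \<bar>k x - c\<bar> * h x \<partial>\<pi>) \<le> (\<integral>x. \<bar>k x - c\<bar> powr r \<partial>\<pi>) powr (1 / r) * H powr (1 / q)"
      unfolding H_def using r h gp(1) hq by (intro integral_Holder[where p = r and q = q]; simp)+
    have "(\<integral>x. u x * T x \<partial>\<pi>) = (\<integral>x. u x * kernel_pow n h x \<partial>\<pi>) - (\<integral>x. u x * (\<integral>x. h x \<partial>\<pi>) \<partial>\<pi>)"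
      unfolding T_def right_diff_distrib using ui h
      by (intro Bochner_Integration.integral_diff integrable_mult_bmeas kernel_pow_bmeas) auto
    also have "\<dots> = (\<integral>x. k x * h x - c * h x \<partial>\<pi>)"
      using ki h by (simp add: integrable_mult_bmeas c_def)
    also have "\<dots> = (\<integral>x. (k x - c) * h x \<partial>\<pi>)"
      by (simp add: left_diff_distrib)
    finally have "\<bar>\<integral>x. u x * T x \<partial>\<pi>\<bar> \<le> (\<integral>x. \<bar>(k x - c) * h x\<bar> \<partial>\<pi>)"
      by (simp add: integral_abs_bound)
    also have "\<dots> = (\<integral>x. \<bar>k x - c\<bar> * h x \<partial>\<pi>)"
      using h by (intro Bochner_Integration.integral_cong) (auto simp: abs_mult)
    also note Hl(2)
    also have "(\<integral>x. \<bar>k x - c\<bar> powr r \<partial>\<pi>) \<le> L * G"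
    proof -
      have "(\<integral>x. u x powr r \<partial>\<pi>) \<le> G"
        unfolding G_def using le ur g(2) by (intro integral_mono) auto
      then have "L * (\<integral>x. u x powr r \<partial>\<pi>) \<le> L * G"
        by (intro mult_left_mono) (auto simp: L_def)
      then show ?thesis using gp(2) by simp
    qed
    then have "(\<integral>x. \<bar>k x - c\<bar> powr r \<partial>\<pi>) powr (1 / r) \<le> (L * G) powr (1 / r)"
      using r by (intro powr_mono2) auto
    finally show ?thesis
      using ui by (simp add: powr_mult L_def G_def mult_right_mono)
  qed
  define gp gm where "gp x = max (g x) 0" and "gm x = max (- g x) 0" for x
  have P: "integrable \<pi> gp \<and> \<bar>\<integral>x. gp x * T x \<partial>\<pi>\<bar> \<le> (L powr (1 / r) * G powr (1 / r)) * H powr (1 / q)"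
    by (rule part) (auto simp: gp_def[abs_def])
  have Mi: "integrable \<pi> gm \<and> \<bar>\<integral>x. gm x * T x \<partial>\<pi>\<bar> \<le> (L powr (1 / r) * G powr (1 / r)) * H powr (1 / q)"
    by (rule part) (auto simp: gm_def[abs_def])
  have "(\<integral>x. g x * T x \<partial>\<pi>) = (\<integral>x. gp x * T x - gm x * T x \<partial>\<pi>)"
    by (intro Bochner_Integration.integral_cong) (auto simp: gp_def gm_def max_def)
  also have "\<dots> = (\<integral>x. gp x * T x \<partial>\<pi>) - (\<integral>x. gm x * T x \<partial>\<pi>)"
    using P Mi Tbm by (intro Bochner_Integration.integral_diff integrable_mult_bmeas) auto
  finally show ?thesis
    using P Mi unfolding T_def L_def G_def H_def by linarith
qed

end

subsection \<open>The initial law\<close>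

text \<open>Turns the squared L2 rate raised to 1/q into the exponent 2 n / q of the constant. The
  convention that 0^0 is 1 matters at l = 0 and n = 0, where both sides are 1.\<close>

lemma rpow_eq_powr_square:
  fixes l q :: real
  assumes "0 \<le> l" "0 < q"
  shows "((l ^ n)\<^sup>2) powr (1 / q) = rpow l (2 * real n / q)"
proof (cases "n = 0 \<or> l = 0")
  case False
  then have "0 < l" using assms by simp
  then have "l powr (2 * real n) = l ^ (2 * n)"
    using powr_realpow[of l "2 * n"] by simp
  then have "(l ^ n)\<^sup>2 = l powr (2 * real n)"
    by (simp only: power_even_eq)
  then show ?thesis
    using False assms by (simp add: rpow_def powr_powr)
qed (use assms in \<open>auto simp: rpow_def zero_power\<close>)

lemma conj_exponent_ge_1: "1 < p \<Longrightarrow> 1 \<le> conj_exponent p"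
  by (cases p) (auto simp: conj_exponent_def ennreal_less_iff simp flip: ennreal_1)

context invariant_kernel
begin

text \<open>With density 1 + g and g of mean zero, the integral is \<pi>(h) plus the pairing of g
  with P^n h - \<pi>(h). The first term accounts for the summand 1 of \<open>C_const\<close>, the
  pairing for the rest.\<close>

lemma initial_law_bound:
  fixes h :: "'a \<Rightarrow> real" and p :: ennreal and q :: real
  assumes gap: "abs_lambda \<pi> P < 1" and ac: "absolutely_continuous \<pi> \<nu>"
    and \<nu>: "sets \<nu> = sets S" "prob_space \<nu>"
    and p: "1 < p" "Lp_norm \<pi> p (dens \<pi> \<nu>) < \<infinity>" and q: "q = conj_exponent p"
    and h: "h \<in> bmeas S" "\<And>x. x \<in> space S \<Longrightarrow> 0 \<le> h x"
  shows "(\<integral>x. kernel_pow n h x \<partial>\<nu>) \<le> C_const \<pi> P p \<nu> n * (\<integral>x. h x powr q \<partial>\<pi>) powr (1 / q)"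
proof -
  interpret \<nu>: prob_space \<nu> by fact
  define D where "D = dens \<pi> \<nu>"
  define H where "H = (\<integral>x. h x powr q \<partial>\<pi>)"
  define l where "l = enn2real (abs_lambda \<pi> P)"
  have l0: "0 \<le> l" by (simp add: l_def)
  have D0: "0 \<le> D x" for x by (simp add: D_def dens_def)
  have [measurable]: "D \<in> borel_measurable S"
    using borel_measurable_RN_deriv[of \<pi> \<nu>] unfolding D_def dens_def[abs_def] borel_measurable_pi by measurable
  note [measurable] = bmeasD[OF h(1)] bmeasD[OF kernel_pow_bmeas[OF h(1)]]
  have "AE x in \<pi>. RN_deriv \<pi> \<nu> x \<noteq> \<infinity>"
    using \<nu> ac by (intro RN_deriv_finite) (auto intro: \<nu>.sigma_finite_measure_axioms)
  then have "AE x in \<pi>. RN_deriv \<pi> \<nu> x = ennreal (D x)"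
    by eventually_elim (simp add: D_def dens_def less_top)
  then have "density \<pi> (RN_deriv \<pi> \<nu>) = density \<pi> (\<lambda>x. ennreal (D x))"
    by (intro density_cong) auto
  then have \<nu>_eq: "\<nu> = density \<pi> (\<lambda>x. ennreal (D x))"
    using density_RN_deriv[OF ac] \<nu> by simp
  have "(\<integral>\<^sup>+x. ennreal (D x) \<partial>\<pi>) = emeasure \<nu> (space S)"
    by (subst \<nu>_eq, subst emeasure_density) (auto intro!: nn_integral_cong)
  also have "\<dots> = 1"
    using \<nu>.emeasure_space_1 \<nu>(1) sets_eq_imp_space_eq[OF \<nu>(1)] by simp
  finally have D1: "(\<integral>\<^sup>+x. ennreal (D x) \<partial>\<pi>) = 1" .
  then have Di: "integrable \<pi> D"
    using D0 by (intro integrableI_nonneg) auto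
  then have "ennreal (\<integral>x. D x \<partial>\<pi>) = 1"
    using D1 D0 by (subst nn_integral_eq_integral[symmetric]) auto
  then have Dint: "(\<integral>x. D x \<partial>\<pi>) = 1" by simp
  have \<nu>_int: "(\<integral>x. kernel_pow n h x \<partial>\<nu>) = (\<integral>x. D x * kernel_pow n h x \<partial>\<pi>)"
    unfolding \<nu>_eq using D0 by (subst integral_density) auto
  show ?thesis
  proof (cases "p = \<infinity>")
    case True
    have q1: "q = 1" by (simp add: q True conj_exponent_def)
    define E where "E = enn2real (Lp_norm \<pi> \<infinity> D)"
    have "AE x in \<pi>. ennreal \<bar>D x\<bar> \<le> Lp_norm \<pi> \<infinity> D"
      unfolding Lp_norm_def by (simp add: esssup_AE)
    moreover have "Lp_norm \<pi> \<infinity> D = ennreal E"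
      using p(2) by (simp add: E_def True D_def)
    moreover have "0 \<le> E" by (simp add: E_def)
    ultimately have "AE x in \<pi>. D x \<le> E"
      using D0 by (simp add: ennreal_le_iff)
    then have "AE x in \<pi>. D x * kernel_pow n h x \<le> E * kernel_pow n h x"
      using AE_space by eventually_elim (simp add: mult_right_mono kernel_pow_nonneg h)
    then have "(\<integral>x. D x * kernel_pow n h x \<partial>\<pi>) \<le> (\<integral>x. E * kernel_pow n h x \<partial>\<pi>)"
      using Di integrable_bmeas[OF kernel_pow_bmeas[OF h(1), of n]]
      by (intro integral_mono_AE integrable_mult_bmeas kernel_pow_bmeas h) simp_all
    also have "\<dots> = E * (\<integral>x. h x \<partial>\<pi>)"
      using h by (simp add: integral_kernel_pow)
    also have "(\<integral>x. h x \<partial>\<pi>) = H"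
      unfolding H_def q1 using h by (intro Bochner_Integration.integral_cong) auto
    also have "H = H powr (1 / q)"
      unfolding q1 by (simp add: H_def)
    finally show ?thesis
      unfolding \<nu>_int H_def by (simp add: C_const_def True E_def D_def Let_def)
  next
    case False
    define r where "r = enn2real p"
    have pr: "p = ennreal r" using False by (simp add: r_def less_top)
    have r1: "1 < r" using p(1) unfolding pr by (simp add: ennreal_less_iff flip: ennreal_1)
    have qr: "q = r / (r - 1)" using False by (simp add: q conj_exponent_def r_def)
    have q1: "1 < q" using r1 by (simp add: qr)
    have conj: "1 / r + 1 / q = 1" using r1 by (simp add: qr field_simps)
    define g where "g x = D x - 1" for x
    have gm[measurable]: "g \<in> borel_measurable S" unfolding g_def[abs_def] by measurable
    have gi: "integrable \<pi> g" "(\<integral>x. g x \<partial>\<pi>) = 0"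
      using Di Dint unfolding g_def by auto
    have "(\<integral>\<^sup>+x. ennreal (\<bar>D x\<bar> powr r) \<partial>\<pi>) \<noteq> \<infinity>"
      using p(2) False by (auto simp: Lp_norm_def r_def D_def Let_def split: if_splits)
    then have Dr: "integrable \<pi> (\<lambda>x. D x powr r)"
      using D0 by (intro integrableI_nonneg) (auto simp: less_top)
    have gr: "integrable \<pi> (\<lambda>x. \<bar>g x\<bar> powr r)"
    proof (rule Bochner_Integration.integrable_bound)
      show "integrable \<pi> (\<lambda>x. D x powr r + 1)" using Dr by simp
      have "\<bar>g x\<bar> powr r \<le> D x powr r + 1" for x
      proof (cases "1 \<le> D x")
        case True
        then have "\<bar>g x\<bar> powr r \<le> D x powr r"
          using r1 by (intro powr_mono2) (auto simp: g_def)
        then show ?thesis by simp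
      next
        case False
        then have "\<bar>g x\<bar> powr r \<le> 1 powr r"
          using r1 D0[of x] by (intro powr_mono2) (auto simp: g_def)
        then show ?thesis by (simp add: add_increasing)
      qed
      then show "AE x in \<pi>. norm (\<bar>g x\<bar> powr r) \<le> norm (D x powr r + 1)"
        by (intro AE_I2) (simp add: abs_of_nonneg)
    qed measurable
    define N where "N = (\<integral>x. \<bar>g x\<bar> powr r \<partial>\<pi>) powr (1 / r)"
    have N0: "0 \<le> N" by (simp add: N_def)
    have norm: "enn2real (Lp_norm \<pi> p (\<lambda>x. dens \<pi> \<nu> x - 1)) = N"
    proof -
      have "(\<integral>\<^sup>+x. ennreal (\<bar>g x\<bar> powr r) \<partial>\<pi>) = ennreal (\<integral>x. \<bar>g x\<bar> powr r \<partial>\<pi>)"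
        using gr by (intro nn_integral_eq_integral) auto
      then show ?thesis
        using False by (simp add: Lp_norm_def r_def[symmetric] N_def g_def D_def[symmetric] Let_def)
    qed
    \<comment> \<open>Hoelder's inequality against the constant 1, which brings \<pi>(h) to the same
      norm of h as the pairing.\<close>
    have "(\<integral>x. h x * 1 \<partial>\<pi>) \<le> H powr (1 / q) * (\<integral>x. 1 powr r \<partial>\<pi>) powr (1 / r)"
      unfolding H_def using q1 r1 conj h
      by (intro integral_Holder integrable_bmeas bmeas_powr) (auto simp: add.commute)
    then have h_le: "(\<integral>x. h x \<partial>\<pi>) \<le> H powr (1 / q)"
      by simp
    define R where "R = (\<integral>x. g x * (kernel_pow n h x - (\<integral>x. h x \<partial>\<pi>)) \<partial>\<pi>)"
    have kb: "kernel_pow n h \<in> bmeas S" using h(1) by (rule kernel_pow_bmeas)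
    have "R = (\<integral>x. g x * kernel_pow n h x \<partial>\<pi>) - (\<integral>x. g x * (\<integral>x. h x \<partial>\<pi>) \<partial>\<pi>)"
      unfolding R_def right_diff_distrib using gi(1) kb
      by (intro Bochner_Integration.integral_diff integrable_mult_bmeas) auto
    also have "\<dots> = (\<integral>x. g x * kernel_pow n h x \<partial>\<pi>)"
      using gi by simp
    also have "\<dots> = (\<integral>x. D x * kernel_pow n h x - kernel_pow n h x \<partial>\<pi>)"
      by (simp add: g_def left_diff_distrib)
    also have "\<dots> = (\<integral>x. D x * kernel_pow n h x \<partial>\<pi>) - (\<integral>x. h x \<partial>\<pi>)"
      using Di kb h by (simp add: integrable_mult_bmeas integral_kernel_pow)
    finally have split: "(\<integral>x. kernel_pow n h x \<partial>\<nu>) = (\<integral>x. h x \<partial>\<pi>) + R"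
      by (simp add: \<nu>_int)
    have "R \<le> (C_const \<pi> P p \<nu> n - 1) * H powr (1 / q)"
    proof (cases "r \<le> 2")
      case True
      have q2: "2 \<le> q" using True r1 by (simp add: qr pos_le_divide_eq)
      have R: "R \<le> N * (rpow l (2 * real n / q) * H powr (1 / q))"
        using correlation_le_of_exponent_le_2[OF gap r1 q2 conj gm gr h, of n] q1 l0
        by (simp add: R_def N_def H_def rpow_eq_powr_square flip: l_def)
      show ?thesis
      proof (cases "r = 2")
        case True
        then have "q = 2" by (simp add: qr)
        then have "rpow l (2 * real n / q) = l ^ n"
          using rpow_eq_powr_square[OF l0, of q n] l0 by (simp add: powr_half_sqrt)
        moreover have "p = 2" using True pr by simp
        ultimately show ?thesis
          using R by (simp add: C_const_def Let_def norm[unfolded \<open>p = 2\<close>] l_def mult_ac)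
      next
        case False
        then have p2: "p < 2"
          using \<open>r \<le> 2\<close> r1 unfolding pr by (simp add: ennreal_less_iff flip: ennreal_numeral)
        \<comment> \<open>Interpolation gives factor 1 here; it is enlarged to the factor in
          \<open>C_const\<close>.\<close>
        have "1 \<le> (2 :: real) powr (2 / r)"
          using r1 by (intro ge_one_powr_ge_zero) auto
        then have "1 * (rpow l (2 * real n / q) * N * H powr (1 / q))
            \<le> 2 powr (2 / r) * (rpow l (2 * real n / q) * N * H powr (1 / q))"
          by (intro mult_right_mono) (auto simp: N_def rpow_def)
        then show ?thesis
          using R p2 \<open>p \<noteq> \<infinity>\<close> by (simp add: C_const_def Let_def norm l_def mult_ac flip: q r_def)
      qed
    next
      case False
      then have r2: "2 < r" by simp
      have p2: "\<not> p < 2" "p \<noteq> 2"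
        using r2 unfolding pr by (auto simp: ennreal_less_iff not_less simp flip: ennreal_numeral)
      have R: "R \<le> 2 * ((rpow l (2 * real n / r) * N) * H powr (1 / q))"
        using correlation_le_of_exponent_gt_2[OF gap r2 q1 conj gm gr h, of n] r1 l0
        by (simp add: R_def N_def H_def rpow_eq_powr_square flip: l_def)
      \<comment> \<open>Since p > 2 gives q < 2, the factor 2 from the splitting of g is at most
        2^(2/q).\<close>
      have "1 \<le> 2 / q" using r2 by (simp add: qr)
      then have "(2 :: real) powr 1 \<le> 2 powr (2 / q)"
        by (intro powr_mono) auto
      then have "2 * ((rpow l (2 * real n / r) * N) * H powr (1 / q))
          \<le> 2 powr (2 / q) * ((rpow l (2 * real n / r) * N) * H powr (1 / q))"
        by (intro mult_right_mono) (auto simp: N_def rpow_def)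
      then show ?thesis
        using R p2 \<open>p \<noteq> \<infinity>\<close> by (simp add: C_const_def Let_def norm l_def mult_ac flip: q r_def)
    qed
    then show ?thesis
      unfolding split H_def[symmetric] using h_le by (simp add: left_diff_distrib)
  qed
qed

end

subsection \<open>The chain and its tails\<close>

locale markov_chain_kernel = invariant_kernel S P \<pi>
  for S :: "'a measure" and P and \<pi> +
  fixes M :: "'w measure" and \<nu> :: "'a measure" and X :: "nat \<Rightarrow> 'w \<Rightarrow> 'a"
  assumes chain: "markov_chain M S P \<nu> X"
begin

sublocale M: prob_space M
  using chain by (simp add: markov_chain_def)

lemma X_measurable[measurable]: "1 \<le> i \<Longrightarrow> X i \<in> measurable M S"
  using chain by (simp add: markov_chain_def)

lemma X_space: "1 \<le> i \<Longrightarrow> \<omega> \<in> space M \<Longrightarrow> X i \<omega> \<in> space S"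
  by (rule measurable_space[OF X_measurable])

lemma past_generator:
  "(\<Union>i\<in>{1..k}. {X i -` A \<inter> space M |A. A \<in> sets S}) \<subseteq> sets M"
  by (auto intro!: measurable_sets[OF X_measurable])

lemma sets_past:
  "sets (past M S X k) = sigma_sets (space M) (\<Union>i\<in>{1..k}. {X i -` A \<inter> space M |A. A \<in> sets S})"
  unfolding past_def using past_generator sets.space_closed by (intro sets_measure_of) blast

lemma space_past[simp]: "space (past M S X k) = space M"
  unfolding past_def using past_generator sets.space_closed by (intro space_measure_of) blast

lemma subalgebra_past: "subalgebra M (past M S X k)"
  unfolding subalgebra_def sets_past
  using sets.sigma_sets_subset[OF past_generator] by simp

lemma subalgebra_past_Suc: "subalgebra (past M S X (Suc k)) (past M S X k)"
proof -
  have "(\<Union>i\<in>{1..k}. {X i -` A \<inter> space M |A. A \<in> sets S})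
      \<subseteq> (\<Union>i\<in>{1..Suc k}. {X i -` A \<inter> space M |A. A \<in> sets S})"
    by (intro UN_mono) auto
  then show ?thesis
    unfolding subalgebra_def sets_past by (simp only: sigma_sets_mono' space_past simp_thms)
qed

lemma X_measurable_past:
  assumes "1 \<le> k"
  shows "X k \<in> measurable (past M S X k) S"
proof (rule measurableI)
  fix A assume A: "A \<in> sets S"
  have "X k -` A \<inter> space M \<in> (\<Union>i\<in>{1..k}. {X i -` A \<inter> space M |A. A \<in> sets S})"
    using assms A by (intro UN_I[of k]) auto
  then show "X k -` A \<inter> space (past M S X k) \<in> sets (past M S X k)"
    unfolding sets_past space_past by (rule sigma_sets.Basic)
qed (use assms in \<open>simp add: X_space\<close>)

text \<open>\<open>markov_chain\<close> gives conditional probabilities of sets only. Under the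
  measure with density z they identify the law of X (Suc k) as a bind with the kernel, and
  integration against a bind extends the identity from indicators to functions.\<close>

lemma markov_property:
  assumes k: "1 \<le> k" and z: "z \<in> borel_measurable (past M S X k)"
    and zb: "\<And>\<omega>. \<omega> \<in> space M \<Longrightarrow> 0 \<le> z \<omega> \<and> z \<omega> \<le> B"
    and f: "f \<in> bmeas S" "\<And>x. x \<in> space S \<Longrightarrow> 0 \<le> f x"
  shows "(\<integral>\<omega>. z \<omega> * f (X (Suc k) \<omega>) \<partial>M) = (\<integral>\<omega>. z \<omega> * kernel_op P f (X k \<omega>) \<partial>M)"
proof -
  interpret F: finite_measure_subalgebra M "past M S X k"
    by unfold_locales (rule subalgebra_past)
  have [measurable]: "z \<in> borel_measurable M"
    by (rule measurable_from_subalg[OF subalgebra_past z])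
  have [measurable]: "X k \<in> measurable M S" "X (Suc k) \<in> measurable M S"
    using k by auto
  have [measurable]: "f \<in> borel_measurable S" using f by (auto dest: bmeasD)
  have B0: "0 \<le> B"
    using zb M.not_empty by (meson all_not_in_conv order_trans)
  define \<mu> where "\<mu> = density M (\<lambda>\<omega>. ennreal (z \<omega>))"
  have [measurable_cong]: "sets \<mu> = sets M" by (simp add: \<mu>_def)
  have step: "(\<integral>\<^sup>+\<omega>. ennreal (z \<omega>) * indicator A (X (Suc k) \<omega>) \<partial>M)
      = (\<integral>\<^sup>+\<omega>. ennreal (z \<omega>) * emeasure (P (X k \<omega>)) A \<partial>M)" if A[measurable]: "A \<in> sets S" for A
  proof -
    define Z where "Z = (\<lambda>\<omega>. indicator A (X (Suc k) \<omega>) :: real)"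
    have [measurable]: "Z \<in> borel_measurable M" unfolding Z_def by measurable
    have zi: "integrable M (\<lambda>\<omega>. z \<omega> * Z \<omega>)"
      using zb B0 by (intro M.integrable_bounded[where B = B]) (auto simp: Z_def abs_mult split: split_indicator)
    have P1: "measure (P (X k \<omega>)) A \<le> 1" if "\<omega> \<in> space M" for \<omega>
      using k that by (intro prob_space.prob_le_1 prob_space_kernel X_space)
    have mP: "(\<lambda>\<omega>. measure (P (X k \<omega>)) A) \<in> borel_measurable M"
      by (rule measurable_compose[OF measurable_compose[OF _ kernel] measurable_measure_prob_algebra]) measurable
    have zP: "integrable M (\<lambda>\<omega>. z \<omega> * measure (P (X k \<omega>)) A)"
    proof (rule M.integrable_bounded)
      fix \<omega> assume w: "\<omega> \<in> space M"
      have "z \<omega> * measure (P (X k \<omega>)) A \<le> B * 1"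
        using zb[OF w] P1[OF w] B0 by (intro mult_mono) auto
      then show "\<bar>z \<omega> * measure (P (X k \<omega>)) A\<bar> \<le> B"
        using zb[OF w] by (simp add: abs_mult)
    qed (use mP in measurable)
    have "(\<integral>\<^sup>+\<omega>. ennreal (z \<omega>) * indicator A (X (Suc k) \<omega>) \<partial>M) = (\<integral>\<^sup>+\<omega>. ennreal (z \<omega> * Z \<omega>) \<partial>M)"
      by (intro nn_integral_cong) (auto simp: Z_def split: split_indicator)
    also have "\<dots> = ennreal (\<integral>\<omega>. z \<omega> * Z \<omega> \<partial>M)"
      using zi zb by (intro nn_integral_eq_integral) (auto intro!: AE_I2 simp: Z_def)
    also have "(\<integral>\<omega>. z \<omega> * Z \<omega> \<partial>M) = (\<integral>\<omega>. z \<omega> * real_cond_exp M (past M S X k) Z \<omega> \<partial>M)"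
      using zi z by (intro F.real_cond_exp_intg(2)[symmetric]) auto
    also have "\<dots> = (\<integral>\<omega>. z \<omega> * measure (P (X k \<omega>)) A \<partial>M)"
    proof (rule integral_cong_AE)
      have "AE \<omega> in M. real_cond_exp M (past M S X k) Z \<omega> = measure (P (X k \<omega>)) A"
        using chain k A unfolding Z_def markov_chain_def by blast
      then show "AE \<omega> in M. z \<omega> * real_cond_exp M (past M S X k) Z \<omega> = z \<omega> * measure (P (X k \<omega>)) A"
        by eventually_elim simp
    qed (use mP in measurable)
    also have "ennreal \<dots> = (\<integral>\<^sup>+\<omega>. ennreal (z \<omega> * measure (P (X k \<omega>)) A) \<partial>M)"
      using zP zb by (intro nn_integral_eq_integral[symmetric]) (auto intro!: AE_I2)
    also have "\<dots> = (\<integral>\<^sup>+\<omega>. ennreal (z \<omega>) * emeasure (P (X k \<omega>)) A \<partial>M)"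
    proof (intro nn_integral_cong)
      fix \<omega> assume w: "\<omega> \<in> space M"
      then interpret Px: prob_space "P (X k \<omega>)" using k by (intro prob_space_kernel X_space)
      show "ennreal (z \<omega> * measure (P (X k \<omega>)) A) = ennreal (z \<omega>) * emeasure (P (X k \<omega>)) A"
        using zb[OF w] by (simp add: Px.emeasure_eq_measure ennreal_mult)
    qed
    finally show ?thesis .
  qed
  have ne: "space \<mu> \<noteq> {}" by (simp add: \<mu>_def M.not_empty)
  have PX: "(\<lambda>\<omega>. P (X k \<omega>)) \<in> measurable \<mu> (subprob_algebra S)" by measurable
  have "distr \<mu> S (X (Suc k)) = \<mu> \<bind> (\<lambda>\<omega>. P (X k \<omega>))"
  proof (rule measure_eqI)
    show "sets (distr \<mu> S (X (Suc k))) = sets (\<mu> \<bind> (\<lambda>\<omega>. P (X k \<omega>)))"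
      by (simp add: sets_bind_measurable[OF PX ne])
    fix A assume "A \<in> sets (distr \<mu> S (X (Suc k)))"
    then have A[measurable]: "A \<in> sets S" by simp
    have "emeasure (distr \<mu> S (X (Suc k))) A = (\<integral>\<^sup>+x. indicator A x \<partial>distr \<mu> S (X (Suc k)))"
      by simp
    also have "\<dots> = (\<integral>\<^sup>+\<omega>. ennreal (z \<omega>) * indicator A (X (Suc k) \<omega>) \<partial>M)"
      unfolding \<mu>_def by (subst nn_integral_distr, measurable, subst nn_integral_density) auto
    also have "\<dots> = (\<integral>\<^sup>+\<omega>. ennreal (z \<omega>) * emeasure (P (X k \<omega>)) A \<partial>M)"
      by (rule step[OF A])
    also have "\<dots> = (\<integral>\<^sup>+\<omega>. emeasure (P (X k \<omega>)) A \<partial>\<mu>)"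
      unfolding \<mu>_def
      by (subst nn_integral_density)
        (auto intro!: measurable_compose[OF measurable_compose[OF _ kernel_subprob] measurable_emeasure_subprob_algebra])
    also have "\<dots> = emeasure (\<mu> \<bind> (\<lambda>\<omega>. P (X k \<omega>))) A"
      by (rule emeasure_bind[OF ne PX A, symmetric])
    finally show "emeasure (distr \<mu> S (X (Suc k))) A = emeasure (\<mu> \<bind> (\<lambda>\<omega>. P (X k \<omega>))) A" .
  qed
  then have "(\<integral>\<^sup>+x. ennreal (f x) \<partial>distr \<mu> S (X (Suc k))) = (\<integral>\<^sup>+x. ennreal (f x) \<partial>(\<mu> \<bind> (\<lambda>\<omega>. P (X k \<omega>))))"
    by simp
  also have "(\<integral>\<^sup>+x. ennreal (f x) \<partial>(\<mu> \<bind> (\<lambda>\<omega>. P (X k \<omega>)))) = (\<integral>\<^sup>+\<omega>. nn_kernel (\<lambda>x. ennreal (f x)) (X k \<omega>) \<partial>\<mu>)"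
    by (rule nn_integral_bind[OF _ PX]) measurable
  also have "\<dots> = (\<integral>\<^sup>+\<omega>. ennreal (z \<omega>) * nn_kernel (\<lambda>x. ennreal (f x)) (X k \<omega>) \<partial>M)"
    unfolding \<mu>_def
    by (subst nn_integral_density) (auto intro!: measurable_compose[OF _ nn_kernel_measurable])
  also have "\<dots> = (\<integral>\<^sup>+\<omega>. ennreal (z \<omega> * kernel_op P f (X k \<omega>)) \<partial>M)"
    using zb f k by (intro nn_integral_cong) (auto simp: ennreal_mult X_space ennreal_kernel_op kernel_op_nonneg)
  also have "(\<integral>\<^sup>+x. ennreal (f x) \<partial>distr \<mu> S (X (Suc k))) = (\<integral>\<^sup>+\<omega>. ennreal (z \<omega>) * ennreal (f (X (Suc k) \<omega>)) \<partial>M)"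
    unfolding \<mu>_def by (subst nn_integral_distr, measurable, subst nn_integral_density) auto
  also have "\<dots> = (\<integral>\<^sup>+\<omega>. ennreal (z \<omega> * f (X (Suc k) \<omega>)) \<partial>M)"
    using zb f by (intro nn_integral_cong) (auto simp: ennreal_mult X_space)
  finally have eq: "(\<integral>\<^sup>+\<omega>. ennreal (z \<omega> * f (X (Suc k) \<omega>)) \<partial>M) = (\<integral>\<^sup>+\<omega>. ennreal (z \<omega> * kernel_op P f (X k \<omega>)) \<partial>M)" .
  have "(\<lambda>\<omega>. kernel_op P f (X k \<omega>)) \<in> borel_measurable M"
    by (rule measurable_compose[OF _ kernel_op_measurable]) measurable
  then show ?thesis
    using zb f k eq
    by (subst (1 2) integral_eq_nn_integral)
      (auto intro!: AE_I2 mult_nonneg_nonneg simp: X_space kernel_op_nonneg)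
qed

text \<open>The induction moves forward in time: the factor G (X k) is absorbed into z, which is
  then measurable for the past up to Suc k. This is why z, its bound and k are general.\<close>

lemma expectation_prod:
  assumes G: "G \<in> bmeas S" "\<And>x. x \<in> space S \<Longrightarrow> 0 \<le> G x"
    and k: "1 \<le> k" and z: "z \<in> borel_measurable (past M S X k)"
    and zb: "\<And>\<omega>. \<omega> \<in> space M \<Longrightarrow> 0 \<le> z \<omega> \<and> z \<omega> \<le> B"
  shows "(\<integral>\<omega>. z \<omega> * (\<Prod>i=k..k+m. G (X i \<omega>)) \<partial>M) = (\<integral>\<omega>. z \<omega> * chain_fn P G (Suc m) (X k \<omega>) \<partial>M)"
  using k z zb
proof (induction m arbitrary: k z B)
  case 0
  then show ?case
    by (intro Bochner_Integration.integral_cong) (auto simp: chain_fn_Suc X_space)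
next
  case (Suc m)
  obtain C where C: "0 \<le> C" "\<And>x. x \<in> space S \<Longrightarrow> \<bar>G x\<bar> \<le> C" using G by (metis bmeasE)
  define z' where "z' \<omega> = z \<omega> * G (X k \<omega>)" for \<omega>
  have z': "z' \<in> borel_measurable (past M S X k)"
    unfolding z'_def[abs_def] using Suc.prems(2) measurable_compose[OF X_measurable_past[OF Suc.prems(1)] bmeasD[OF G(1)]]
    by measurable
  have z'b: "0 \<le> z' \<omega> \<and> z' \<omega> \<le> B * C" if "\<omega> \<in> space M" for \<omega>
    using Suc.prems(3)[OF that] G(2)[of "X k \<omega>"] C(2)[of "X k \<omega>"] X_space[OF Suc.prems(1) that]
    by (auto simp: z'_def intro!: mult_mono)
  have "{k..k + Suc m} = insert k {Suc k..Suc k + m}" by auto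
  then have "(\<integral>\<omega>. z \<omega> * (\<Prod>i=k..k + Suc m. G (X i \<omega>)) \<partial>M) = (\<integral>\<omega>. z' \<omega> * (\<Prod>i=Suc k..Suc k + m. G (X i \<omega>)) \<partial>M)"
    by (simp add: z'_def mult.assoc)
  also have "\<dots> = (\<integral>\<omega>. z' \<omega> * chain_fn P G (Suc m) (X (Suc k) \<omega>) \<partial>M)"
    using z'b by (intro Suc.IH measurable_from_subalg[OF subalgebra_past_Suc z']) auto
  also have "\<dots> = (\<integral>\<omega>. z' \<omega> * kernel_op P (chain_fn P G (Suc m)) (X k \<omega>) \<partial>M)"
    using Suc.prems(1) z' z'b G by (intro markov_property chain_fn_bmeas chain_fn_nonneg)
  also have "\<dots> = (\<integral>\<omega>. z \<omega> * chain_fn P G (Suc (Suc m)) (X k \<omega>) \<partial>M)"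
    by (subst (2) chain_fn_Suc) (simp add: z'_def mult.assoc)
  finally show ?case .
qed

lemma expectation_kernel_pow:
  assumes f: "f \<in> bmeas S" "\<And>x. x \<in> space S \<Longrightarrow> 0 \<le> f x"
  shows "(\<integral>\<omega>. f (X (Suc n) \<omega>) \<partial>M) = (\<integral>x. kernel_pow n f x \<partial>\<nu>)"
  using f
proof (induction n arbitrary: f)
  case 0
  have "\<nu> = distr M S (X 1)" using chain by (simp add: markov_chain_def)
  then show ?case
    using 0 by (simp add: integral_distr bmeasD)
next
  case (Suc n)
  have "(\<integral>\<omega>. f (X (Suc (Suc n)) \<omega>) \<partial>M) = (\<integral>\<omega>. kernel_op P f (X (Suc n) \<omega>) \<partial>M)"
    using markov_property[of "Suc n" "\<lambda>\<omega>. 1" 1 f] Suc.prems by simp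
  also have "\<dots> = (\<integral>x. kernel_pow n (kernel_op P f) x \<partial>\<nu>)"
    using Suc.prems by (intro Suc.IH) (auto simp: kernel_op_nonneg)
  finally show ?case
    by (simp add: funpow_swap1)
qed

lemma hoeffding_mgf:
  assumes gap: "abs_lambda \<pi> P < 1" "right_lambda \<pi> P < 1"
    and ac: "absolutely_continuous \<pi> \<nu>"
    and p: "1 < p" "Lp_norm \<pi> p (dens \<pi> \<nu>) < \<infinity>" and q: "q = conj_exponent p"
    and l: "l = real_of_ereal (max (right_lambda \<pi> P) 0)" and n: "1 \<le> n"
    and f: "f \<in> borel_measurable S" "\<And>x. x \<in> space S \<Longrightarrow> f x \<in> {a..b}"
  shows "(\<integral>\<omega>. exp (t * ((\<Sum>i=n0+1..n0+n. f (X i \<omega>)) - real n * (\<integral>x. f x \<partial>\<pi>))) \<partial>M)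
    \<le> C_const \<pi> P p \<nu> n0 * exp (t\<^sup>2 / 2 * (q * alpha l * (real n * (b - a)\<^sup>2 / 4)))"
proof -
  have fbm: "f \<in> bmeas S"
    using f by (intro bmeasI[of _ _ "max \<bar>a\<bar> \<bar>b\<bar>"]) (auto, fastforce)
  define F where "F x = f x - (\<integral>x. f x \<partial>\<pi>)" for x
  have Fbm: "F \<in> bmeas S" unfolding F_def[abs_def] by (intro bmeas_diff fbm bmeas_const)
  define G where "G s x = exp (s * F x)" for s x
  have Gbm: "G s \<in> bmeas S" for s
    unfolding G_def[abs_def] by (intro bmeas_exp bmeas_mult Fbm bmeas_const)
  have Gpos: "0 < G s x" for s x by (simp add: G_def)
  have cb: "chain_fn P (G s) n \<in> bmeas S" for s by (intro chain_fn_bmeas Gbm)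
  have c0: "0 \<le> chain_fn P (G s) n x" if "x \<in> space S" for s x
    using that Gpos by (intro chain_fn_nonneg) (auto intro: less_imp_le)
  have \<nu>: "\<nu> = distr M S (X 1)" using chain by (simp add: markov_chain_def)
  have q1: "1 \<le> q"
    unfolding q using p(1) by (rule conj_exponent_ge_1)
  obtain m where m: "n = Suc m" using n by (cases n) auto
  have "(\<integral>\<omega>. exp (t * ((\<Sum>i=n0+1..n0+n. f (X i \<omega>)) - real n * (\<integral>x. f x \<partial>\<pi>))) \<partial>M)
      = (\<integral>\<omega>. 1 * (\<Prod>i=n0+1..n0+1+m. G t (X i \<omega>)) \<partial>M)"
  proof (intro Bochner_Integration.integral_cong refl)
    fix \<omega>
    have eq: "(\<Sum>i=n0+1..n0+n. f (X i \<omega>)) - real n * (\<integral>x. f x \<partial>\<pi>) = (\<Sum>i=n0+1..n0+n. F (X i \<omega>))"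
      by (simp add: F_def sum_subtractf)
    show "exp (t * ((\<Sum>i=n0+1..n0+n. f (X i \<omega>)) - real n * (\<integral>x. f x \<partial>\<pi>)))
        = 1 * (\<Prod>i=n0+1..n0+1+m. G t (X i \<omega>))"
      unfolding eq by (simp add: G_def m distrib_left sum_distrib_left exp_add exp_sum)
  qed
  also have "\<dots> = (\<integral>\<omega>. chain_fn P (G t) n (X (Suc n0) \<omega>) \<partial>M)"
    using expectation_prod[OF Gbm less_imp_le[OF Gpos], of "n0 + 1" "\<lambda>\<omega>. 1" 1 t m] by (simp add: m)
  also have "\<dots> = (\<integral>x. kernel_pow n0 (chain_fn P (G t) n) x \<partial>\<nu>)"
    using cb c0 by (intro expectation_kernel_pow)
  also have "\<dots> \<le> C_const \<pi> P p \<nu> n0 * (\<integral>x. chain_fn P (G t) n x powr q \<partial>\<pi>) powr (1 / q)"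
    using gap(1) ac p q cb c0 by (intro initial_law_bound) (auto simp: \<nu> intro: M.prob_space_distr)
  also have "\<dots> \<le> C_const \<pi> P p \<nu> n0 * exp ((q * t)\<^sup>2 / 2 * (alpha l * (real n * (b - a)\<^sup>2 / 4))) powr (1 / q)"
  proof (intro mult_left_mono powr_mono2)
    have "(\<integral>x. chain_fn P (G t) n x powr q \<partial>\<pi>) \<le> (\<integral>x. chain_fn P (\<lambda>x. G t x powr q) n x \<partial>\<pi>)"
      using q1 cb c0 Gpos Gbm
      by (intro integral_mono integrable_bmeas bmeas_powr chain_fn_powr_le chain_fn_bmeas) (auto intro: less_imp_le)
    also have "(\<lambda>x. G t x powr q) = (\<lambda>x. exp (q * t * (f x - (\<integral>x. f x \<partial>\<pi>))))"
      by (simp add: G_def F_def powr_def mult.assoc)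
    also have "(\<integral>x. chain_fn P \<dots> n x \<partial>\<pi>) \<le> exp ((q * t)\<^sup>2 / 2 * (alpha l * (real n * (b - a)\<^sup>2 / 4)))"
      by (intro hoeffding_stationary fbm f gap l)
    finally show "(\<integral>x. chain_fn P (G t) n x powr q \<partial>\<pi>) \<le> exp ((q * t)\<^sup>2 / 2 * (alpha l * (real n * (b - a)\<^sup>2 / 4)))" .
    show "0 \<le> C_const \<pi> P p \<nu> n0"
      by (auto simp: C_const_def Let_def rpow_def intro!: add_nonneg_nonneg mult_nonneg_nonneg)
  qed (use q1 in auto)
  \<comment> \<open>Replacing t by q t and taking the q-th root leaves (q t)^2 / q = q t^2, the
    origin of the factor q in the exponent.\<close>
  also have "exp ((q * t)\<^sup>2 / 2 * (alpha l * (real n * (b - a)\<^sup>2 / 4))) powr (1 / q)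
      = exp (t\<^sup>2 / 2 * (q * alpha l * (real n * (b - a)\<^sup>2 / 4)))"
    using q1 by (simp add: powr_def power2_eq_square field_simps)
  finally show ?thesis .
qed

end

text \<open>Chernoff's bound at the optimal t = s / v, for t and for -t; the union of the two events
  gives the factor 2.\<close>

lemma (in prob_space) abs_tail_le_of_mgf_le:
  fixes Y :: "'a \<Rightarrow> real"
  assumes [measurable]: "Y \<in> borel_measurable M" and int: "\<And>t. integrable M (\<lambda>\<omega>. exp (t * Y \<omega>))"
    and mgf: "\<And>t. expectation (\<lambda>\<omega>. exp (t * Y \<omega>)) \<le> C * exp (t\<^sup>2 / 2 * v)"
    and v: "0 \<le> v" and s: "0 < s"
  shows "prob {\<omega> \<in> space M. \<bar>Y \<omega>\<bar> > s} \<le> 2 * C * exp (- (s\<^sup>2 / (2 * v)))"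
proof (cases "v = 0")
  case True
  \<comment> \<open>For v = 0 the exponent is a division by zero, so the exponential is 1 and the
    bound is trivial once t = 0 has shown that C is at least 1.\<close>
  have "1 \<le> C" using mgf[of 0] by (simp add: prob_space)
  then show ?thesis by (intro order_trans[OF prob_le_1]) (simp add: True)
next
  case False
  then have v: "0 < v" using v by simp
  define t where "t = s / v"
  have t: "0 < t" using s v by (simp add: t_def)
  have tail: "prob {\<omega> \<in> space M. exp (t * s) \<le> exp (u * Y \<omega>)} \<le> C * exp (- (s\<^sup>2 / (2 * v)))"
    if "u\<^sup>2 = t\<^sup>2" for u
  proof -
    have "prob {\<omega> \<in> space M. exp (t * s) \<le> exp (u * Y \<omega>)} \<le> expectation (\<lambda>\<omega>. exp (u * Y \<omega>)) / exp (t * s)"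
      by (rule integral_Markov_inequality_measure[OF int, where A = "{}"]) auto
    also have "\<dots> \<le> C * exp (t\<^sup>2 / 2 * v) / exp (t * s)"
      using mgf[of u] that by (intro divide_right_mono) auto
    also have "\<dots> = C * exp (t\<^sup>2 / 2 * v - t * s)"
      by (simp add: exp_diff)
    also have "t\<^sup>2 / 2 * v - t * s = - (s\<^sup>2 / (2 * v))"
      using v by (simp add: t_def power2_eq_square field_simps)
    finally show ?thesis .
  qed
  have "prob {\<omega> \<in> space M. \<bar>Y \<omega>\<bar> > s}
      \<le> prob ({\<omega> \<in> space M. exp (t * s) \<le> exp (t * Y \<omega>)} \<union> {\<omega> \<in> space M. exp (t * s) \<le> exp (- t * Y \<omega>)})"
  proof (intro finite_measure_mono subsetI)
    fix \<omega> assume "\<omega> \<in> {\<omega> \<in> space M. \<bar>Y \<omega>\<bar> > s}"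
    moreover from this have "t * s \<le> t * \<bar>Y \<omega>\<bar>"
      using t by (intro mult_left_mono) auto
    ultimately show "\<omega> \<in> {\<omega> \<in> space M. exp (t * s) \<le> exp (t * Y \<omega>)} \<union> {\<omega> \<in> space M. exp (t * s) \<le> exp (- t * Y \<omega>)}"
      by (cases "0 \<le> Y \<omega>") auto
  qed measurable
  also have "\<dots> \<le> C * exp (- (s\<^sup>2 / (2 * v))) + C * exp (- (s\<^sup>2 / (2 * v)))"
    by (intro order_trans[OF measure_Un_le] add_mono tail) auto
  finally show ?thesis by simp
qed

theorem theorem6p2:
  fixes S :: "'a measure" and P :: "'a \<Rightarrow> 'a measure" and \<pi> \<nu> :: "'a measure"
    and M :: "'w measure" and X :: "nat \<Rightarrow> 'w \<Rightarrow> 'a"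
    and p :: ennreal and n0 n :: nat and f :: "'a \<Rightarrow> real" and a b q l_r :: real
  assumes "standard_Borel S"
    and "P \<in> measurable S (prob_algebra S)"
    and "invariant_prob S P \<pi>"
    and "markov_chain M S P \<nu> X"
    and "abs_lambda \<pi> P < 1"
    and "right_lambda \<pi> P < 1"
    and "absolutely_continuous \<pi> \<nu>"
    and "1 < p"
    and "Lp_norm \<pi> p (dens \<pi> \<nu>) < \<infinity>"
    and "q = conj_exponent p"
    and "l_r = real_of_ereal (max (right_lambda \<pi> P) 0)"
    and "n \<ge> 1"
    and "f \<in> borel_measurable S"
    and "\<And>x. x \<in> space S \<Longrightarrow> f x \<in> {a..b}"
  shows "(\<forall>t::real.
            (\<integral>\<omega>. exp (t * ((\<Sum>i=n0+1..n0+n. f (X i \<omega>)) - real n * (\<integral>x. f x \<partial>\<pi>))) \<partial>M)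
              \<le> C_const \<pi> P p \<nu> n0
                  * exp (t\<^sup>2 / 2 * (q * alpha l_r * (real n * (b - a)\<^sup>2 / 4)))) \<and>
         (\<forall>\<epsilon>>0.
            measure M {\<omega> \<in> space M.
                \<bar>1 / real n * (\<Sum>i=n0+1..n0+n. f (X i \<omega>)) - (\<integral>x. f x \<partial>\<pi>)\<bar> > \<epsilon>}
              \<le> 2 * C_const \<pi> P p \<nu> n0
                  * exp (- (inverse q * inverse (alpha l_r) / (2 * ((b - a)\<^sup>2 / 4)) * (real n * \<epsilon>\<^sup>2))))"
proof -
  interpret markov_chain_kernel S P \<pi> M \<nu> X
    by unfold_locales fact+
  define m where "m = (\<integral>x. f x \<partial>\<pi>)"
  define Y where "Y \<omega> = (\<Sum>i=n0+1..n0+n. f (X i \<omega>)) - real n * m" for \<omega>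
  define v where "v = q * alpha l_r * (real n * (b - a)\<^sup>2 / 4)"
  have mgf: "(\<integral>\<omega>. exp (t * Y \<omega>) \<partial>M) \<le> C_const \<pi> P p \<nu> n0 * exp (t\<^sup>2 / 2 * v)" for t
    unfolding Y_def m_def v_def by (rule hoeffding_mgf) fact+
  have fX: "(\<lambda>\<omega>. f (X i \<omega>)) \<in> bmeas M" if "1 \<le> i" for i
  proof (rule bmeasI)
    show "(\<lambda>\<omega>. f (X i \<omega>)) \<in> borel_measurable M"
      using \<open>f \<in> borel_measurable S\<close> by (rule measurable_compose[OF X_measurable[OF that]])
    show "\<bar>f (X i \<omega>)\<bar> \<le> max \<bar>a\<bar> \<bar>b\<bar>" if "\<omega> \<in> space M" for \<omega>
      using assms(14)[OF X_space[OF \<open>1 \<le> i\<close> that]] by auto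
  qed
  have Ybm: "Y \<in> bmeas M"
    unfolding Y_def[abs_def] by (intro bmeas_diff bmeas_sum bmeas_const fX) auto
  have Yexp: "integrable M (\<lambda>\<omega>. exp (t * Y \<omega>))" for t
  proof -
    have "(\<lambda>\<omega>. exp (t * Y \<omega>)) \<in> bmeas M"
      by (intro bmeas_exp bmeas_mult bmeas_const Ybm)
    then obtain B where "(\<lambda>\<omega>. exp (t * Y \<omega>)) \<in> borel_measurable M" "\<And>\<omega>. \<omega> \<in> space M \<Longrightarrow> \<bar>exp (t * Y \<omega>)\<bar> \<le> B"
      by (metis bmeasE)
    then show ?thesis by (rule M.integrable_bounded)
  qed
  have l: "0 \<le> l_r" "l_r < 1"
    using assms(6) unfolding assms(11) by (cases "right_lambda \<pi> P"; auto simp: max_def)+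
  have q: "0 < q"
    using conj_exponent_ge_1[OF assms(8)] by (simp add: assms(10))
  have v0: "0 \<le> v"
    using l q by (auto simp: v_def alpha_def intro!: mult_nonneg_nonneg)
  have tail: "measure M {\<omega> \<in> space M. \<bar>1 / real n * (\<Sum>i=n0+1..n0+n. f (X i \<omega>)) - m\<bar> > \<epsilon>}
      \<le> 2 * C_const \<pi> P p \<nu> n0
        * exp (- (inverse q * inverse (alpha l_r) / (2 * ((b - a)\<^sup>2 / 4)) * (real n * \<epsilon>\<^sup>2)))"
    if "0 < \<epsilon>" for \<epsilon>
  proof -
    have n: "0 < real n" using assms(12) by simp
    have "1 / real n * (\<Sum>i=n0+1..n0+n. f (X i \<omega>)) - m = Y \<omega> / real n" for \<omega>
      using n by (simp add: Y_def diff_divide_distrib)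
    then have "{\<omega> \<in> space M. \<bar>1 / real n * (\<Sum>i=n0+1..n0+n. f (X i \<omega>)) - m\<bar> > \<epsilon>}
        = {\<omega> \<in> space M. \<bar>Y \<omega>\<bar> > real n * \<epsilon>}"
      using n by (simp add: abs_divide pos_less_divide_eq mult.commute)
    moreover have "(real n * \<epsilon>)\<^sup>2 / (2 * v)
        = inverse q * inverse (alpha l_r) / (2 * ((b - a)\<^sup>2 / 4)) * (real n * \<epsilon>\<^sup>2)"
    proof -
      \<comment> \<open>The case w = 0, that is a = b, makes both sides divisions by zero, hence
        both 0.\<close>
      have "(u * e)\<^sup>2 / (2 * (q * A * (u * w / 4))) = inverse q * inverse A / (2 * (w / 4)) * (u * e\<^sup>2)"
        if "0 < u" "0 < A" for u e A w :: real
        using that q by (cases "w = 0") (simp_all add: field_simps power2_eq_square)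
      from this[OF n, of "alpha l_r" \<epsilon> "(b - a)\<^sup>2"] l show ?thesis
        by (simp only: v_def) (simp add: alpha_def)
    qed
    ultimately show ?thesis
      using M.abs_tail_le_of_mgf_le[OF bmeasD[OF Ybm] Yexp mgf v0, of "real n * \<epsilon>"] n that by simp
  qed
  show ?thesis
    using mgf tail unfolding Y_def v_def m_def by blast
qed

end
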